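(* The variation operator $f\mapsto\|\mathcal H_tf(x)\|_{v(2),\mathbb R_+}$, $x\in\mathbb R^n$ (variation taken in $t$), is not of strong type $(p,p)$ nor of weak type $(p,p)$ with respect to $\gamma_\infty$, for any $p\in[1,\infty)$.
   Context: Let $n\ge1$, let $Q$ be a real, symmetric, positive definite $n\times n$ matrix and $B$ a real $n\times n$ matrix all of whose eigenvalues have negative real parts. For $0<t\le+\infty$ set $Q_t=\int_0^t e^{sB}Qe^{sB^*}\,ds$, and let $\gamma_\infty$ be the Gaussian probability measure on $\mathbb R^n$ with Lebesgue density $(2\pi)^{-n/2}(\det Q_\infty)^{-1/2}\exp(-\frac12\langle Q_\infty^{-1}x,x\rangle)$. Set $R(x)=\frac12\langle Q_\infty^{-1}x,x\rangle$ and $D_t=Q_\infty e^{-tB^*}Q_\infty^{-1}$. The Ornstein--Uhlenbeck semigroup $(\mathcal H_t)_{t>0}$ is given for $f\in L^1(\gamma_\infty)$ by $\mathcal H_tf(x)=\int_{\mathbb R^n}K_t(x,u)f(u)\,d\gamma_\infty(u)$, where $$K_t(x,u)=\Big(\frac{\det Q_\infty}{\det Q_t}\Big)^{1/2}e^{R(x)}\exp\Big[-\tfrac12\big\langle(Q_t^{-1}-Q_\infty^{-1})(u-D_tx),\,u-D_tx\big\rangle\Big].$$ Here $\mathbb R_+=(0,\infty)$. For $1\le\varrho<\infty$ and a continuous real-valued function $\phi$ on an interval $I$, $\|\phi\|_{v(\varrho),I}=\sup\big(\sum_{i=1}^N|\phi(t_i)-\phi(t_{i-1})|^\varrho\big)^{1/\varrho}$,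 the supremum being over all finite increasing sequences $(t_i)_0^N$ of points in $I$; $\|\mathcal H_tf(x)\|_{v(\varrho),I}$ is this seminorm of $t\mapsto\mathcal H_tf(x)$ for fixed $x$. An operator $T$ is of strong type $(p,p)$ with respect to $\gamma_\infty$ if $\|Tf\|_{L^p(\gamma_\infty)}\le C\|f\|_{L^p(\gamma_\infty)}$ for some $C<\infty$ and all $f\in L^p(\gamma_\infty)$, and of weak type $(p,p)$ if $\gamma_\infty\{|Tf|>\alpha\}\le C\alpha^{-p}\|f\|_{L^p(\gamma_\infty)}^p$ for some $C<\infty$, all $\alpha>0$ and all $f\in L^p(\gamma_\infty)$. *)

theory Defs
  imports "HOL-Analysis.Analysis"
begin

text \<open>The product \<open>*\<close> and hence \<open>^\<close> and \<^const>\<open>exp\<close> on \<^typ>\<open>real^'n^'n\<close> are not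
  the matrix operations, so powers and the exponential are built from \<open>**\<close>.\<close>

definition matrix_exp :: "real^'n^'n \<Rightarrow> real^'n^'n" where
  "matrix_exp A = (\<Sum>k. (1 / fact k) *\<^sub>R (((**) A ^^ k) (mat 1)))"

definition positive_definite :: "real^'n^'n \<Rightarrow> bool" where
  "positive_definite A \<longleftrightarrow> (\<forall>x. x \<noteq> 0 \<longrightarrow> 0 < (A *v x) \<bullet> x)"

text \<open>Complex eigenvalues of a real matrix.\<close>

definition complex_eigenvalue :: "real^'n^'n \<Rightarrow> complex \<Rightarrow> bool" where
  "complex_eigenvalue A z \<longleftrightarrow>
     (\<exists>v :: complex^'n. v \<noteq> 0 \<and> (\<chi> i j. complex_of_real (A $ i $ j)) *v v = z *s v)"

text \<open>\<open>Q\<^sub>t\<close> for \<open>0 < t \<le> \<infinity>\<close>, as a Bochner integral in the space of matrices;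
  \<open>t\<close> is extended real so that \<open>Q\<^sub>\<infinity>\<close> is the case \<open>t = \<infinity>\<close>.\<close>

definition ou_cov :: "real^'n^'n \<Rightarrow> real^'n^'n \<Rightarrow> ereal \<Rightarrow> real^'n^'n" where
  "ou_cov Q B t =
     (LINT s:{s. 0 \<le> s \<and> ereal s \<le> t}|lborel.
        matrix_exp (s *\<^sub>R B) ** Q ** matrix_exp (s *\<^sub>R transpose B))"

abbreviation ou_cov_inf :: "real^'n^'n \<Rightarrow> real^'n^'n \<Rightarrow> real^'n^'n" where
  "ou_cov_inf Q B \<equiv> ou_cov Q B \<infinity>"

definition ou_R :: "real^'n^'n \<Rightarrow> real^'n^'n \<Rightarrow> real^'n \<Rightarrow> real" where
  "ou_R Q B x = (1/2) * ((matrix_inv (ou_cov_inf Q B) *v x) \<bullet> x)"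

definition ou_measure :: "real^'n^'n \<Rightarrow> real^'n^'n \<Rightarrow> (real^'n) measure" where
  "ou_measure Q B =
     density lborel (\<lambda>x. ennreal
       ((2 * pi) powr (- real CARD('n) / 2) * det (ou_cov_inf Q B) powr (- 1/2) *
        exp (- (1/2) * ((matrix_inv (ou_cov_inf Q B) *v x) \<bullet> x))))"

definition ou_D :: "real^'n^'n \<Rightarrow> real^'n^'n \<Rightarrow> real \<Rightarrow> real^'n^'n" where
  "ou_D Q B t =
     ou_cov_inf Q B ** matrix_exp ((- t) *\<^sub>R transpose B) ** matrix_inv (ou_cov_inf Q B)"

definition ou_kernel :: "real^'n^'n \<Rightarrow> real^'n^'n \<Rightarrow> real \<Rightarrow> real^'n \<Rightarrow> real^'n \<Rightarrow> real" where
  "ou_kernel Q B t x u =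
     (det (ou_cov_inf Q B) / det (ou_cov Q B (ereal t))) powr (1/2) * exp (ou_R Q B x) *
     exp (- (1/2) *
       (((matrix_inv (ou_cov Q B (ereal t)) - matrix_inv (ou_cov_inf Q B)) *v (u - ou_D Q B t *v x))
         \<bullet> (u - ou_D Q B t *v x)))"

definition ou_semigroup ::
    "real^'n^'n \<Rightarrow> real^'n^'n \<Rightarrow> real \<Rightarrow> (real^'n \<Rightarrow> real) \<Rightarrow> real^'n \<Rightarrow> real" where
  "ou_semigroup Q B t f x = (LINT u|ou_measure Q B. ou_kernel Q B t x u * f u)"

definition variation :: "real \<Rightarrow> real set \<Rightarrow> (real \<Rightarrow> real) \<Rightarrow> ennreal" where
  "variation r I \<phi> =
     (SUP (N, t) \<in> {(N :: nat, t :: nat \<Rightarrow> real). strict_mono_on {0..N} t \<and> t ` {0..N} \<subseteq> I}.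
        ennreal ((\<Sum>i=1..N. \<bar>\<phi> (t i) - \<phi> (t (i - 1))\<bar> powr r) powr (1/r)))"

definition ou_variation ::
    "real^'n^'n \<Rightarrow> real^'n^'n \<Rightarrow> real \<Rightarrow> (real^'n \<Rightarrow> real) \<Rightarrow> real^'n \<Rightarrow> ennreal" where
  "ou_variation Q B r f x = variation r {0<..} (\<lambda>t. ou_semigroup Q B t f x)"

text \<open>Real powers on \<open>[0,\<infinity>]\<close>, intended for exponents \<open>a > 0\<close>.\<close>

definition ennreal_powr :: "ennreal \<Rightarrow> real \<Rightarrow> ennreal" where
  "ennreal_powr x a = (if x = \<infinity> then \<infinity> else ennreal (enn2real x powr a))"

definition Lp_norm :: "'a measure \<Rightarrow> real \<Rightarrow> ('a \<Rightarrow> ennreal) \<Rightarrow> ennreal" where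
  "Lp_norm M p g = ennreal_powr (\<integral>\<^sup>+ x. ennreal_powr (g x) p \<partial>M) (1/p)"

definition Lp_functions :: "'a measure \<Rightarrow> real \<Rightarrow> ('a \<Rightarrow> real) set" where
  "Lp_functions M p = {f \<in> borel_measurable M. Lp_norm M p (\<lambda>x. ennreal \<bar>f x\<bar>) < \<infinity>}"

text \<open>Operators take values in \<open>[0,\<infinity>]\<close>, since the variation may be infinite.\<close>

definition strong_type :: "'a measure \<Rightarrow> real \<Rightarrow> (('a \<Rightarrow> real) \<Rightarrow> 'a \<Rightarrow> ennreal) \<Rightarrow> bool" where
  "strong_type M p T \<longleftrightarrow>
     (\<exists>C::real. \<forall>f \<in> Lp_functions M p.
        Lp_norm M p (T f) \<le> ennreal C * Lp_norm M p (\<lambda>x. ennreal \<bar>f x\<bar>))"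

definition weak_type :: "'a measure \<Rightarrow> real \<Rightarrow> (('a \<Rightarrow> real) \<Rightarrow> 'a \<Rightarrow> ennreal) \<Rightarrow> bool" where
  "weak_type M p T \<longleftrightarrow>
     (\<exists>C::real. \<forall>\<alpha>>0. \<forall>f \<in> Lp_functions M p.
        emeasure M {x \<in> space M. T f x > ennreal \<alpha>}
          \<le> ennreal C * ennreal (\<alpha> powr (- p)) *
             ennreal_powr (Lp_norm M p (\<lambda>x. ennreal \<bar>f x\<bar>)) p)"

end

theory Submission
  imports Defs "HOL-Probability.Distributions" "HOL-Computational_Algebra.Fundamental_Theorem_Algebra"
begin

text \<open>
  Along a fixed partition the sum of the squared increments of a martingale is controlled by its
  \<open>L\<^sup>2\<close> norm.  The seminorm \<open>v(2)\<close> lets the partition depend on the path, and then the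
  control is lost already for the simple random walk: for a walk of
  \<open>N\<close> independent signs, the largest sum of squared increments over all partitions is not
  \<open>O(N)\<close> in probability.  The proof plants a long random walk in the semigroup.

  Let \<open>r\<^sub>m(x)\<close> be the square wave \<open>(-1)\<close> to the power \<open>\<lfloor>m x\<^sub>i\<rfloor>\<close>.  For fixed \<open>t > 0\<close>
  the smoothing kernel does not see fast oscillations, so \<open>H\<^sub>t r\<^sub>m \<longrightarrow> 0\<close> as \<open>m \<longrightarrow> \<infinity>\<close>
  (\<open>riemann_lebesgue_square_wave\<close>); for fixed \<open>m\<close>, \<open>H\<^sub>t r\<^sub>m \<longrightarrow> \<kappa> r\<^sub>m\<close> almost everywhere as
  \<open>t \<longrightarrow> 0\<close>, where \<open>\<kappa> > 0\<close> is the total mass of a Gaussian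
  (\<open>ou_semigroup_tendsto_at_0\<close>).  Choosing in turn a frequency \<open>m\<^sub>1\<close>, a time \<open>t\<^sub>1\<close>, a much
  larger frequency \<open>m\<^sub>2\<close>, a much smaller time \<open>t\<^sub>2\<close>, and so on, and letting \<open>f\<close> be
  the sum of the first \<open>N\<close> of these waves divided by \<open>sqrt N\<close>, makes the semigroup at time
  \<open>t\<^sub>k\<close> map \<open>f\<close> to nearly \<open>\<kappa>\<close> times its \<open>k\<close>-th normalised
  partial sum.  The same weak convergence of \<open>r\<^sub>m\<close> to \<open>0\<close>, now tested against
  functions of the earlier waves, makes the signs nearly independent and fair under the invariant
  measure (\<open>exists_simulates\<close>).  So \<open>f\<close> has bounded \<open>L\<^sup>p\<close> norms, as normalised
  sums of signs are sub-Gaussian, while \<open>t \<mapsto> H\<^sub>t f(x)\<close> follows a random walk as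
  \<open>t\<close> decreases.

  For the walk, fix \<open>M\<close> and cut \<open>{0..N}\<close> dyadically.  Going down from the top, select a
  block as soon as its sum \<open>S\<close> satisfies \<open>S\<^sup>2 \<ge> M\<close> times its length.  The selected blocks
  are disjoint, and if they cover half of all steps then they yield a sum of squares of at least
  \<open>M N / 2\<close>.  A step stays uncovered only if no block around it is selected; but given one
  half of a block, the independent other half pushes the block over the threshold with a
  probability bounded below by some \<open>\<delta> > 0\<close>, so each further scale reduces the expected
  uncovered proportion by a factor \<open>1 - \<delta>\<close> (\<open>sign_avg_uncovered\<close>).

  The analytic facts rest on one identity: the kernel times the invariant density is the Gaussian
  density with mean \<open>exp(tB) x\<close> and covariance \<open>Q\<^sub>t\<close> (\<open>kernel_times_density\<close>).  It
  follows from \<open>Q\<^sub>\<infinity> = Q\<^sub>t + exp(tB) Q\<^sub>\<infinity> exp(tB)\<^sup>T\<close>, which needs the integral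
  defining \<open>Q\<^sub>\<infinity>\<close> to converge, hence the exponential decay of \<open>exp(tB)\<close>.
\<close>

section \<open>Averages over random signs\<close>

text \<open>The expectation of \<open>F\<close> over \<open>n\<close> independent fair signs.  Defining it by recursion on the
  first sign keeps all probability on the walk elementary and matches the later construction, which
  adds one sign at the head of the list at a time.\<close>

fun sign_avg :: "nat \<Rightarrow> (real list \<Rightarrow> real) \<Rightarrow> real" where
  "sign_avg 0 F = F []"
| "sign_avg (Suc n) F = (sign_avg n (\<lambda>xs. F (1 # xs)) + sign_avg n (\<lambda>xs. F (-1 # xs))) / 2"

lemma sign_avg_mono:
  assumes "\<And>xs. length xs = n \<Longrightarrow> F xs \<le> G xs"
  shows "sign_avg n F \<le> sign_avg n G"
  using assms
proof (induction n arbitrary: F G)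
  case (Suc n)
  have "sign_avg n (\<lambda>xs. F (a # xs)) \<le> sign_avg n (\<lambda>xs. G (a # xs))" for a
    by (rule Suc.IH) (simp add: Suc.prems)
  from add_mono[OF this[of 1] this[of "-1"]] show ?case by simp
qed auto

lemma sign_avg_cong:
  assumes "\<And>xs. length xs = n \<Longrightarrow> F xs = G xs"
  shows "sign_avg n F = sign_avg n G"
  by (intro antisym sign_avg_mono) (simp_all add: assms)

lemma sign_avg_add: "sign_avg n (\<lambda>xs. F xs + G xs) = sign_avg n F + sign_avg n G"
  by (induction n arbitrary: F G) (auto simp: field_simps)

lemma sign_avg_cmult: "sign_avg n (\<lambda>xs. c * F xs) = c * sign_avg n F"
  by (induction n arbitrary: F) (auto simp: field_simps)

lemma sign_avg_multc: "sign_avg n (\<lambda>xs. F xs * c) = sign_avg n F * c"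
  using sign_avg_cmult[of n c F] by (simp add: mult.commute)

lemma sign_avg_const: "sign_avg n (\<lambda>xs. c) = c"
  by (induction n) auto

lemma sign_avg_diff: "sign_avg n (\<lambda>xs. F xs - G xs) = sign_avg n F - sign_avg n G"
  using sign_avg_add[of n F "\<lambda>xs. (-1) * G xs"] unfolding sign_avg_cmult by simp

text \<open>Independence of the first \<open>m\<close> from the last \<open>n\<close> signs.\<close>

lemma sign_avg_append:
  "sign_avg (m + n) F = sign_avg m (\<lambda>xs. sign_avg n (\<lambda>ys. F (xs @ ys)))"
  by (induction m arbitrary: F) auto

lemma sign_avg_swap:
  "sign_avg m (\<lambda>xs. sign_avg n (\<lambda>ys. F xs ys)) = sign_avg n (\<lambda>ys. sign_avg m (\<lambda>xs. F xs ys))"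
proof (induction m arbitrary: F)
  case (Suc m)
  have "sign_avg n (\<lambda>ys. sign_avg (Suc m) (\<lambda>xs. F xs ys))
      = sign_avg n (\<lambda>ys. (sign_avg m (\<lambda>xs. F (1 # xs) ys) + sign_avg m (\<lambda>xs. F (-1 # xs) ys)) * (1/2))"
    by simp
  also have "\<dots> = sign_avg (Suc m) (\<lambda>xs. sign_avg n (\<lambda>ys. F xs ys))"
    unfolding sign_avg_multc sign_avg_add by (simp add: Suc.IH)
  finally show ?case ..
qed simp

lemma sign_avg_neg: "sign_avg n (\<lambda>xs. F (map uminus xs)) = sign_avg n F"
proof (induction n arbitrary: F)
  case (Suc n)
  show ?case
    using Suc.IH[of "\<lambda>xs. F (1 # xs)"] Suc.IH[of "\<lambda>xs. F (-1 # xs)"] by simp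
qed simp

lemma sum_list_map_uminus: "sum_list (map uminus xs) = - sum_list (xs :: real list)"
  by (induction xs) auto

lemma sign_avg_sum_sq: "sign_avg n (\<lambda>xs. (sum_list xs)\<^sup>2) = n"
proof (induction n)
  case (Suc n)
  have "sign_avg (Suc n) (\<lambda>xs. (sum_list xs)\<^sup>2)
      = sign_avg n (\<lambda>xs. (1 + sum_list xs)\<^sup>2 + (-1 + sum_list xs)\<^sup>2) / 2"
    by (simp add: sign_avg_add)
  also have "\<dots> = sign_avg n (\<lambda>xs. 2 * (sum_list xs)\<^sup>2 + 2) / 2"
    by (intro arg_cong2[where f="(/)"] sign_avg_cong refl) (simp add: power2_eq_square algebra_simps)
  finally show ?case by (simp add: sign_avg_add sign_avg_cmult sign_avg_const Suc)
qed auto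

lemma sign_avg_sum_fourth: "sign_avg n (\<lambda>xs. (sum_list xs)^4) \<le> 3 * (real n)\<^sup>2"
proof (induction n)
  case (Suc n)
  have "sign_avg (Suc n) (\<lambda>xs. (sum_list xs)^4)
      = sign_avg n (\<lambda>xs. (1 + sum_list xs)^4 + (-1 + sum_list xs)^4) / 2"
    by (simp add: sign_avg_add)
  also have "\<dots> = sign_avg n (\<lambda>xs. 2 * (sum_list xs)^4 + (12 * (sum_list xs)\<^sup>2 + 2)) / 2"
    by (intro arg_cong2[where f="(/)"] sign_avg_cong refl)
      (simp add: power2_eq_square power4_eq_xxxx algebra_simps)
  also have "\<dots> = sign_avg n (\<lambda>xs. (sum_list xs)^4) + 6 * n + 1"
    by (simp add: sign_avg_add sign_avg_cmult sign_avg_const sign_avg_sum_sq)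
  finally have "sign_avg (Suc n) (\<lambda>xs. (sum_list xs)^4) = sign_avg n (\<lambda>xs. (sum_list xs)^4) + 6 * real n + 1"
    by simp
  moreover have "3 * (real (Suc n))\<^sup>2 = 3 * (real n)\<^sup>2 + 6 * real n + 3"
    by (simp add: power2_eq_square algebra_simps)
  ultimately show ?case using Suc by linarith
qed auto

text \<open>A second and fourth moment argument in the spirit of Paley and Zygmund: with \<open>z = S\<^sup>2 / n\<close> the
  quadratic \<open>z/2 - z\<^sup>2/16 - 1/8\<close> is at most \<open>1\<close> everywhere and at most \<open>0\<close> for
  \<open>0 \<le> z \<le> 1/4\<close>, so it lies below the indicator of \<open>z \<ge> 1/4\<close>, and its mean is at least
  \<open>1/2 - 3/16 - 1/8 = 3/16\<close>.  By symmetry half of this belongs to positive sums.\<close>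

lemma sign_avg_half_tail:
  assumes "n \<ge> 1"
  shows "3 / 32 \<le> sign_avg n (\<lambda>xs. of_bool (sqrt n / 2 \<le> sum_list xs))"
proof -
  let ?S = "sum_list :: real list \<Rightarrow> real"
  have n: "real n > 0" using assms by simp
  have pt: "(1/2) / n * (?S xs)\<^sup>2 + (- (1/16) / n\<^sup>2 * (?S xs)^4 + (-1/8))
      \<le> of_bool (sqrt n / 2 \<le> ?S xs) + of_bool (sqrt n / 2 \<le> ?S (map uminus xs))" for xs
  proof -
    define z where "z = (?S xs)\<^sup>2 / n"
    have e: "(1/2) / n * (?S xs)\<^sup>2 + (- (1/16) / n\<^sup>2 * (?S xs)^4 + (-1/8)) = z/2 - z\<^sup>2/16 - 1/8"
      by (simp add: z_def power_divide power2_eq_square power4_eq_xxxx)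
    show ?thesis
    proof (cases "z \<ge> 1/4")
      case True
      then have "(sqrt n / 2)\<^sup>2 \<le> (?S xs)\<^sup>2"
        using n by (simp add: z_def field_simps power_divide)
      then have "sqrt n / 2 \<le> \<bar>?S xs\<bar>" using abs_le_square_iff[of "sqrt n / 2" "?S xs"] n by simp
      moreover have "z/2 - z\<^sup>2/16 - 1/8 \<le> 1"
        using zero_le_power2[of "z - 4"] by (simp add: power2_eq_square algebra_simps)
      ultimately show ?thesis unfolding e by (auto simp: sum_list_map_uminus abs_if split: if_splits)
    next
      case False
      moreover have "z \<ge> 0" by (simp add: z_def)
      ultimately have "z/2 - z\<^sup>2/16 - 1/8 \<le> 0" using zero_le_power2[of z] by linarith
      then show ?thesis unfolding e by auto
    qed
  qed
  have "3/16 \<le> (1/2) / n * n + (- (1/16) / n\<^sup>2 * (3 * (real n)\<^sup>2) + (-1/8))"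
    using n by simp
  also have "\<dots> \<le> (1/2) / n * n + (- (1/16) / n\<^sup>2 * sign_avg n (\<lambda>xs. (?S xs)^4) + (-1/8))"
    by (intro add_mono mult_left_mono_neg order.refl sign_avg_sum_fourth) simp
  also have "\<dots> = sign_avg n (\<lambda>xs. (1/2) / n * (?S xs)\<^sup>2 + (- (1/16) / n\<^sup>2 * (?S xs)^4 + (-1/8)))"
    unfolding sign_avg_add sign_avg_cmult sign_avg_const sign_avg_sum_sq ..
  also have "\<dots> \<le> sign_avg n (\<lambda>xs. of_bool (sqrt n / 2 \<le> ?S xs) + of_bool (sqrt n / 2 \<le> ?S (map uminus xs)))"
    by (intro sign_avg_mono pt)
  also have "\<dots> = 2 * sign_avg n (\<lambda>xs. of_bool (sqrt n / 2 \<le> ?S xs))"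
    unfolding sign_avg_add using sign_avg_neg[of n "\<lambda>xs. of_bool (sqrt n / 2 \<le> ?S xs)"] by simp
  finally show ?thesis by simp
qed

text \<open>Ask each of \<open>R\<close> independent stretches of length \<open>k\<close> to have a sum of typical size.\<close>

lemma sign_avg_tail:
  assumes "k \<ge> 1"
  shows "(3/32)^R \<le> sign_avg (R * k) (\<lambda>xs. of_bool (R * (sqrt k / 2) \<le> sum_list xs))"
proof (induction R)
  case (Suc R)
  let ?a = "sqrt k / 2"
  have "(3/32)^Suc R \<le> sign_avg k (\<lambda>xs. of_bool (?a \<le> sum_list xs)) *
     sign_avg (R * k) (\<lambda>xs. of_bool (R * ?a \<le> sum_list xs))"
    unfolding power_Suc using sign_avg_half_tail[OF assms] Suc by (intro mult_mono) auto
  also have "\<dots> = sign_avg k (\<lambda>xs. sign_avg (R * k) (\<lambda>ys. of_bool (?a \<le> sum_list xs) * of_bool (R * ?a \<le> sum_list ys)))"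
    by (simp add: sign_avg_multc sign_avg_cmult)
  also have "\<dots> \<le> sign_avg k (\<lambda>xs. sign_avg (R * k) (\<lambda>ys. of_bool (Suc R * ?a \<le> sum_list (xs @ ys))))"
    by (intro sign_avg_mono) (auto simp: field_simps)
  also have "\<dots> = sign_avg (Suc R * k) (\<lambda>xs. of_bool (Suc R * ?a \<le> sum_list xs))"
    using sign_avg_append[of k "R * k"] by simp
  finally show ?case .
qed auto

text \<open>Exceeding \<open>sqrt (2Mn)\<close> has a probability that is bounded below uniformly in the length
  \<open>n\<close>: cut into \<open>w \<ge> 8M\<close> stretches, as \<open>w * (sqrt (n/w) / 2) = sqrt (w n) / 2 \<ge> sqrt (2Mn)\<close>.
  The shift \<open>s\<close> plays the contribution of an already known neighbouring half block: whatever its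
  sign, a large sum of the same sign carries the total over the threshold.  The factor \<open>2\<close>
  is there because the threshold of the doubled block has to be exceeded by one half alone.\<close>

lemma sign_avg_large_deviation:
  assumes "M > 0"
  obtains w \<delta> where "w \<ge> (1::nat)" "0 < \<delta>" "\<delta> < (1::real)"
    "\<And>l s. sign_avg (w * 2^l) (\<lambda>xs. of_bool ((s + sum_list xs)\<^sup>2 < 2 * M * (real w * 2^l))) \<le> 1 - \<delta>"
proof -
  define R where "R = nat \<lceil>8 * M\<rceil>"
  have R: "real R \<ge> 8 * M" "R \<ge> 1" using assms unfolding R_def by linarith+
  show ?thesis
  proof (rule that[of R "(3/32)^R"])
    show "(3/32::real)^R < 1" using R by (simp add: power_less_one_iff)
    fix l :: nat and s :: real
    let ?n = "R * 2^l"
    let ?T = "sqrt (2 * M * ?n)"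
    have T: "?T \<le> R * (sqrt (2^l) / 2)"
    proof (rule real_le_lsqrt)
      have "2 * M * ?n \<le> (R / 4) * (R * 2^l)" using R assms by (simp add: mult_right_mono)
      also have "\<dots> = (R * (sqrt (2^l) / 2))\<^sup>2"
        by (simp add: power_mult_distrib power_divide power2_eq_square)
      finally show "2 * M * ?n \<le> (R * (sqrt (2^l) / 2))\<^sup>2" .
    qed auto
    have up: "(3/32)^R \<le> sign_avg ?n (\<lambda>xs. of_bool (?T \<le> sum_list xs))"
    proof (rule order.trans[OF sign_avg_tail[of "2^l" R]])
      show "sign_avg ?n (\<lambda>xs. of_bool (R * (sqrt (2^l :: nat) / 2) \<le> sum_list xs))
          \<le> sign_avg ?n (\<lambda>xs. of_bool (?T \<le> sum_list xs))"
        using T by (intro sign_avg_mono) auto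
    qed simp
    have dn: "(3/32)^R \<le> sign_avg ?n (\<lambda>xs. of_bool (?T \<le> - sum_list xs))"
      using up sign_avg_neg[of ?n "\<lambda>xs. of_bool (?T \<le> sum_list xs)"] by (simp add: sum_list_map_uminus)
    have sq: "2 * M * ?n \<le> x\<^sup>2" if "?T \<le> \<bar>x\<bar>" for x :: real
      using abs_le_square_iff[of ?T x] that assms by simp
    have "(3/32)^R \<le> sign_avg ?n (\<lambda>xs. 1 - of_bool ((s + sum_list xs)\<^sup>2 < 2 * M * ?n))"
    proof (cases "s \<ge> 0")
      case True
      have "?T \<le> sum_list xs \<Longrightarrow> \<not> (s + sum_list xs)\<^sup>2 < 2 * M * ?n" for xs
        using sq[of "s + sum_list xs"] True by linarith
      then show ?thesis by (intro order.trans[OF up] sign_avg_mono) auto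
    next
      case False
      have "?T \<le> - sum_list xs \<Longrightarrow> \<not> (s + sum_list xs)\<^sup>2 < 2 * M * ?n" for xs
        using sq[of "s + sum_list xs"] False by linarith
      then show ?thesis by (intro order.trans[OF dn] sign_avg_mono) auto
    qed
    then show "sign_avg ?n (\<lambda>xs. of_bool ((s + sum_list xs)\<^sup>2 < 2 * M * (real R * 2^l))) \<le> 1 - (3/32)^R"
      by (simp add: sign_avg_diff sign_avg_const)
  qed (use R in auto)
qed

lemma sign_avg_exp: "sign_avg n (\<lambda>xs. exp (c * sum_list xs)) = (cosh c)^n"
proof (induction n)
  case (Suc n)
  have "sign_avg (Suc n) (\<lambda>xs. exp (c * sum_list xs))
     = (sign_avg n (\<lambda>xs. exp c * exp (c * sum_list xs)) + sign_avg n (\<lambda>xs. exp (-c) * exp (c * sum_list xs))) / 2"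
    by (simp add: distrib_left exp_add exp_diff exp_minus field_simps)
  also have "\<dots> = cosh c * (cosh c)^n"
    unfolding sign_avg_cmult Suc by (simp add: cosh_def algebra_simps)
  finally show ?case by simp
qed simp

lemma cosh_le_exp_square:
  assumes "0 \<le> c" "c \<le> (1::real)"
  shows "cosh c \<le> exp (c\<^sup>2)"
proof -
  have 1: "exp c \<le> 1 + c + c\<^sup>2" using exp_bound assms by simp
  have "1 + c \<le> exp c" by simp
  then have "exp (-c) \<le> 1 / (1 + c)" using assms by (simp add: exp_minus field_simps)
  also have "1 / (1 + c) \<le> 1 - c + c\<^sup>2"
    using assms by (simp add: field_simps power2_eq_square)
  finally have "cosh c \<le> 1 + c\<^sup>2" using 1 by (simp add: cosh_def)
  also have "\<dots> \<le> exp (c\<^sup>2)" by simp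
  finally show ?thesis .
qed

text \<open>Normalised sums of signs are sub-Gaussian: their exponential moments are bounded independently of
  \<open>N\<close>, and \<open>\<bar>s\<bar> powr p\<close> is dominated by \<open>exp s + exp (- s)\<close>.\<close>

lemma sign_avg_moment:
  assumes "p \<ge> 1"
  obtains C where "C \<ge> 0" "\<And>N. N \<ge> 1 \<Longrightarrow> sign_avg N (\<lambda>xs. \<bar>sum_list xs / sqrt N\<bar> powr p) \<le> C"
proof -
  obtain q where q: "real q \<ge> p" using real_arch_simple by blast
  have pt: "\<bar>s\<bar> powr p \<le> 1 + fact q * (exp s + exp (-s))" for s :: real
  proof (cases "\<bar>s\<bar> \<le> 1")
    case True
    have "\<bar>s\<bar> powr p \<le> 1" using assms True powr_le1[of p "\<bar>s\<bar>"] by simp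
    then show ?thesis by (simp add: add_increasing2)
  next
    case False
    then have "\<bar>s\<bar> powr p \<le> \<bar>s\<bar> powr q" using q by (intro powr_mono) auto
    also have "\<dots> = \<bar>s\<bar>^q" using False by (subst powr_realpow) auto
    also have "\<dots> = fact q * (\<bar>s\<bar>^q / fact q)" by simp
    also have "\<bar>s\<bar>^q / fact q \<le> exp \<bar>s\<bar>"
    proof -
      have "(\<lambda>n. \<bar>s\<bar>^n / fact n) sums exp \<bar>s\<bar>"
        using exp_converges[of "\<bar>s\<bar>"] by (simp add: divide_inverse mult.commute)
      from sums_unique[OF this] sum_le_suminf[OF sums_summable[OF this], of "{q}"]
      show ?thesis by simp
    qed
    also have "exp \<bar>s\<bar> \<le> exp s + exp (-s)" by (simp add: abs_if)
    finally show ?thesis by simp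
  qed
  have "sign_avg N (\<lambda>xs. \<bar>sum_list xs / sqrt N\<bar> powr p) \<le> 1 + fact q * (2 * exp 1)" if N: "N \<ge> 1" for N
  proof -
    let ?c = "1 / sqrt N"
    have c: "0 \<le> ?c" "?c \<le> 1" "?c\<^sup>2 = 1 / N" using N by (auto simp: power_divide)
    have E: "(cosh ?c)^N \<le> exp 1"
    proof -
      have "(cosh ?c)^N \<le> (exp (?c\<^sup>2))^N"
        using c cosh_le_exp_square[of ?c] by (intro power_mono) auto
      also have "\<dots> = exp 1" using N unfolding c by (simp flip: exp_of_nat_mult)
      finally show ?thesis .
    qed
    have "sign_avg N (\<lambda>xs. \<bar>sum_list xs / sqrt N\<bar> powr p)
       \<le> sign_avg N (\<lambda>xs. 1 + fact q * (exp (?c * sum_list xs) + exp ((- ?c) * sum_list xs)))"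
      by (rule sign_avg_mono, rule order.trans[OF pt]) simp
    also have "\<dots> = 1 + fact q * ((cosh ?c)^N + (cosh ?c)^N)"
      unfolding sign_avg_add sign_avg_cmult sign_avg_const sign_avg_exp by simp
    also have "\<dots> \<le> 1 + fact q * (2 * exp 1)" using E by simp
    finally show ?thesis .
  qed
  then show ?thesis by (intro that[of "1 + fact q * (2 * exp 1)"]) auto
qed

section \<open>Dyadic blocks with large sums\<close>

text \<open>The number of steps left over when, from the top down, every dyadic block whose sum has square at
  least \<open>M\<close> times its length is selected and removed.  Blocks of level \<open>l\<close> have length
  \<open>w * 2^l\<close>.\<close>

fun uncovered :: "nat \<Rightarrow> real \<Rightarrow> nat \<Rightarrow> real list \<Rightarrow> real" where
  "uncovered w M 0 xs = (if (sum_list xs)\<^sup>2 < M * w then w else 0)"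
| "uncovered w M (Suc l) xs = (if (sum_list xs)\<^sup>2 < M * (real w * 2^Suc l)
     then uncovered w M l (take (w * 2^l) xs) + uncovered w M l (drop (w * 2^l) xs) else 0)"

lemma uncovered_nonneg: "0 \<le> uncovered w M l xs"
  by (induction l arbitrary: xs) auto

text \<open>A step of the left half that is uncovered inside that half stays uncovered only if the whole block is
  not selected either.  Given the left half, this has probability at most \<open>1 - \<delta>\<close>, by the randomness of
  the right half alone; the same holds with the halves exchanged.\<close>

lemma sign_avg_uncovered:
  assumes \<delta>: "\<delta> \<le> (1::real)"
    and dev: "\<And>l s. sign_avg (w * 2^l) (\<lambda>xs. of_bool ((s + sum_list xs)\<^sup>2 < 2 * M * (real w * 2^l))) \<le> 1 - \<delta>"
  shows "sign_avg (w * 2^l) (uncovered w M l) \<le> (1 - \<delta>)^l * (real w * 2^l)"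
proof (induction l)
  case 0
  have "sign_avg w (uncovered w M 0) \<le> sign_avg w (\<lambda>_. real w)" by (intro sign_avg_mono) auto
  then show ?case by (simp add: sign_avg_const del: uncovered.simps)
next
  case (Suc l)
  let ?n = "w * 2^l" and ?u = "uncovered w M l"
  have dbl: "w * 2^Suc l = ?n + ?n" by simp
  \<comment> \<open>The event that the block made of the two halves is not selected.\<close>
  let ?I = "\<lambda>xs ys. of_bool ((sum_list xs + sum_list ys)\<^sup>2 < 2 * M * (real w * 2^l)) :: real"
  have half: "sign_avg ?n (\<lambda>xs. sign_avg ?n (\<lambda>ys. ?u xs * ?I xs ys)) \<le> (1 - \<delta>) * sign_avg ?n ?u"
  proof -
    have "sign_avg ?n (\<lambda>xs. sign_avg ?n (\<lambda>ys. ?u xs * ?I xs ys)) \<le> sign_avg ?n (\<lambda>xs. ?u xs * (1 - \<delta>))"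
      unfolding sign_avg_cmult by (intro sign_avg_mono mult_left_mono dev uncovered_nonneg)
    also have "\<dots> = (1 - \<delta>) * sign_avg ?n ?u" by (subst sign_avg_multc) (rule mult.commute)
    finally show ?thesis .
  qed
  have "sign_avg (w * 2^Suc l) (uncovered w M (Suc l))
      = sign_avg ?n (\<lambda>xs. sign_avg ?n (\<lambda>ys. uncovered w M (Suc l) (xs @ ys)))"
    using sign_avg_append[of ?n ?n "uncovered w M (Suc l)"] by (simp only: dbl)
  also have "\<dots> = sign_avg ?n (\<lambda>xs. sign_avg ?n (\<lambda>ys. ?u xs * ?I xs ys + ?u ys * ?I ys xs))"
    by (intro sign_avg_cong) (auto simp: algebra_simps)
  also have "\<dots> = 2 * sign_avg ?n (\<lambda>xs. sign_avg ?n (\<lambda>ys. ?u xs * ?I xs ys))"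
    using sign_avg_swap[of ?n ?n "\<lambda>xs ys. ?u ys * ?I ys xs"] by (simp add: sign_avg_add)
  also have "\<dots> \<le> 2 * ((1 - \<delta>) * ((1 - \<delta>)^l * (real w * 2^l)))"
    using half Suc mult_left_mono[OF Suc, of "1 - \<delta>"] \<delta> by auto
  finally show ?case by (simp add: mult_ac del: uncovered.simps)
qed

lemma sign_avg_mostly_covered:
  assumes "M > 0"
  obtains w l where "w \<ge> (1::nat)"
    "sign_avg (w * 2^l) (\<lambda>xs. of_bool (uncovered w M l xs \<le> real w * 2^l / 2)) \<ge> 1/2"
proof -
  from sign_avg_large_deviation[OF assms] obtain w \<delta> where w: "w \<ge> (1::nat)" "0 < \<delta>" "\<delta> < (1::real)" and
    dev: "\<And>l s. sign_avg (w * 2^l) (\<lambda>xs. of_bool ((s + sum_list xs)\<^sup>2 < 2 * M * (real w * 2^l))) \<le> 1 - \<delta>"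
    by metis
  obtain l where l: "(1 - \<delta>)^l < 1/4" using real_arch_pow_inv[of "1/4" "1 - \<delta>"] w by auto
  let ?n = "w * 2^l"
  have n: "real ?n > 0" using w by simp
  have "sign_avg ?n (\<lambda>xs. 1 - of_bool (uncovered w M l xs \<le> real w * 2^l / 2))
      \<le> sign_avg ?n (\<lambda>xs. (2 / ?n) * uncovered w M l xs)"
    using n uncovered_nonneg[of w M l] by (intro sign_avg_mono) (auto simp: field_simps)
  also have "\<dots> \<le> (2 / ?n) * ((1 - \<delta>)^l * ?n)"
    unfolding sign_avg_cmult using sign_avg_uncovered[of \<delta> w M l, OF _ dev] w
    by (intro mult_left_mono) auto
  also have "\<dots> \<le> 1/2" using l n by simp
  finally show ?thesis using w by (intro that[of w l]) (auto simp: sign_avg_diff sign_avg_const)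
qed

lemma sum_list_drop_conv_sum: "sum_list (drop k xs) = (\<Sum>j<length xs. if k \<le> j then xs ! j else (0::real))"
proof -
  have "(\<Sum>j<length xs. if k \<le> j then xs ! j else 0) = (\<Sum>j\<in>{k..<length xs}. xs ! j)"
    by (rule sum.mono_neutral_cong_right) auto
  also have "\<dots> = (\<Sum>j\<in>{0..<length xs - k}. xs ! (k + j))"
    by (rule sum.reindex_bij_witness[of _ "\<lambda>j. k + j" "\<lambda>j. j - k"]) auto
  also have "\<dots> = sum_list (drop k xs)" by (simp add: sum_list_sum_nth)
  finally show ?thesis ..
qed

text \<open>The largest sum of squared increments of \<open>y\<close> over partitions of \<open>{j..j + w * 2^l}\<close> into dyadic
  blocks.\<close>

fun block_var :: "nat \<Rightarrow> nat \<Rightarrow> nat \<Rightarrow> (nat \<Rightarrow> real) \<Rightarrow> real" where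
  "block_var w 0 j y = (y (j + w) - y j)\<^sup>2"
| "block_var w (Suc l) j y =
     max ((y (j + w * 2^Suc l) - y j)\<^sup>2) (block_var w l j y + block_var w l (j + w * 2^l) y)"

text \<open>Keep the selected blocks: each contributes at least \<open>M\<close> per step.  The sums of the tails
  \<open>drop k xs\<close> take the place of partial sums since, in the application, later list positions
  correspond to larger times and lower frequencies.\<close>

lemma block_var_ge_covered:
  assumes "M \<ge> 0" "length xs = w * 2^l" "\<And>k. k \<le> w * 2^l \<Longrightarrow> y (j + k) - y (j + w * 2^l) = sum_list (drop k xs)"
  shows "block_var w l j y \<ge> M * (real w * 2^l - uncovered w M l xs)"
  using assms
proof (induction l arbitrary: j xs)
  case 0
  from 0(3)[of 0] have "y j - y (j + w) = sum_list xs" by simp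
  then have "(y (j + w) - y j)\<^sup>2 = (sum_list xs)\<^sup>2" by (metis power2_commute)
  then show ?case using 0 by (simp)
next
  case (Suc l)
  let ?h = "w * 2^l"
  have len: "length xs = ?h + ?h" using Suc.prems(2) by simp
  have dbl: "w * 2^Suc l = ?h + ?h" by simp
  note y = Suc.prems(3)
  from y[of 0] have "y j - y (j + w * 2^Suc l) = sum_list xs" by simp
  then have sq: "(y (j + w * 2^Suc l) - y j)\<^sup>2 = (sum_list xs)\<^sup>2" by (metis power2_commute)
  show ?case
  proof (cases "(sum_list xs)\<^sup>2 < M * (real w * 2^Suc l)")
    case False
    then show ?thesis using sq by simp
  next
    case True
    have left: "M * (real w * 2^l - uncovered w M l (take ?h xs)) \<le> block_var w l j y"
    proof (rule Suc.IH[OF Suc.prems(1)])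
      show "length (take ?h xs) = w * 2^l" using len by simp
      fix k assume k: "k \<le> w * 2^l"
      have "drop k (take ?h xs @ drop ?h xs) = drop k (take ?h xs) @ drop ?h xs"
        using k len by (subst drop_append) simp
      then have "sum_list (drop k xs) = sum_list (drop k (take ?h xs)) + sum_list (drop ?h xs)"
        unfolding append_take_drop_id by simp
      then show "y (j + k) - y (j + w * 2^l) = sum_list (drop k (take ?h xs))"
        using y[of k] y[of ?h] k by simp
    qed
    have right: "M * (real w * 2^l - uncovered w M l (drop ?h xs)) \<le> block_var w l (j + ?h) y"
    proof (rule Suc.IH[OF Suc.prems(1)])
      show "length (drop ?h xs) = w * 2^l" using len by simp
      fix k assume k: "k \<le> w * 2^l"
      show "y (j + ?h + k) - y (j + ?h + w * 2^l) = sum_list (drop k (drop ?h xs))"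
        using y[of "?h + k", unfolded dbl] k unfolding dbl by (simp add: algebra_simps)
    qed
    have "M * (real w * 2^Suc l - uncovered w M (Suc l) xs)
        = M * (real w * 2^l - uncovered w M l (take ?h xs)) + M * (real w * 2^l - uncovered w M l (drop ?h xs))"
      using True by (simp add: algebra_simps)
    then show ?thesis using left right by simp
  qed
qed

lemma block_var_cmult: "block_var w l j (\<lambda>k. c * y k) = c\<^sup>2 * block_var w l j y"
proof (induction l arbitrary: j)
  case (Suc l)
  have "(c * y (j + w * 2 ^ Suc l) - c * y j)\<^sup>2 = c\<^sup>2 * (y (j + w * 2 ^ Suc l) - y j)\<^sup>2"
    by (simp add: power_mult_distrib flip: right_diff_distrib)
  then show ?case using Suc by (simp add: max_mult_distrib_left flip: distrib_left)
qed (simp add: power_mult_distrib flip: right_diff_distrib)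

text \<open>Every squared increment loses at most half of itself and \<open>4 * \<eta>\<^sup>2\<close>, and at most \<open>2^l\<close> blocks
  occur.\<close>

lemma block_var_perturb:
  assumes "\<And>k. k \<le> w * 2^l \<Longrightarrow> \<bar>z (j + k) - y (j + k)\<bar> \<le> \<eta>"
  shows "block_var w l j z \<ge> block_var w l j y / 2 - 4 * \<eta>\<^sup>2 * 2^l"
  using assms
proof (induction l arbitrary: j)
  have step: "(z a - z b)\<^sup>2 \<ge> (y a - y b)\<^sup>2 / 2 - 4 * \<eta>\<^sup>2"
    if "\<bar>z a - y a\<bar> \<le> \<eta>" "\<bar>z b - y b\<bar> \<le> \<eta>" for a b
  proof -
    let ?e = "(z a - z b) - (y a - y b)"
    have "\<bar>?e\<bar> \<le> \<bar>2 * \<eta>\<bar>" using that by linarith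
    then have "?e\<^sup>2 \<le> (2 * \<eta>)\<^sup>2" by (simp add: abs_le_square_iff)
    moreover have "(y a - y b)\<^sup>2 \<le> 2 * (z a - z b)\<^sup>2 + 2 * ?e\<^sup>2"
      using zero_le_power2[of "(z a - z b) + ?e"] by (simp add: power2_eq_square algebra_simps)
    ultimately show ?thesis by (simp add: power_mult_distrib)
  qed
  {
    case 0
    show ?case using step[of "j + w" j] 0[of w] 0[of 0] by simp
  next
    case (Suc l)
    have 1: "(z (j + w * 2^Suc l) - z j)\<^sup>2 \<ge> (y (j + w * 2^Suc l) - y j)\<^sup>2 / 2 - 4 * \<eta>\<^sup>2 * 2^Suc l"
    proof -
      have "4 * \<eta>\<^sup>2 * 1 \<le> 4 * \<eta>\<^sup>2 * 2^Suc l" by (intro mult_left_mono) (auto simp del: power_Suc)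
      then show ?thesis
        using step[of "j + w * 2^Suc l" j] Suc.prems[of "w * 2^Suc l"] Suc.prems[of 0] by simp
    qed
    have 2: "block_var w l j z \<ge> block_var w l j y / 2 - 4 * \<eta>\<^sup>2 * 2^l"
      by (rule Suc.IH, rule Suc.prems) simp
    have 3: "block_var w l (j + w * 2^l) z \<ge> block_var w l (j + w * 2^l) y / 2 - 4 * \<eta>\<^sup>2 * 2^l"
      by (rule Suc.IH) (use Suc.prems[of "w * 2^l + _"] in \<open>simp add: add.assoc\<close>)
    show ?case using 1 2 3 by (auto simp: max_def algebra_simps)
  }
qed

lemma block_var_partition:
  assumes "w \<ge> 1"
  shows "\<exists>L n. n 0 = j \<and> n L = j + w * 2^l \<and> (\<forall>i<L. n i < n (Suc i)) \<and>
    block_var w l j y = (\<Sum>i<L. (y (n (Suc i)) - y (n i))\<^sup>2)"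
proof (induction l arbitrary: j)
  case 0
  show ?case using assms by (intro exI[of _ 1] exI[of _ "\<lambda>i. j + i * w"]) auto
next
  case (Suc l)
  show ?case
  proof (cases "(y (j + w * 2^Suc l) - y j)\<^sup>2 \<ge> block_var w l j y + block_var w l (j + w * 2^l) y")
    case True
    then show ?thesis using assms
      by (intro exI[of _ 1] exI[of _ "\<lambda>i. j + i * (w * 2^Suc l)"]) auto
  next
    case False
    from Suc.IH[of j] obtain L1 n1 where 1: "n1 0 = j" "n1 L1 = j + w * 2^l" "\<forall>i<L1. n1 i < n1 (Suc i)"
      "block_var w l j y = (\<Sum>i<L1. (y (n1 (Suc i)) - y (n1 i))\<^sup>2)" by blast
    from Suc.IH[of "j + w * 2^l"] obtain L2 n2 where 2: "n2 0 = j + w * 2^l" "n2 L2 = j + w * 2^l + w * 2^l"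
      "\<forall>i<L2. n2 i < n2 (Suc i)"
      "block_var w l (j + w * 2^l) y = (\<Sum>i<L2. (y (n2 (Suc i)) - y (n2 i))\<^sup>2)" by blast
    define n where "n i = (if i < L1 then n1 i else n2 (i - L1))" for i
    have nL: "n i = n1 i" if "i \<le> L1" for i using that 1 2 by (auto simp: n_def)
    have nR: "n (L1 + i) = n2 i" for i by (simp add: n_def)
    have "(\<Sum>i<L1 + L2. (y (n (Suc i)) - y (n i))\<^sup>2)
        = (\<Sum>i<L1. (y (n (Suc i)) - y (n i))\<^sup>2) + (\<Sum>i<L2. (y (n (L1 + Suc i)) - y (n (L1 + i)))\<^sup>2)"
      by (induction L2) auto
    also have "\<dots> = block_var w l j y + block_var w l (j + w * 2^l) y"
      unfolding nR 1 2 by (simp add: nL)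
    finally have S: "(\<Sum>i<L1 + L2. (y (n (Suc i)) - y (n i))\<^sup>2) = block_var w (Suc l) j y"
      using False by simp
    have mono: "n i < n (Suc i)" if "i < L1 + L2" for i
    proof (cases "i < L1")
      case True
      then show ?thesis using 1 by (simp add: nL)
    next
      case False
      then obtain k where "i = L1 + k" using le_Suc_ex not_less by blast
      then show ?thesis using 2 that nR[of k] nR[of "Suc k"] by simp
    qed
    show ?thesis
      by (intro exI[of _ "L1 + L2"] exI[of _ n]) (use S mono 1 2 nL[of 0] nR[of L2] in \<open>auto simp: algebra_simps\<close>)
  qed
qed

lemma variation_ge_block_var:
  assumes w: "w \<ge> 1" and \<tau>: "strict_mono_on {0..w * 2^l} \<tau>" "\<tau> ` {0..w * 2^l} \<subseteq> I"
  shows "ennreal (sqrt (block_var w l 0 (\<lambda>k. \<phi> (\<tau> k)))) \<le> variation 2 I \<phi>"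
proof -
  obtain L n where n: "n 0 = 0" "n L = w * 2^l" "\<forall>i<L. n i < n (Suc i)"
    and bv: "block_var w l 0 (\<lambda>k. \<phi> (\<tau> k)) = (\<Sum>i<L. (\<phi> (\<tau> (n (Suc i))) - \<phi> (\<tau> (n i)))\<^sup>2)"
    using block_var_partition[OF w, of 0 l "\<lambda>k. \<phi> (\<tau> k)"] unfolding add_0 by blast
  have less: "n i < n k" if "i < k" "k \<le> L" for i k
    using that
  proof (induction k)
    case (Suc k)
    then show ?case using n(3)[rule_format, of k] by (cases "i = k") auto
  qed simp
  have le: "n i \<le> w * 2^l" if "i \<le> L" for i
    using less[of i L] n(2) that by (cases "i = L") auto
  let ?t = "\<lambda>i. \<tau> (n i)"
  have "(L, ?t) \<in> {(N :: nat, t :: nat \<Rightarrow> real). strict_mono_on {0..N} t \<and> t ` {0..N} \<subseteq> I}"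
  proof (clarsimp, intro conjI strict_mono_onI image_subsetI)
    fix r s assume "r \<in> {0..L}" "s \<in> {0..L}" "r < s"
    then show "?t r < ?t s" using less[of r s] le by (intro strict_mono_onD[OF \<tau>(1)]) auto
  qed (use le \<tau>(2) in auto)
  then have "(case (L, ?t) of (N, t) \<Rightarrow>
      ennreal ((\<Sum>i=1..N. \<bar>\<phi> (t i) - \<phi> (t (i - 1))\<bar> powr 2) powr (1/2))) \<le> variation 2 I \<phi>"
    unfolding variation_def by (rule SUP_upper)
  moreover have "(\<Sum>i=1..L. \<bar>\<phi> (?t i) - \<phi> (?t (i - 1))\<bar> powr 2)
      = (\<Sum>i<L. (\<phi> (\<tau> (n (Suc i))) - \<phi> (\<tau> (n i)))\<^sup>2)"
    by (rule sum.reindex_bij_witness[of _ Suc "\<lambda>i. i - 1"]) (auto simp: powr_numeral)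
  moreover have "0 \<le> (\<Sum>i<L. (\<phi> (\<tau> (n (Suc i))) - \<phi> (\<tau> (n i)))\<^sup>2)" by (intro sum_nonneg) auto
  ultimately show ?thesis unfolding bv by (simp add: powr_half_sqrt)
qed

section \<open>The matrix exponential\<close>

lemma bounded_bilinear_matrix_mult:
  "bounded_bilinear ((**) :: real^'n^'m \<Rightarrow> real^'k^'n \<Rightarrow> real^'k^'m)"
  unfolding bilinear_conv_bounded_bilinear[symmetric] bilinear_def
  by (auto intro!: linearI simp: vec_eq_iff matrix_matrix_mult_def distrib_right distrib_left sum.distrib sum_distrib_left mult_ac)

lemma bounded_bilinear_matrix_vector_mult:
  "bounded_bilinear ((*v) :: real^'n^'m \<Rightarrow> real^'n \<Rightarrow> real^'m)"
  unfolding bilinear_conv_bounded_bilinear[symmetric] bilinear_def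
  by (auto intro!: linearI simp: matrix_vector_right_distrib matrix_vector_mult_add_rdistrib
      scaleR_matrix_vector_assoc[symmetric] matrix_vector_mult_scaleR)

lemma bounded_linear_transpose: "bounded_linear (transpose :: real^'n^'m \<Rightarrow> real^'m^'n)"
  by (auto intro!: linearI simp: linear_conv_bounded_linear[symmetric] transpose_def vec_eq_iff)

lemmas matrix_mult_bilinear_simps =
  bounded_bilinear.add_left[OF bounded_bilinear_matrix_mult]
  bounded_bilinear.add_right[OF bounded_bilinear_matrix_mult]
  bounded_bilinear.diff_left[OF bounded_bilinear_matrix_mult]
  bounded_bilinear.diff_right[OF bounded_bilinear_matrix_mult]
  bounded_bilinear.scaleR_left[OF bounded_bilinear_matrix_mult]
  bounded_bilinear.scaleR_right[OF bounded_bilinear_matrix_mult]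

abbreviation mpow :: "real^'n^'n \<Rightarrow> nat \<Rightarrow> real^'n^'n" where
  "mpow A k \<equiv> ((**) A ^^ k) (mat 1)"

lemma mpow_scaleR: "mpow (t *\<^sub>R A) k = t^k *\<^sub>R mpow A k"
  by (induction k) (auto simp: matrix_mult_bilinear_simps)

lemma mpow_commute: "A ** mpow A k = mpow A k ** A"
  by (induction k) (auto simp: matrix_mul_assoc)

lemma transpose_mpow: "transpose (mpow A k) = mpow (transpose A) k"
  by (induction k) (auto simp: matrix_transpose_mul mpow_commute)

lemma mpow_norm_le:
  fixes A :: "real^'n^'n"
  obtains c K where "c \<ge> 0" "K \<ge> 0" "\<And>k. norm (mpow A k) \<le> c * K^k"
proof -
  obtain K where K: "\<And>(X :: real^'n^'n) (Y :: real^'n^'n). norm (X ** Y) \<le> norm X * norm Y * K" "K \<ge> 0"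
    using bounded_bilinear.nonneg_bounded[OF bounded_bilinear_matrix_mult] by blast
  have "norm (mpow A k) \<le> norm (mat 1 :: real^'n^'n) * (norm A * K)^k" for k
  proof (induction k)
    case (Suc k)
    have "norm (mpow A (Suc k)) \<le> norm A * norm (mpow A k) * K" using K(1)[of A "mpow A k"] by simp
    also have "\<dots> \<le> norm A * (norm (mat 1 :: real^'n^'n) * (norm A * K)^k) * K"
      using Suc K by (intro mult_right_mono mult_left_mono) auto
    finally show ?case by (simp add: mult_ac)
  qed simp
  then show ?thesis using K by (intro that[of "norm (mat 1 :: real^'n^'n)" "norm A * K"]) auto
qed

lemma summable_matrix_exp_norm: "summable (\<lambda>k. norm ((1 / fact k) *\<^sub>R mpow (A :: real^'n^'n) k))"
proof -
  obtain c K where c: "c \<ge> 0" "K \<ge> 0" "\<And>k. norm (mpow A k) \<le> c * K^k" using mpow_norm_le[of A] by blast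
  show ?thesis
  proof (rule summable_comparison_test'[of "\<lambda>k. c * (inverse (fact k) * K^k)"])
    show "summable (\<lambda>k. c * (inverse (fact k) * K^k))" by (intro summable_mult summable_exp)
    show "norm (norm ((1 / fact k) *\<^sub>R mpow A k)) \<le> c * (inverse (fact k) * K^k)" for k
      using mult_left_mono[OF c(3)[of k], of "inverse (fact k)"] by (simp add: field_simps)
  qed
qed

lemma summable_matrix_exp: "summable (\<lambda>k. (1 / fact k) *\<^sub>R mpow (A :: real^'n^'n) k)"
  using summable_matrix_exp_norm by (rule summable_norm_cancel)

text \<open>Entries, inner products and matrix products of \<open>matrix_exp A\<close> are all bounded linear in it, so that
  identities for the exponential can be checked on the powers of \<open>A\<close>.\<close>

lemma bounded_linear_matrix_exp:
  assumes "bounded_linear L"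
  shows "L (matrix_exp (A :: real^'n^'n)) = (\<Sum>k. (1 / fact k) *\<^sub>R L (mpow A k))"
    and "summable (\<lambda>k. (1 / fact k) *\<^sub>R L (mpow A k))"
proof -
  interpret bounded_linear L by fact
  show "L (matrix_exp A) = (\<Sum>k. (1 / fact k) *\<^sub>R L (mpow A k))"
    unfolding matrix_exp_def by (subst suminf[OF summable_matrix_exp]) (simp add: scaleR)
  show "summable (\<lambda>k. (1 / fact k) *\<^sub>R L (mpow A k))"
    using summable[OF summable_matrix_exp[of A]] by (simp add: scaleR)
qed

lemma matrix_exp_zero: "matrix_exp (0 :: real^'n^'n) = mat 1"
proof -
  have "(1 / fact k) *\<^sub>R mpow (0 :: real^'n^'n) k = (if k = 0 then mat 1 else 0)" for k
    by (cases k) auto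
  then show ?thesis unfolding matrix_exp_def by (simp add: sums_unique[OF sums_single[of 0 "\<lambda>_. mat 1"], symmetric])
qed

lemma matrix_exp_commute: "A ** matrix_exp (t *\<^sub>R A) = matrix_exp (t *\<^sub>R (A :: real^'n^'n)) ** A"
  using bounded_linear_matrix_exp(1)[OF bounded_bilinear.bounded_linear_right[OF bounded_bilinear_matrix_mult], of A "t *\<^sub>R A"]
    bounded_linear_matrix_exp(1)[OF bounded_bilinear.bounded_linear_left[OF bounded_bilinear_matrix_mult], of "t *\<^sub>R A" A]
  by (simp add: mpow_scaleR matrix_mult_bilinear_simps mpow_commute)

lemma transpose_matrix_exp: "transpose (matrix_exp A) = matrix_exp (transpose (A :: real^'n^'n))"
  by (subst bounded_linear_matrix_exp(1)[OF bounded_linear_transpose]) (simp add: transpose_mpow matrix_exp_def)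

text \<open>Each coordinate is an everywhere convergent real power series, which can be differentiated term by
  term.\<close>

lemma matrix_exp_has_vector_derivative:
  "((\<lambda>t. matrix_exp (t *\<^sub>R A)) has_vector_derivative A ** matrix_exp (t *\<^sub>R A)) (at t within S)"
  for A :: "real^'n^'n"
proof (rule has_vector_derivative_at_within)
  show "((\<lambda>t. matrix_exp (t *\<^sub>R A)) has_vector_derivative A ** matrix_exp (t *\<^sub>R A)) (at t)"
    unfolding has_vector_derivative_def
  proof (subst has_derivative_componentwise_within, intro ballI)
    fix i :: "real^'n^'n"
    define c where "c k = (mpow A k \<bullet> i) / fact k" for k
    have bl: "bounded_linear (\<lambda>X :: real^'n^'n. X \<bullet> i)" by (rule bounded_linear_inner_left)
    have eq: "matrix_exp (s *\<^sub>R A) \<bullet> i = (\<Sum>k. c k * s^k)" and sm: "summable (\<lambda>k. c k * s^k)" for s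
      using bounded_linear_matrix_exp[OF bl, of "s *\<^sub>R A"] by (simp_all add: c_def mpow_scaleR mult_ac)
    have bl': "bounded_linear (\<lambda>X :: real^'n^'n. (A ** X) \<bullet> i)"
      by (rule bounded_linear_compose[OF bl bounded_bilinear.bounded_linear_right[OF bounded_bilinear_matrix_mult]])
    have "diffs c k = (A ** mpow A k) \<bullet> i / fact k" for k
      by (simp add: diffs_def c_def field_simps del: of_nat_Suc)
    then have eq': "(A ** matrix_exp (t *\<^sub>R A)) \<bullet> i = (\<Sum>k. diffs c k * t^k)"
      using bounded_linear_matrix_exp(1)[OF bl', of "t *\<^sub>R A"]
      by (simp add: mpow_scaleR matrix_mult_bilinear_simps mult_ac)
    have "((\<lambda>s. \<Sum>k. c k * s^k) has_field_derivative (\<Sum>k. diffs c k * t^k)) (at t)"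
      by (rule termdiffs_strong_converges_everywhere[OF sm])
    then show "((\<lambda>s. matrix_exp (s *\<^sub>R A) \<bullet> i) has_derivative (\<lambda>s. s *\<^sub>R (A ** matrix_exp (t *\<^sub>R A)) \<bullet> i)) (at t)"
      unfolding eq eq'[symmetric] has_field_derivative_def by (simp add: mult_commute_abs)
  qed
qed

lemma continuous_on_matrix_exp: "continuous_on S (\<lambda>t. matrix_exp (t *\<^sub>R (A :: real^'n^'n)))"
  by (rule continuous_on_vector_derivative) (rule matrix_exp_has_vector_derivative)

text \<open>The function \<open>r \<mapsto> exp (rA) exp ((s + t - r)A)\<close> has derivative zero because \<open>A\<close> commutes with
  its exponential.\<close>

lemma matrix_exp_add:
  fixes A :: "real^'n^'n"
  shows "matrix_exp ((s + t) *\<^sub>R A) = matrix_exp (s *\<^sub>R A) ** matrix_exp (t *\<^sub>R A)"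
proof -
  let ?E = "\<lambda>t. matrix_exp (t *\<^sub>R A)"
  define G where "G r = ?E r ** ?E (s + t - r)" for r
  have "(G has_vector_derivative 0) (at r within UNIV)" for r
  proof -
    have 1: "((\<lambda>r. ?E (s + t - r)) has_vector_derivative (-1) *\<^sub>R (A ** ?E (s + t - r))) (at r)"
    proof -
      have "((\<lambda>r. s + t - r) has_vector_derivative -1) (at r)"
        by (auto intro!: derivative_eq_intros)
      from vector_diff_chain_at[of "\<lambda>r. s + t - r" "-1" r ?E, OF this matrix_exp_has_vector_derivative]
      show ?thesis by (simp add: o_def)
    qed
    have "(G has_vector_derivative
        ?E r ** ((-1) *\<^sub>R (A ** ?E (s + t - r))) + (A ** ?E r) ** ?E (s + t - r)) (at r)"
      unfolding G_def
      by (rule bounded_bilinear.has_vector_derivative[OF bounded_bilinear_matrix_mult matrix_exp_has_vector_derivative 1])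
    then show ?thesis
      by (simp add: bounded_bilinear.minus_right[OF bounded_bilinear_matrix_mult] matrix_exp_commute flip: matrix_mul_assoc)
  qed
  then have "G s = G 0"
    using has_vector_derivative_zero_constant[of UNIV G] by (metis UNIV_I convex_UNIV)
  then show ?thesis by (simp add: G_def matrix_exp_zero)
qed

lemma matrix_exp_inverse:
  fixes A :: "real^'n^'n"
  shows "matrix_exp (s *\<^sub>R A) ** matrix_exp ((-s) *\<^sub>R A) = mat 1"
    and "matrix_exp ((-s) *\<^sub>R A) ** matrix_exp (s *\<^sub>R A) = mat 1"
  using matrix_exp_add[of s "-s" A] matrix_exp_add[of "-s" s A] by (simp_all add: matrix_exp_zero)

section \<open>Exponential decay for stable matrices\<close>

text \<open>Eigenvalues are complex, so the decay of the real exponential is studied on its complexification.\<close>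

abbreviation cmat :: "real^'n^'n \<Rightarrow> complex^'n^'n" where
  "cmat A \<equiv> (\<chi> i j. complex_of_real (A $ i $ j))"

lemma cmat_mult: "cmat (A ** B) = cmat A ** cmat (B :: real^'n^'n)"
  by (simp add: vec_eq_iff matrix_matrix_mult_def)

lemma cmat_mat: "cmat (mat 1) = mat 1"
  by (simp add: vec_eq_iff mat_def)

lemma bounded_linear_cmat_mult: "bounded_linear (\<lambda>X. cmat (X :: real^'n^'n) *v v)"
proof -
  have "linear (\<lambda>X. cmat (X :: real^'n^'n) *v v)"
    by (rule linearI) (simp_all add: vec_eq_iff matrix_vector_mult_def algebra_simps sum.distrib scaleR_sum_right sum_distrib_left scaleR_conv_of_real[where 'a = complex])
  then show ?thesis by (simp add: linear_conv_bounded_linear)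
qed

definition shifted :: "real^'n^'n \<Rightarrow> complex \<Rightarrow> complex^'n \<Rightarrow> complex^'n" where
  "shifted B z v = cmat B *v v - z *s v"

definition decays :: "real^'n^'n \<Rightarrow> complex^'n \<Rightarrow> bool" where
  "decays B v \<longleftrightarrow> (\<exists>C c. c > 0 \<and> (\<forall>t\<ge>0. norm (cmat (matrix_exp (t *\<^sub>R B)) *v v) \<le> C * exp (- c * t)))"

lemma cmat_exp_shifted:
  "cmat (matrix_exp (t *\<^sub>R B)) *v shifted B z v = shifted B z (cmat (matrix_exp (t *\<^sub>R B)) *v v)"
  by (simp add: shifted_def matrix_vector_mult_diff_distrib matrix_vector_mul_assoc vector_scalar_commute
      matrix_exp_commute flip: cmat_mult)

lemma shifted_commute: "shifted B z (shifted B w v) = shifted B w (shifted B z v)"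
  by (simp add: shifted_def matrix_vector_mult_diff_distrib vector_scalar_commute algebra_simps vec_eq_iff)

text \<open>The function \<open>u(t) = exp(tB) v\<close> solves \<open>u' = z u + exp(tB) (B - z) v\<close> with a forcing
  term that decays.  Hence the derivative of \<open>y = exp(- z t) u\<close>, and with it \<open>y\<close> itself, grows at a smaller
  exponential rate than \<open>exp(- Re z t)\<close>, so that \<open>u = exp(z t) y\<close> decays.\<close>

lemma decays_if_shifted_decays:
  fixes B :: "real^'n^'n"
  assumes z: "Re z < 0" and "decays B (shifted B z v)"
  shows "decays B v"
proof -
  let ?E = "\<lambda>t. cmat (matrix_exp (t *\<^sub>R B))"
  obtain C c0 where c0: "c0 > 0" and C: "\<And>t. t \<ge> 0 \<Longrightarrow> norm (?E t *v shifted B z v) \<le> C * exp (- c0 * t)"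
    using assms(2) unfolding decays_def by blast
  have C0: "C \<ge> 0" using C[of 0] by (meson norm_ge_zero order_trans mult_le_0_iff order.refl exp_gt_zero not_le zero_le_mult_iff)
  \<comment> \<open>The minimum keeps the growth rate \<open>b\<close> of \<open>y\<close> positive, even if the forcing term decays faster than \<open>exp(Re z t)\<close>.\<close>
  define c where "c = min c0 (- Re z / 2)"
  define b where "b = - Re z - c"
  have c: "c > 0" "c \<le> c0" "b > 0" using c0 z by (auto simp: c_def b_def min_def)
  have bound: "norm ((?E t *v v) $ i) \<le> (norm (v $ i) + C / b) * exp (- c * t)" if t: "t \<ge> 0" for t i
  proof -
    define y where "y s = exp (- z * of_real s) * (?E s *v v) $ i" for s :: real
    define y' where "y' s = exp (- z * of_real s) * (?E s *v shifted B z v) $ i" for s :: real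
    have der: "(y has_vector_derivative y' s) (at s)" for s
    proof -
      have 1: "((\<lambda>s. (?E s *v v) $ i) has_vector_derivative (cmat (B ** matrix_exp (s *\<^sub>R B)) *v v) $ i) (at s)"
        by (rule bounded_linear.has_vector_derivative[OF bounded_linear_vec_nth],
            rule bounded_linear.has_vector_derivative[OF bounded_linear_cmat_mult], rule matrix_exp_has_vector_derivative)
      have 2: "((\<lambda>s. exp (- z * of_real s)) has_vector_derivative - z * exp (- z * of_real s)) (at s)"
        by (rule has_vector_derivative_real_field) (auto intro!: derivative_eq_intros)
      have eq: "(?E s *v shifted B z v) $ i = (cmat (B ** matrix_exp (s *\<^sub>R B)) *v v) $ i - z * (?E s *v v) $ i"
        by (simp add: cmat_exp_shifted) (simp add: shifted_def matrix_vector_mul_assoc cmat_mult)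
      then show ?thesis
        unfolding y_def[abs_def] y'_def eq using has_vector_derivative_mult[OF 2 1]
        by (simp add: algebra_simps)
    qed
    have "norm (y t - y 0) \<le> C / b * exp (b * t) - C / b * exp (b * 0)"
    proof (cases "t = 0")
      case False
      with t have "0 < t" by simp
      then show ?thesis
      proof (rule differentiable_bound_general[where f = y and f' = y' and \<phi>' = "\<lambda>s. C * exp (b * s)"])
        show "continuous_on {0..t} y"
          using der by (meson continuous_at_imp_continuous_on has_vector_derivative_continuous)
        show "continuous_on {0..t} (\<lambda>s. C / b * exp (b * s))" by (intro continuous_intros)
        show "((\<lambda>s. C / b * exp (b * s)) has_vector_derivative C * exp (b * s)) (at s)" for s
          using c by (auto intro!: derivative_eq_intros simp: has_real_derivative_iff_has_vector_derivative[symmetric])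
        show "norm (y' s) \<le> C * exp (b * s)" if "0 < s" for s
        proof -
          have "norm (y' s) = exp (- Re z * s) * norm ((?E s *v shifted B z v) $ i)"
            by (simp add: y'_def norm_mult norm_exp_eq_Re)
          also have "\<dots> \<le> exp (- Re z * s) * (C * exp (- c0 * s))"
            using Finite_Cartesian_Product.norm_nth_le[of "?E s *v shifted B z v" i] C[of s] that by (intro mult_left_mono) auto
          also have "\<dots> = C * exp ((- Re z - c0) * s)" by (simp add: algebra_simps exp_add[symmetric] exp_diff exp_minus field_simps)
          also have "\<dots> \<le> C * exp (b * s)"
            using C0 c that by (intro mult_left_mono) (auto simp: b_def mult_right_mono)
          finally show ?thesis .
        qed
      qed (use der in auto)
    qed simp
    moreover have "C / b \<ge> 0" using C0 c(3) by simp
    ultimately have "norm (y t) \<le> norm (y 0) + C / b * exp (b * t)"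
      using norm_triangle_ineq2[of "y t" "y 0"] by simp
    also have "y 0 = v $ i"
      by (simp add: y_def matrix_exp_zero cmat_mat)
    also have "norm (v $ i) \<le> norm (v $ i) * exp (b * t)" using c t by (simp add: mult_le_cancel_left1)
    finally have *: "norm (y t) \<le> (norm (v $ i) + C / b) * exp (b * t)" by (simp add: algebra_simps)
    have "(?E t *v v) $ i = exp (z * of_real t) * y t"
      by (simp add: y_def exp_minus)
    then have "norm ((?E t *v v) $ i) = exp (Re z * t) * norm (y t)"
      by (simp add: norm_mult norm_exp_eq_Re)
    also have "\<dots> \<le> exp (Re z * t) * ((norm (v $ i) + C / b) * exp (b * t))"
      using * by (intro mult_left_mono) auto
    also have "\<dots> = (norm (v $ i) + C / b) * exp (- c * t)"
      by (simp add: b_def algebra_simps flip: exp_add)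
    finally show ?thesis .
  qed
  have "norm (?E t *v v) \<le> (\<Sum>i\<in>UNIV. norm (v $ i) + C / b) * exp (- c * t)" if t: "t \<ge> 0" for t
  proof -
    have "norm (?E t *v v) \<le> (\<Sum>i\<in>UNIV. norm ((?E t *v v) $ i))"
      unfolding norm_vec_def by (rule L2_set_le_sum) auto
    also have "\<dots> \<le> (\<Sum>i\<in>UNIV. (norm (v $ i) + C / b) * exp (- c * t))"
      by (intro sum_mono bound t)
    finally show ?thesis by (simp add: sum_distrib_right)
  qed
  then show ?thesis unfolding decays_def using c by blast
qed

lemma foldr_shifted_commute: "foldr (shifted B) zs (shifted B z v) = shifted B z (foldr (shifted B) zs v)"
  by (induction zs) (simp_all add: shifted_commute)

text \<open>Remove the factors one by one.  A factor with \<open>Re z \<ge> 0\<close> is injective as \<open>z\<close> is then no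
  eigenvalue, so it can be cancelled; a factor with \<open>Re z < 0\<close> is handled by
  \<open>decays_if_shifted_decays\<close>.\<close>

lemma decays_if_annihilated:
  fixes B :: "real^'n^'n"
  assumes ev: "\<And>z. complex_eigenvalue B z \<Longrightarrow> Re z < 0"
  shows "foldr (shifted B) zs v = 0 \<Longrightarrow> decays B v"
proof (induction zs arbitrary: v)
  case Nil
  then show ?case by (auto simp: decays_def intro!: exI[of _ "0::real"] exI[of _ "1::real"])
next
  case (Cons z zs)
  show ?case
  proof (cases "Re z < 0")
    case True
    show ?thesis
      by (rule decays_if_shifted_decays[OF True], rule Cons.IH) (use Cons.prems in \<open>simp add: foldr_shifted_commute\<close>)
  next
    case False
    then have "\<not> complex_eigenvalue B z" using ev by blast
    moreover have "shifted B z (foldr (shifted B) zs v) = 0" using Cons.prems by simp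
    ultimately have "foldr (shifted B) zs v = 0" by (auto simp: complex_eigenvalue_def shifted_def)
    then show ?thesis by (rule Cons.IH)
  qed
qed

text \<open>The vector \<open>p(B) v\<close>.\<close>

definition poly_act :: "real^'n^'n \<Rightarrow> complex poly \<Rightarrow> complex^'n \<Rightarrow> complex^'n" where
  "poly_act B p v = (\<Sum>k\<le>degree p. coeff p k *s (((*v) (cmat B) ^^ k) v))"

lemma poly_act_bound:
  assumes "degree p \<le> m"
  shows "poly_act B p v = (\<Sum>k\<le>m. coeff p k *s (((*v) (cmat B) ^^ k) v))"
  unfolding poly_act_def
  by (rule sum.mono_neutral_left) (use assms in \<open>auto simp: coeff_eq_0\<close>)

lemma poly_act_linear_factor: "poly_act B ([:-z, 1:] * q) v = shifted B z (poly_act B q v)"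
proof -
  let ?m = "Suc (degree q)" and ?T = "(*v) (cmat B)"
  have "degree ([:-z, 1:] * q) \<le> ?m" by (metis degree_mult_le degree_pCons_eq_if one_neq_zero degree_1 plus_1_eq_Suc pCons_one degree_linear_power power_one_right)
  then have "poly_act B ([:-z, 1:] * q) v = (\<Sum>k\<le>?m. coeff ([:-z, 1:] * q) k *s ((?T ^^ k) v))"
    by (rule poly_act_bound)
  also have "\<dots> = (\<Sum>k\<le>?m. coeff (pCons 0 q) k *s ((?T ^^ k) v)) - z *s (\<Sum>k\<le>?m. coeff q k *s ((?T ^^ k) v))"
    by (simp add: vec_eq_iff sum_distrib_left sum_subtractf[symmetric] algebra_simps del: sum.atMost_Suc)
  also have "(\<Sum>k\<le>?m. coeff (pCons 0 q) k *s ((?T ^^ k) v)) = (\<Sum>k\<le>degree q. coeff q k *s ?T ((?T ^^ k) v))"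
    by (subst sum.atMost_Suc_shift) simp
  also have "\<dots> = ?T (poly_act B q v)"
    unfolding poly_act_def by (simp add: linear_sum[OF matrix_vector_mul_linear] vector_scalar_commute)
  also have "(\<Sum>k\<le>?m. coeff q k *s ((?T ^^ k) v)) = poly_act B q v"
    by (rule poly_act_bound[symmetric]) simp
  finally show ?thesis by (simp add: shifted_def)
qed

lemma poly_act_linear_factors: "poly_act B (\<Prod>z\<leftarrow>zs. [:-z, 1:]) v = foldr (shifted B) zs v"
proof (induction zs)
  case Nil
  then show ?case by (simp add: poly_act_def)
next
  case (Cons z zs)
  then show ?case by (simp only: list.map prod_list.Cons poly_act_linear_factor foldr_Cons o_apply)
qed

text \<open>The powers of \<open>B\<close> live in a space of finite dimension, hence are linearly dependent.\<close>

lemma annihilating_combination: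
  fixes B :: "real^'n^'n"
  obtains a m where "(\<Sum>k\<le>m. a k *\<^sub>R mpow B k) = 0" "\<exists>k\<le>m. a k \<noteq> (0::real)"
proof -
  let ?d = "DIM(real^'n^'n)"
  show ?thesis
  proof (cases "inj_on (mpow B) {..?d}")
    case True
    then have "card (mpow B ` {..?d}) = Suc ?d" by (simp add: card_image)
    then have "dependent (mpow B ` {..?d})"
      using independent_bound[of "mpow B ` {..?d}"] by (metis Suc_n_not_le_n)
    then obtain u where u: "\<exists>v\<in>mpow B ` {..?d}. u v \<noteq> 0" "(\<Sum>v\<in>mpow B ` {..?d}. u v *\<^sub>R v) = 0"
      using dependent_finite[of "mpow B ` {..?d}"] by auto
    show ?thesis
      by (rule that[of "\<lambda>k. u (mpow B k)" ?d]) (use u sum.reindex[OF True, of "\<lambda>v. u v *\<^sub>R v"] in auto)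
  next
    case False
    then obtain i j where ij: "i \<noteq> j" "i \<le> ?d" "j \<le> ?d" "mpow B i = mpow B j" unfolding inj_on_def by auto
    \<comment> \<open>Two equal powers give the relation \<open>B^i - B^j = 0\<close>.\<close>
    define a :: "nat \<Rightarrow> real" where "a k = (if k = i then 1 else 0) - (if k = j then 1 else 0)" for k
    have "(\<Sum>k\<le>?d. a k *\<^sub>R mpow B k) = mpow B i - mpow B j"
      using ij by (simp add: a_def scaleR_diff_left sum_subtractf if_distrib[of "\<lambda>x. x *\<^sub>R _"] sum.delta cong: if_cong)
    then show ?thesis using ij by (intro that[of a ?d]) (auto simp: a_def intro!: exI[of _ i])
  qed
qed

lemma cmat_mpow: "cmat (mpow B k) *v v = ((*v) (cmat B) ^^ k) v"
  by (induction k) (simp_all add: cmat_mat cmat_mult flip: matrix_vector_mul_assoc)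

text \<open>Over the complex numbers the annihilating polynomial splits into linear factors.\<close>

lemma annihilating_factors:
  fixes B :: "real^'n^'n"
  obtains zs where "\<And>v. foldr (shifted B) zs v = 0"
proof -
  obtain a m where a: "(\<Sum>k\<le>m. a k *\<^sub>R mpow B k) = 0" "\<exists>k\<le>m. a k \<noteq> (0::real)"
    by (rule annihilating_combination)
  define p where "p = (\<Sum>k\<le>m. monom (complex_of_real (a k)) k)"
  have cp: "coeff p k = (if k \<le> m then complex_of_real (a k) else 0)" for k
    by (simp add: p_def coeff_sum sum.delta' if_distrib cong: if_cong)
  have p0: "p \<noteq> 0" using a(2) cp by (metis coeff_0 of_real_eq_0_iff)
  have dp: "degree p \<le> m" by (rule degree_le) (simp add: cp)
  have act: "poly_act B p v = 0" for v
  proof -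
    interpret L: bounded_linear "\<lambda>X. cmat X *v v" by (rule bounded_linear_cmat_mult)
    have "poly_act B p v = (\<Sum>k\<le>m. a k *\<^sub>R (cmat (mpow B k) *v v))"
      unfolding poly_act_bound[OF dp] cmat_mpow by (intro sum.cong) (auto simp: cp vec_eq_iff scaleR_conv_of_real[where 'a = complex])
    also have "\<dots> = cmat (\<Sum>k\<le>m. a k *\<^sub>R mpow B k) *v v" unfolding L.sum L.scaleR ..
    finally show ?thesis unfolding a by (simp add: matrix_vector_mult_def vec_eq_iff)
  qed
  obtain A where "p = smult (lead_coeff p) (\<Prod>x\<in>#A. [:-x, 1:])"
    using alg_closed_imp_factorization[OF p0] by blast
  moreover obtain zs where "mset zs = A" using ex_mset by blast
  ultimately have pz: "p = smult (lead_coeff p) (\<Prod>x\<leftarrow>zs. [:-x, 1:])"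
    by (metis mset_map prod_mset_prod_list)
  have "foldr (shifted B) zs v = 0" for v
  proof -
    have "poly_act B p v = lead_coeff p *s poly_act B (\<Prod>x\<leftarrow>zs. [:-x, 1:]) v"
      by (subst pz) (simp add: poly_act_def p0 vec_eq_iff sum_distrib_left mult.assoc)
    then show ?thesis using act p0 by (simp add: poly_act_linear_factors)
  qed
  then show ?thesis by (rule that)
qed

lemma matrix_exp_decays:
  fixes B :: "real^'n^'n"
  assumes ev: "\<And>z. complex_eigenvalue B z \<Longrightarrow> Re z < 0"
  obtains C c where "C \<ge> 0" "c > 0" "\<And>t. t \<ge> 0 \<Longrightarrow> norm (matrix_exp (t *\<^sub>R B)) \<le> C * exp (- c * t)"
proof -
  obtain zs where "\<And>v. foldr (shifted B) zs v = 0" using annihilating_factors[of B] by blast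
  then have "decays B v" for v using decays_if_annihilated[OF ev] by blast
  then have "\<forall>j. \<exists>C c. c > 0 \<and> (\<forall>t\<ge>0. norm (cmat (matrix_exp (t *\<^sub>R B)) *v axis j 1) \<le> C * exp (- c * t))"
    unfolding decays_def by blast
  then obtain C c where cj: "\<And>j. c j > 0"
    and Cj: "\<And>j t. t \<ge> 0 \<Longrightarrow> norm (cmat (matrix_exp (t *\<^sub>R B)) *v axis j 1) \<le> C j * exp (- c j * t)"
    by metis
  define d where "d = Min (range c)"
  have d: "d > 0" "d \<le> c j" for j using cj by (auto simp: d_def)
  \<comment> \<open>The columns of the exponential are its values at the unit vectors.\<close>
  have entry: "\<bar>matrix_exp (t *\<^sub>R B) $ i $ j\<bar> \<le> \<bar>C j\<bar> * exp (- d * t)" if t: "t \<ge> 0" for i j t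
  proof -
    have "\<bar>matrix_exp (t *\<^sub>R B) $ i $ j\<bar> = norm ((cmat (matrix_exp (t *\<^sub>R B)) *v axis j 1) $ i)"
      by (simp add: matrix_vector_mul_component matrix_vector_mult_def axis_def if_distrib cong: if_cong)
    also have "\<dots> \<le> C j * exp (- c j * t)" using Finite_Cartesian_Product.norm_nth_le Cj[OF t] by (rule order_trans)
    also have "\<dots> \<le> \<bar>C j\<bar> * exp (- d * t)"
      using d(2)[of j] t by (intro mult_mono) (auto simp: mult_right_mono)
    finally show ?thesis .
  qed
  have "norm (matrix_exp (t *\<^sub>R B)) \<le> (\<Sum>i\<in>(UNIV::'n set). \<Sum>j\<in>(UNIV::'n set). \<bar>C j\<bar>) * exp (- d * t)" if t: "t \<ge> 0" for t
  proof -
    have "norm (matrix_exp (t *\<^sub>R B)) \<le> (\<Sum>i\<in>UNIV. norm (matrix_exp (t *\<^sub>R B) $ i))"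
      unfolding norm_vec_def[of "matrix_exp (t *\<^sub>R B)"] by (rule L2_set_le_sum) auto
    also have "\<dots> \<le> (\<Sum>i\<in>UNIV. \<Sum>j\<in>UNIV. \<bar>matrix_exp (t *\<^sub>R B) $ i $ j\<bar>)"
      by (intro sum_mono norm_le_l1_cart)
    also have "\<dots> \<le> (\<Sum>i\<in>(UNIV::'n set). \<Sum>j\<in>(UNIV::'n set). \<bar>C j\<bar> * exp (- d * t))"
      by (intro sum_mono entry t)
    finally show ?thesis by (simp add: sum_distrib_right mult.assoc)
  qed
  then show ?thesis using d by (intro that[of "\<Sum>i\<in>(UNIV::'n set). \<Sum>j\<in>(UNIV::'n set). \<bar>C j\<bar>" d]) (auto intro!: sum_nonneg mult_nonneg_nonneg)
qed

section \<open>Positive definite matrices\<close>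

lemma inner_matrix_transpose: "((A :: real^'n^'m) *v x) \<bullet> y = x \<bullet> (transpose A *v y)"
  by (metis dot_lmul_matrix inner_commute transpose_matrix_vector)

lemma transpose_scaleR: "transpose (c *\<^sub>R (A :: real^'n^'m)) = c *\<^sub>R transpose A"
  by (simp add: vec_eq_iff transpose_def)

lemma det_scaleR: "det (c *\<^sub>R (A :: real^'n^'n)) = c ^ CARD('n) * det A"
  by (simp add: det_def prod.distrib sum_distrib_left mult_ac)

lemma matrix_inv_invertible:
  fixes A :: "real^'n^'n"
  assumes "invertible A"
  shows "A ** matrix_inv A = mat 1" "matrix_inv A ** A = mat 1"
  using someI_ex[OF assms[unfolded invertible_def]] unfolding matrix_inv_def by auto

lemma symmetric_matrix_inv:
  fixes A :: "real^'n^'n"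
  assumes "transpose A = A" "invertible A"
  shows "transpose (matrix_inv A) = matrix_inv A"
proof -
  have "transpose (matrix_inv A) ** A = mat 1"
    using arg_cong[OF matrix_inv_invertible(1)[OF assms(2)], of transpose] assms(1)
    by (simp add: matrix_transpose_mul)
  then have "transpose (matrix_inv A) ** A ** matrix_inv A = matrix_inv A" by simp
  then show ?thesis by (simp add: matrix_inv_invertible(1)[OF assms(2)] flip: matrix_mul_assoc)
qed

lemma matrix_inv_scaleR:
  fixes A :: "real^'n^'n"
  assumes A: "invertible A" and c: "c \<noteq> 0"
  shows "invertible (c *\<^sub>R A)" "matrix_inv (c *\<^sub>R A) = (1 / c) *\<^sub>R matrix_inv A"
proof -
  have 1: "(c *\<^sub>R A) ** ((1 / c) *\<^sub>R matrix_inv A) = mat 1" "((1 / c) *\<^sub>R matrix_inv A) ** (c *\<^sub>R A) = mat 1"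
    using c by (simp_all add: matrix_mult_bilinear_simps matrix_inv_invertible[OF A])
  then show inv: "invertible (c *\<^sub>R A)" unfolding invertible_def by blast
  have "matrix_inv (c *\<^sub>R A) = matrix_inv (c *\<^sub>R A) ** ((c *\<^sub>R A) ** ((1 / c) *\<^sub>R matrix_inv A))"
    unfolding 1 by simp
  also have "\<dots> = (1 / c) *\<^sub>R matrix_inv A"
    unfolding matrix_mul_assoc matrix_inv_invertible(2)[OF inv] by simp
  finally show "matrix_inv (c *\<^sub>R A) = (1 / c) *\<^sub>R matrix_inv A" .
qed

lemma positive_definite_invertible:
  fixes A :: "real^'n^'n"
  assumes "positive_definite A"
  shows "invertible A"
proof -
  have "x = 0" if "A *v x = 0" for x
    using assms that unfolding positive_definite_def by force
  then have "\<exists>C. C ** A = mat 1" by (simp add: matrix_left_invertible_ker)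
  then show ?thesis using invertible_left_inverse by blast
qed

text \<open>Along the segment from the identity to \<open>A\<close> all matrices are positive definite, hence invertible, so
  the determinant cannot change sign.\<close>

lemma positive_definite_det_pos:
  fixes A :: "real^'n^'n"
  assumes A: "positive_definite A"
  shows "det A > 0"
proof (rule ccontr)
  define f where "f s = det ((1 - s) *\<^sub>R mat 1 + s *\<^sub>R A)" for s :: real
  assume "\<not> det A > 0"
  then have "f 1 \<le> 0" "0 \<le> f 0" by (auto simp: f_def)
  moreover have "continuous_on {0..1} f"
    unfolding f_def det_def by (intro continuous_intros)
  ultimately obtain s where s: "0 \<le> s" "s \<le> 1" "f s = 0"
    using IVT2'[of f 1 0 0] by auto
  have "positive_definite ((1 - s) *\<^sub>R mat 1 + s *\<^sub>R A)"
    unfolding positive_definite_def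
  proof safe
    fix x :: "real^'n" assume "x \<noteq> 0"
    then have x: "x \<bullet> x > 0" "(A *v x) \<bullet> x > 0" using A by (auto simp: positive_definite_def)
    have "((1 - s) *\<^sub>R mat 1 + s *\<^sub>R A) *v x = (1 - s) *\<^sub>R x + s *\<^sub>R (A *v x)"
      by (simp add: matrix_vector_mult_add_rdistrib flip: scaleR_matrix_vector_assoc)
    moreover have "0 < (1 - s) * (x \<bullet> x) + s * ((A *v x) \<bullet> x)"
    proof (cases "s = 0")
      case False
      then show ?thesis using x s by (intro add_nonneg_pos mult_nonneg_nonneg mult_pos_pos) auto
    qed (use x in simp)
    ultimately show "0 < (((1 - s) *\<^sub>R mat 1 + s *\<^sub>R A) *v x) \<bullet> x" by (simp add: inner_add_left)
  qed
  then show False using positive_definite_invertible s(3) invertible_det_nz unfolding f_def by blast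
qed

lemma positive_definite_coercive:
  fixes A :: "real^'n^'n"
  assumes A: "positive_definite A"
  obtains c where "c > 0" "\<And>x. c * (norm x)\<^sup>2 \<le> (A *v x) \<bullet> x"
proof -
  have "\<exists>x\<in>sphere (0::real^'n) 1. \<forall>y\<in>sphere 0 1. (A *v x) \<bullet> x \<le> (A *v y) \<bullet> y"
    by (intro continuous_attains_inf compact_sphere continuous_on_inner[OF linear_continuous_on[OF matrix_vector_mul_bounded_linear] continuous_on_id]) simp
  then obtain x where x: "norm x = 1" "\<And>y. norm y = 1 \<Longrightarrow> (A *v x) \<bullet> x \<le> (A *v y) \<bullet> y"
    by (auto simp: dist_norm)
  have "(A *v x) \<bullet> x * (norm y)\<^sup>2 \<le> (A *v y) \<bullet> y" for y
  proof (cases "y = 0")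
    case False
    have "(A *v x) \<bullet> x * (norm y)\<^sup>2 \<le> ((A *v ((1 / norm y) *\<^sub>R y)) \<bullet> ((1 / norm y) *\<^sub>R y)) * (norm y)\<^sup>2"
      using False by (intro mult_right_mono x) auto
    also have "\<dots> = (A *v y) \<bullet> y"
      using False by (simp add: matrix_vector_mult_scaleR power2_eq_square)
    finally show ?thesis .
  qed simp
  moreover have "(A *v x) \<bullet> x > 0" using A x(1) unfolding positive_definite_def by (metis norm_zero zero_neq_one)
  ultimately show ?thesis by (rule that[rotated])
qed

lemma positive_definite_matrix_inv:
  fixes A :: "real^'n^'n"
  assumes "positive_definite A"
  shows "positive_definite (matrix_inv A)"
  unfolding positive_definite_def
proof safe
  note inv = matrix_inv_invertible[OF positive_definite_invertible[OF assms]]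
  fix x :: "real^'n" assume x: "x \<noteq> 0"
  let ?w = "matrix_inv A *v x"
  have e: "A *v ?w = x" by (simp add: matrix_vector_mul_assoc inv)
  then have "?w \<noteq> 0" using x by auto
  then have "0 < (A *v ?w) \<bullet> ?w" using assms unfolding positive_definite_def by blast
  then show "0 < ?w \<bullet> x" unfolding e by (simp add: inner_commute)
qed

lemma tendsto_det:
  fixes A :: "'a \<Rightarrow> real^'n^'n"
  assumes "(A \<longlongrightarrow> L) F" shows "((\<lambda>t. det (A t)) \<longlongrightarrow> det L) F"
  unfolding det_def by (intro tendsto_intros tendsto_vec_nth assms)

text \<open>Cramer's rule expresses the solution of a linear system by determinants, which are continuous.\<close>

lemma tendsto_matrix_inv_vec:
  fixes A :: "'a \<Rightarrow> real^'n^'n"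
  assumes lim: "(A \<longlongrightarrow> L) F" and L: "invertible L" and inv: "\<forall>\<^sub>F t in F. invertible (A t)"
  shows "((\<lambda>t. matrix_inv (A t) *v b) \<longlongrightarrow> matrix_inv L *v b) F"
proof -
  define X where "X A = (\<chi> k. det (\<chi> i j. if j = k then b $ i else A $ i $ j) / det A)" for A :: "real^'n^'n"
  have eq: "matrix_inv A *v b = X A" if "invertible A" for A :: "real^'n^'n"
  proof -
    have "A *v (matrix_inv A *v b) = b"
      using matrix_inv_invertible[OF that] by (simp add: matrix_vector_mul_assoc)
    then show ?thesis using cramer[of A "matrix_inv A *v b" b] that by (simp add: X_def invertible_det_nz)
  qed
  have "((\<lambda>t. X (A t)) \<longlongrightarrow> X L) F"
    unfolding X_def
  proof (rule tendsto_vec_lambda, rule tendsto_divide)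
    fix k :: 'n
    have entries: "((\<lambda>t. A t $ i $ j) \<longlongrightarrow> L $ i $ j) F" for i j by (intro tendsto_vec_nth lim)
    show "((\<lambda>t. det (\<chi> i j. if j = k then b $ i else A t $ i $ j)) \<longlongrightarrow> det (\<chi> i j. if j = k then b $ i else L $ i $ j)) F"
      by (rule tendsto_det, intro tendsto_vec_lambda) (auto simp: entries)
    show "((\<lambda>t. det (A t)) \<longlongrightarrow> det L) F" by (rule tendsto_det[OF lim])
    show "det L \<noteq> 0" using L by (simp add: invertible_det_nz)
  qed
  then show ?thesis
    unfolding eq[OF L]
  proof (rule Lim_transform_eventually)
    show "\<forall>\<^sub>F t in F. X (A t) = matrix_inv (A t) *v b" using inv by eventually_elim (simp add: eq)
  qed
qed

text \<open>The uniform lower bound for the inverse quadratic forms provides the dominating Gaussian in the limit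
  \<open>t \<longrightarrow> 0\<close>.\<close>

lemma eventually_matrix_inv_coercive:
  fixes A :: "'a \<Rightarrow> real^'n^'n"
  assumes lim: "(A \<longlongrightarrow> L) F" and L: "positive_definite L"
  obtains c where "c > 0" "\<forall>\<^sub>F t in F. invertible (A t) \<longrightarrow> (\<forall>v. c * (norm v)\<^sup>2 \<le> (matrix_inv (A t) *v v) \<bullet> v)"
proof -
  obtain c where c: "c > 0" "\<And>x. c * (norm x)\<^sup>2 \<le> (L *v x) \<bullet> x"
    using positive_definite_coercive[OF L] by blast
  obtain K where K: "\<And>(X :: real^'n^'n) (y :: real^'n). norm (X *v y) \<le> norm X * norm y * K" "K > 0"
    using bounded_bilinear.pos_bounded[OF bounded_bilinear_matrix_vector_mult] by blast
  define M where "M = (norm L + c / (2 * K)) * K"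
  have M: "M > 0" using c K by (auto simp: M_def intro!: mult_pos_pos add_nonneg_pos)
  have "\<forall>\<^sub>F t in F. dist (A t) L < c / (2 * K)"
    using lim c K by (intro tendstoD) auto
  then have "\<forall>\<^sub>F t in F. invertible (A t) \<longrightarrow> (\<forall>v. (c / 2 / M\<^sup>2) * (norm v)\<^sup>2 \<le> (matrix_inv (A t) *v v) \<bullet> v)"
  proof eventually_elim
    case (elim t)
    then have d: "norm (A t - L) \<le> c / (2 * K)" by (simp add: dist_norm)
    have coer: "c / 2 * (norm w)\<^sup>2 \<le> (A t *v w) \<bullet> w" for w
    proof -
      have "\<bar>((A t - L) *v w) \<bullet> w\<bar> \<le> norm ((A t - L) *v w) * norm w" by (rule Cauchy_Schwarz_ineq2)
      also have "\<dots> \<le> (c / (2 * K) * norm w * K) * norm w"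
        using d K(2) by (intro mult_right_mono order_trans[OF K(1)[of "A t - L" w]]) auto
      also have "\<dots> = c / 2 * (norm w)\<^sup>2" using K(2) by (simp add: power2_eq_square)
      finally have "\<bar>(A t *v w) \<bullet> w - (L *v w) \<bullet> w\<bar> \<le> c / 2 * (norm w)\<^sup>2"
        by (simp add: matrix_vector_mult_diff_rdistrib inner_diff_left)
      then show ?thesis using c(2)[of w] by linarith
    qed
    have "norm (A t) \<le> norm L + c / (2 * K)" using d norm_triangle_ineq2[of "A t" L] by linarith
    then have "norm (A t *v w) \<le> (norm L + c / (2 * K)) * norm w * K" for w
      using K(2) by (intro order_trans[OF K(1)[of "A t" w]] mult_right_mono) auto
    then have up: "norm (A t *v w) \<le> M * norm w" for w
      by (simp add: M_def mult_ac)
    show ?case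
    proof safe
      fix v assume inv: "invertible (A t)"
      let ?w = "matrix_inv (A t) *v v"
      have e: "A t *v ?w = v" using matrix_inv_invertible[OF inv] by (simp add: matrix_vector_mul_assoc)
      have "(norm v)\<^sup>2 \<le> (M * norm ?w)\<^sup>2" using up[of ?w] unfolding e by (intro power_mono) auto
      then have "(c / 2 / M\<^sup>2) * (norm v)\<^sup>2 \<le> (c / 2 / M\<^sup>2) * (M * norm ?w)\<^sup>2"
        using c by (intro mult_left_mono) auto
      also have "\<dots> = c / 2 * (norm ?w)\<^sup>2" using M by (simp add: power_mult_distrib)
      also have "\<dots> \<le> (A t *v ?w) \<bullet> ?w" by (rule coer)
      finally show "(c / 2 / M\<^sup>2) * (norm v)\<^sup>2 \<le> ?w \<bullet> v" unfolding e by (simp add: inner_commute)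
    qed
  qed
  then show ?thesis using that[of "c / 2 / M\<^sup>2"] c M by auto
qed

text \<open>Completing the square in the Mehler kernel.  The matrices stand for \<open>S = Q\<^sub>\<infinity>\<close>,
  \<open>T = Q\<^sub>t\<close>, their inverses \<open>R\<close> and \<open>P\<close>, \<open>E = exp(tB)\<close> and
  \<open>F = exp(- tB\<^sup>T)\<close>, so that \<open>D\<close> is \<open>D\<^sub>t\<close>.  The splitting of \<open>S\<close> gives
  \<open>D = T F R + E\<close>, hence \<open>(P - R) D = P E\<close>, which turns the mean \<open>D x\<close> into \<open>E x\<close>.\<close>

lemma kernel_exponent:
  fixes S T E F P R :: "real^'n^'n"
  assumes sym: "transpose P = P" "transpose R = R"
    and inv: "R ** S = mat 1" "S ** R = mat 1" "P ** T = mat 1" "T ** P = mat 1"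
    and split: "S = T + E ** S ** transpose E"
    and F: "transpose E ** F = mat 1"
  defines "D \<equiv> S ** F ** R"
  shows "(R *v x) \<bullet> x - ((P - R) *v (u - D *v x)) \<bullet> (u - D *v x) - (R *v u) \<bullet> u
     = - ((P *v (u - E *v x)) \<bullet> (u - E *v x))"
proof -
  have "D = (T + E ** S ** transpose E) ** F ** R" unfolding D_def by (subst split) simp
  also have "\<dots> = T ** (F ** R) + E ** (S ** (transpose E ** F) ** R)"
    by (simp add: matrix_mult_bilinear_simps matrix_mul_assoc)
  finally have D: "D = T ** (F ** R) + E" by (simp add: F inv)
  have "P ** D = F ** R + P ** E"
    by (simp add: D matrix_mult_bilinear_simps matrix_mul_assoc inv)
  moreover have "R ** D = F ** R"
    unfolding D_def by (simp add: matrix_mul_assoc inv)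
  ultimately have PD: "(P - R) *v (D *v x) = P *v (E *v x)"
    by (simp add: matrix_vector_mul_assoc matrix_mult_bilinear_simps)
  define w where "w = F *v (R *v x)"
  have "(P *v (E *v x)) \<bullet> (T *v w) = (E *v x) \<bullet> (P *v (T *v w))"
    by (subst inner_matrix_transpose) (simp add: sym)
  also have "P *v (T *v w) = w" by (simp add: matrix_vector_mul_assoc inv)
  also have "(E *v x) \<bullet> w = x \<bullet> (transpose E *v w)" by (rule inner_matrix_transpose)
  also have "transpose E *v w = R *v x" by (simp add: w_def matrix_vector_mul_assoc matrix_mul_assoc F)
  also have "x \<bullet> (R *v x) = (R *v x) \<bullet> x" by (rule inner_commute)
  finally have cross: "(P *v (E *v x)) \<bullet> (D *v x) = (R *v x) \<bullet> x + (P *v (E *v x)) \<bullet> (E *v x)"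
    by (simp add: D w_def matrix_vector_mult_add_rdistrib inner_add_right matrix_vector_mul_assoc matrix_mul_assoc)
  have "transpose (P - R) = P - R" by (simp add: bounded_linear.linear linear_diff bounded_linear_transpose sym)
  then have symPR: "((P - R) *v a) \<bullet> b = ((P - R) *v b) \<bullet> a" for a b
    by (subst inner_matrix_transpose) (simp add: inner_commute)
  have symP: "(P *v a) \<bullet> b = (P *v b) \<bullet> a" for a b
    by (subst inner_matrix_transpose) (simp add: sym inner_commute)
  let ?y = "D *v x" and ?m = "E *v x"
  have "((P - R) *v (u - ?y)) \<bullet> (u - ?y)
      = ((P - R) *v u) \<bullet> u - 2 * (((P - R) *v ?y) \<bullet> u) + ((P - R) *v ?y) \<bullet> ?y"
    using symPR[of u ?y] by (simp add: matrix_vector_mult_diff_distrib inner_diff_left inner_diff_right)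
  also have "\<dots> = (P *v u) \<bullet> u - (R *v u) \<bullet> u - 2 * ((P *v ?m) \<bullet> u) + ((R *v x) \<bullet> x + (P *v ?m) \<bullet> ?m)"
    unfolding PD cross by (simp add: matrix_vector_mult_diff_rdistrib inner_diff_left)
  finally have 1: "((P - R) *v (u - ?y)) \<bullet> (u - ?y) = \<dots>" .
  have "(P *v (u - ?m)) \<bullet> (u - ?m) = (P *v u) \<bullet> u - 2 * ((P *v ?m) \<bullet> u) + (P *v ?m) \<bullet> ?m"
    using symP[of u ?m] by (simp add: matrix_vector_mult_diff_distrib inner_diff_left inner_diff_right)
  then show ?thesis unfolding 1 by simp
qed

section \<open>Lebesgue and Gaussian integrals\<close>

lemma lborel_integral_pos:
  fixes g :: "'a :: euclidean_space \<Rightarrow> real"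
  assumes g: "integrable lborel g" and pos: "\<And>x. g x > 0"
  shows "(\<integral>x. g x \<partial>lborel) > 0"
proof -
  have "(\<integral>x. g x \<partial>lborel) \<noteq> 0"
  proof
    assume "(\<integral>x. g x \<partial>lborel) = 0"
    then have "AE x in lborel. g x = 0"
      using integral_nonneg_eq_0_iff_AE[OF g] pos by (simp add: less_imp_le)
    then have "AE x :: 'a in lborel. False" by eventually_elim (metis pos less_irrefl)
    then show False using AE_iff_measurable[of UNIV "lborel :: 'a measure" "\<lambda>_. False"] by simp
  qed
  moreover have "(\<integral>x. g x \<partial>lborel) \<ge> 0" using pos by (intro Bochner_Integration.integral_nonneg less_imp_le)
  ultimately show ?thesis by linarith
qed

lemma lborel_integral_translate:
  fixes g :: "'a :: euclidean_space \<Rightarrow> real"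
  assumes g: "integrable lborel g"
  shows "integrable lborel (\<lambda>u. g (u + a))" "(\<integral>u. g (u + a) \<partial>lborel) = (\<integral>u. g u \<partial>lborel)"
proof -
  have [measurable]: "g \<in> borel_measurable borel" using g by simp
  show "integrable lborel (\<lambda>u. g (u + a))"
    using integrable_distr_eq[of "(+) a" lborel borel g] g by (simp add: lborel_distr_plus add.commute)
  show "(\<integral>u. g (u + a) \<partial>lborel) = (\<integral>u. g u \<partial>lborel)"
    using integral_distr[of "(+) a" lborel borel g] by (simp add: lborel_distr_plus add.commute)
qed

lemma lborel_integral_affine:
  fixes g :: "'a :: euclidean_space \<Rightarrow> real"
  assumes [measurable]: "g \<in> borel_measurable borel" and c: "c > 0"
  shows "(\<integral>u. g u \<partial>lborel) = c ^ DIM('a) * (\<integral>v. g (a + c *\<^sub>R v) \<partial>lborel)"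
proof -
  have "(\<integral>u. g u \<partial>lborel) = (\<integral>u. g u \<partial>density (distr lborel borel (\<lambda>x. a + c *\<^sub>R x)) (\<lambda>_. ennreal (c ^ DIM('a))))"
    using lborel_affine[of c a] c by (simp add: ennreal_power)
  also have "\<dots> = (\<integral>u. c ^ DIM('a) * g u \<partial>distr lborel borel (\<lambda>x. a + c *\<^sub>R x))"
    using c by (subst integral_density) auto
  also have "\<dots> = c ^ DIM('a) * (\<integral>v. g (a + c *\<^sub>R v) \<partial>lborel)"
    by (simp add: integral_distr)
  finally show ?thesis .
qed

lemma integrable_exp_neg_norm_sq:
  assumes c: "c > 0"
  shows "integrable lborel (\<lambda>v :: 'a :: euclidean_space. exp (- c * (norm v)\<^sup>2))"
proof -
  define \<sigma> where "\<sigma> = 1 / sqrt (2 * c)"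
  have \<sigma>: "\<sigma> > 0" "\<sigma>\<^sup>2 = 1 / (2 * c)" using c by (auto simp: \<sigma>_def power_divide)
  have "integrable lborel (\<lambda>x. sqrt (2 * pi * \<sigma>\<^sup>2) * normal_density 0 \<sigma> x)"
    using \<sigma> by (intro integrable_mult_right) (rule integrable_normal_density)
  moreover have "(\<lambda>x. sqrt (2 * pi * \<sigma>\<^sup>2) * normal_density 0 \<sigma> x) = (\<lambda>x. exp (- c * x\<^sup>2))"
    using \<sigma> c by (auto simp: normal_density_def fun_eq_iff)
  ultimately have "integrable lborel (\<lambda>x :: real. exp (- c * x\<^sup>2))" by simp
  then have fin: "(\<integral>\<^sup>+x. ennreal (exp (- c * x\<^sup>2)) \<partial>lborel) < \<infinity>"
    by (simp add: integrable_iff_bounded)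
  have "ennreal (exp (- c * (norm v)\<^sup>2)) = (\<Prod>b\<in>Basis. ennreal (exp (- c * (v \<bullet> b)\<^sup>2)))" for v :: 'a
  proof -
    have "(norm v)\<^sup>2 = (\<Sum>b\<in>Basis. (v \<bullet> b)\<^sup>2)"
      unfolding power2_norm_eq_inner by (subst euclidean_inner) (simp add: power2_eq_square)
    then show ?thesis by (simp add: prod_ennreal exp_sum[symmetric] sum_distrib_left sum_negf)
  qed
  then have "(\<integral>\<^sup>+v. ennreal (exp (- c * (norm (v :: 'a))\<^sup>2)) \<partial>lborel) = (\<Prod>b\<in>(Basis :: 'a set). \<integral>\<^sup>+x. ennreal (exp (- c * x\<^sup>2)) \<partial>lborel)"
    using nn_integral_lborel_prod[of "\<lambda>_ x. ennreal (exp (- c * x\<^sup>2))"] by simp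
  also have "\<dots> < \<infinity>" using fin by (simp add: ennreal_prod_eq_top power_less_top_ennreal)
  finally show ?thesis by (intro integrableI_bounded) auto
qed

lemma integrable_gaussian:
  fixes P :: "real^'n^'n"
  assumes "positive_definite P"
  shows "integrable lborel (\<lambda>v. exp (- (1/2) * ((P *v v) \<bullet> v)))"
proof -
  obtain c where c: "c > 0" "\<And>x. c * (norm x)\<^sup>2 \<le> (P *v x) \<bullet> x"
    using positive_definite_coercive[OF assms] by blast
  show ?thesis
  proof (rule Bochner_Integration.integrable_bound[OF integrable_exp_neg_norm_sq[of "c/2"]])
    show "AE v in lborel. norm (exp (- (1/2) * ((P *v v) \<bullet> v))) \<le> norm (exp (- (c/2) * (norm v)\<^sup>2))"
      using c(2) by (intro AE_I2) simp
    have "continuous_on UNIV (\<lambda>v. exp (- (1/2) * ((P *v v) \<bullet> v)))"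
      by (intro continuous_intros linear_continuous_on matrix_vector_mul_bounded_linear)
    then show "(\<lambda>v. exp (- (1/2) * ((P *v v) \<bullet> v))) \<in> borel_measurable lborel"
      by (simp add: borel_measurable_continuous_onI)
  qed (use c in simp)
qed

text \<open>Translations preserve the \<open>L\<^sup>1\<close> norm, so almost everywhere convergence implies convergence in
  \<open>L\<^sup>1\<close> by Scheffe's lemma.\<close>

lemma translation_L1_continuous:
  fixes g :: "'a :: euclidean_space \<Rightarrow> real"
  assumes g: "integrable lborel g" and cont: "AE x in lborel. isCont g x" and h: "h \<longlonglongrightarrow> 0"
  shows "(\<lambda>i. \<integral>x. \<bar>g (x + h i) - g x\<bar> \<partial>lborel) \<longlonglongrightarrow> 0"
proof -
  have meas[measurable]: "g \<in> borel_measurable borel" using g by simp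
  have gi: "integrable lborel (\<lambda>x. g (x + h i))" for i
    by (rule lborel_integral_translate(1)[OF g])
  have nn: "(\<integral>\<^sup>+x. norm (g (x + h i)) \<partial>lborel) = (\<integral>\<^sup>+x. norm (g x) \<partial>lborel)" for i
  proof -
    have "(\<integral>\<^sup>+x. norm (g x) \<partial>distr lborel borel ((+) (h i))) = (\<integral>\<^sup>+x. norm (g (h i + x)) \<partial>lborel)"
      by (rule nn_integral_distr) auto
    then show ?thesis by (simp add: lborel_distr_plus add.commute)
  qed
  have "(\<lambda>i. \<integral>\<^sup>+x. norm (g (x + h i) - g x) \<partial>lborel) \<longlonglongrightarrow> 0"
  proof (rule Scheffe_lemma2)
    show "AE x in lborel. (\<lambda>i. g (x + h i)) \<longlonglongrightarrow> g x"
      using cont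
    proof eventually_elim
      case (elim x)
      have "(\<lambda>i. x + h i) \<longlonglongrightarrow> x + 0" by (intro tendsto_intros h)
      then show ?case using isCont_tendsto_compose[OF elim] by simp
    qed
  qed (use g nn in auto)
  then have "(\<lambda>i. ennreal (\<integral>x. \<bar>g (x + h i) - g x\<bar> \<partial>lborel)) \<longlonglongrightarrow> ennreal 0"
    using g gi by (simp add: nn_integral_eq_integral)
  then show ?thesis by (rule tendsto_ennrealD) auto
qed

section \<open>Square waves\<close>

text \<open>A discontinuous wave is chosen, rather than a cosine, because it takes only the values \<open>1\<close> and
  \<open>-1\<close>; it is still continuous off a null set.\<close>

definition square_wave :: "'n \<Rightarrow> nat \<Rightarrow> real^'n \<Rightarrow> real" where
  "square_wave i m x = (if even \<lfloor>real m * x $ i\<rfloor> then 1 else -1)"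

lemma square_wave_cases: "square_wave i m x = 1 \<or> square_wave i m x = -1" by (simp add: square_wave_def)

lemma abs_square_wave [simp]: "\<bar>square_wave i m x\<bar> = 1" by (simp add: square_wave_def)

lemma borel_measurable_square_wave [measurable]: "square_wave (i :: 'n::finite) m \<in> borel_measurable borel"
proof -
  have "(\<lambda>x :: real^'n. real m * x $ i) \<in> borel_measurable borel"
    by (intro borel_measurable_continuous_onI continuous_intros)
  then have "(\<lambda>x :: real^'n. \<lfloor>real m * x $ i\<rfloor>) \<in> measurable borel (count_space UNIV)" by measurable
  then show ?thesis unfolding square_wave_def[abs_def] by measurable
qed

lemma square_wave_shift:
  assumes "m > 0"
  shows "square_wave i m (x + axis i (1 / real m)) = - square_wave i m x"
proof -
  have "real m * (x + axis i (1 / real m)) $ i = real m * x $ i + 1"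
    using assms by (simp add: distrib_left)
  then show ?thesis by (simp add: square_wave_def)
qed

lemma eventually_square_wave_eq:
  assumes "real m * x $ i \<notin> \<int>"
  shows "\<forall>\<^sub>F y in nhds x. square_wave i m y = square_wave i m x"
proof -
  have "((\<lambda>y. real m * y $ i) \<longlongrightarrow> real m * x $ i) (nhds x)"
    by (intro tendsto_intros) (auto simp: filterlim_ident)
  from eventually_floor_eq[OF this assms] show ?thesis
    by eventually_elim (simp add: square_wave_def)
qed

lemma isCont_square_wave:
  assumes "real m * x $ i \<notin> \<int>" shows "isCont (square_wave i m) x"
  unfolding isCont_def
  by (rule tendsto_eventually) (use eventually_square_wave_eq[OF assms] in \<open>auto simp: eventually_at_filter elim: eventually_mono\<close>)

lemma AE_not_grid:
  assumes "m > 0"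
  shows "AE x :: real^'n in lborel. real m * x $ i \<notin> \<int>"
proof -
  have 1: "AE x :: real^'n in lborel. x $ i \<noteq> of_int k / real m" for k :: int
  proof -
    have "negligible {x :: real^'n. axis i 1 \<bullet> x = of_int k / real m}"
      by (rule negligible_hyperplane) (simp add: axis_eq_0_iff)
    then have "{x :: real^'n. axis i 1 \<bullet> x = of_int k / real m} \<in> null_sets lebesgue"
      by (simp add: negligible_iff_null_sets)
    moreover have "{x :: real^'n. axis i 1 \<bullet> x = of_int k / real m} \<in> sets lborel"
      by (simp add: borel_closed closed_hyperplane)
    ultimately have "{x :: real^'n. axis i 1 \<bullet> x = of_int k / real m} \<in> null_sets lborel"
      using null_sets_completion_iff by blast
    then have "AE x in lborel. x \<notin> {x :: real^'n. axis i 1 \<bullet> x = of_int k / real m}" by (rule AE_not_in)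
    then show ?thesis by eventually_elim (simp add: inner_axis')
  qed
  have "AE x :: real^'n in lborel. \<forall>k::int. x $ i \<noteq> of_int k / real m"
    using 1 by (simp add: AE_all_countable)
  then show ?thesis
  proof eventually_elim
    case (elim x)
    then show ?case using assms by (auto simp: Ints_def field_simps)
  qed
qed

text \<open>Translating by half a period changes the sign of the wave, so twice the integral equals the integral of
  the wave against the difference of \<open>g\<close> and a small translate of \<open>g\<close>.\<close>

lemma riemann_lebesgue_square_wave:
  fixes g :: "real^'n \<Rightarrow> real"
  assumes g: "integrable lborel g" and cont: "AE x in lborel. isCont g x"
  shows "(\<lambda>m. \<integral>x. g x * square_wave i (Suc m) x \<partial>lborel) \<longlonglongrightarrow> 0"
proof -
  define h :: "nat \<Rightarrow> real^'n" where "h m = axis i (1 / real (Suc m))" for m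
  have [measurable]: "g \<in> borel_measurable borel" using g by simp
  have h: "h \<longlonglongrightarrow> 0"
  proof -
    have "(\<lambda>m. (1 / real (Suc m)) *\<^sub>R (axis i 1 :: real^'n)) \<longlonglongrightarrow> 0 *\<^sub>R axis i 1"
      using LIMSEQ_inverse_real_of_nat by (intro tendsto_intros) (simp add: inverse_eq_divide)
    moreover have "(1 / real (Suc m)) *\<^sub>R (axis i 1 :: real^'n) = h m" for m
      by (simp add: h_def vec_eq_iff axis_def)
    ultimately show ?thesis by simp
  qed
  have bnd: "\<bar>\<integral>x. g x * square_wave i (Suc m) x \<partial>lborel\<bar> \<le> (\<integral>x. \<bar>g (x + h m) - g x\<bar> \<partial>lborel)" for m
  proof -
    let ?r = "square_wave i (Suc m) :: real^'n \<Rightarrow> real"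
    have gi: "integrable lborel (\<lambda>x. g (x + h m))"
      by (rule lborel_integral_translate(1)[OF g])
    have i1: "integrable lborel (\<lambda>x. g x * ?r x)"
      by (rule Bochner_Integration.integrable_bound[OF g]) (auto simp: abs_mult)
    have i2: "integrable lborel (\<lambda>x. g (x + h m) * ?r x)"
      by (rule Bochner_Integration.integrable_bound[OF gi]) (auto simp: abs_mult)
    have "(\<integral>x. g x * ?r x \<partial>lborel) = (\<integral>x. g x * ?r x \<partial>distr lborel borel ((+) (h m)))"
      by (simp add: lborel_distr_plus)
    also have "\<dots> = (\<integral>x. g (h m + x) * ?r (h m + x) \<partial>lborel)"
      by (rule integral_distr) auto
    also have "\<dots> = - (\<integral>x. g (x + h m) * ?r x \<partial>lborel)"
      using square_wave_shift[of "Suc m" i] by (simp add: h_def add.commute)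
    finally have "2 * (\<integral>x. g x * ?r x \<partial>lborel) = (\<integral>x. g x * ?r x \<partial>lborel) - (\<integral>x. g (x + h m) * ?r x \<partial>lborel)" by simp
    also have "\<dots> = (\<integral>x. (g x - g (x + h m)) * ?r x \<partial>lborel)"
      using i1 i2 by (simp add: left_diff_distrib)
    also have "\<bar>\<dots>\<bar> \<le> (\<integral>x. \<bar>(g x - g (x + h m)) * ?r x\<bar> \<partial>lborel)"
      by (rule integral_abs_bound)
    also have "\<dots> = (\<integral>x. \<bar>g (x + h m) - g x\<bar> \<partial>lborel)"
      by (simp add: abs_mult abs_minus_commute)
    finally have "\<bar>2 * (\<integral>x. g x * ?r x \<partial>lborel)\<bar> \<le> (\<integral>x. \<bar>g (x + h m) - g x\<bar> \<partial>lborel)" .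
    then show ?thesis by linarith
  qed
  show ?thesis
    by (rule Lim_null_comparison[OF _ translation_L1_continuous[OF g cont h]])
       (use bnd in auto)
qed

abbreviation pattern :: "'n::finite \<Rightarrow> nat list \<Rightarrow> real^'n \<Rightarrow> real list" where
  "pattern i ms x \<equiv> map (\<lambda>m. square_wave i m x) ms"

lemma borel_measurable_pattern:
  "(\<lambda>x :: real^'n. G (pattern i ms x) :: real) \<in> borel_measurable borel"
proof (induction ms arbitrary: G)
  case (Cons m ms)
  have eq: "(\<lambda>x :: real^'n. G (pattern i (m # ms) x)) =
      (\<lambda>x. if square_wave i m x = 1 then G (1 # pattern i ms x) else G (-1 # pattern i ms x))"
    using square_wave_cases by (fastforce simp: fun_eq_iff)
  have [measurable]: "(\<lambda>x :: real^'n. G (a # pattern i ms x)) \<in> borel_measurable borel" for a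
    by (rule Cons.IH)
  show ?case unfolding eq by measurable
qed simp

text \<open>Off the grid all waves are locally constant, so that any function of their values is continuous there.\<close>

lemma isCont_pattern:
  assumes "\<forall>m\<in>set ms. real m * x $ i \<notin> \<int>"
  shows "isCont (\<lambda>x. G (pattern i ms x) :: real) x"
proof -
  have "\<forall>\<^sub>F y in nhds x. \<forall>m\<in>set ms. square_wave i m y = square_wave i m x"
    using assms by (intro eventually_ball_finite) (auto intro: eventually_square_wave_eq)
  then have "\<forall>\<^sub>F y in nhds x. G (pattern i ms y) = G (pattern i ms x)"
    by eventually_elim (rule arg_cong[where f = G], simp)
  then show ?thesis
    unfolding isCont_def by (intro tendsto_eventually) (auto simp: eventually_at_filter elim: eventually_mono)
qed

lemma AE_isCont_pattern:
  assumes "\<forall>m\<in>set ms. m > 0"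
  shows "AE x :: real^'n in lborel. isCont (\<lambda>x. G (pattern i ms x) :: real) x"
proof -
  have "AE x :: real^'n in lborel. \<forall>m\<in>set ms. real m * x $ i \<notin> \<int>"
    using assms by (intro AE_finite_allI) (auto intro: AE_not_grid)
  then show ?thesis by eventually_elim (rule isCont_pattern)
qed

lemma abs_sum_pattern: "\<bar>sum_list (pattern i ms x)\<bar> \<le> length ms"
proof (induction ms)
  case (Cons m ms)
  then show ?case using abs_square_wave[of i m x] abs_triangle_ineq[of "square_wave i m x" "sum_list (pattern i ms x)"] by simp
qed simp

section \<open>The covariance matrices\<close>

locale ornstein_uhlenbeck =
  fixes Q B :: "real^'n^'n"
  assumes sym: "transpose Q = Q" and pd: "positive_definite Q"
    and stable: "\<And>z. complex_eigenvalue B z \<Longrightarrow> Re z < 0"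

begin

abbreviation E :: "real \<Rightarrow> real^'n^'n" where "E t \<equiv> matrix_exp (t *\<^sub>R B)"

abbreviation Cov :: "real \<Rightarrow> real^'n^'n" where "Cov t \<equiv> ou_cov Q B (ereal t)"

abbreviation Cinf :: "real^'n^'n" where "Cinf \<equiv> ou_cov_inf Q B"

text \<open>The integrand of \<open>Q\<^sub>t\<close>.\<close>

definition flow_cov :: "real \<Rightarrow> real^'n^'n" where "flow_cov s = E s ** Q ** transpose (E s)"

lemma matrix_exp_transpose: "matrix_exp (s *\<^sub>R transpose B) = transpose (E s)"
  by (simp add: transpose_matrix_exp transpose_scaleR)

lemma Cov_eq: "Cov t = (LINT s:{0..t}|lborel. flow_cov s)"
  unfolding ou_cov_def flow_cov_def matrix_exp_transpose
  by (rule arg_cong2[where f="\<lambda>A f. set_lebesgue_integral lborel A f"]) auto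

lemma Cinf_eq: "Cinf = (LINT s:{0..}|lborel. flow_cov s)"
  unfolding ou_cov_def flow_cov_def matrix_exp_transpose
  by (rule arg_cong2[where f="\<lambda>A f. set_lebesgue_integral lborel A f"]) auto

lemma continuous_on_flow_cov: "continuous_on S flow_cov"
  unfolding flow_cov_def
  by (intro bounded_bilinear.continuous_on[OF bounded_bilinear_matrix_mult]
      bounded_linear.continuous_on[OF bounded_linear_transpose] continuous_on_matrix_exp continuous_on_const)

lemma set_integrable_flow_cov: "set_integrable lborel {0..} flow_cov"
proof -
  obtain C c where Cc: "C \<ge> 0" "c > 0" "\<And>t. t \<ge> 0 \<Longrightarrow> norm (E t) \<le> C * exp (- c * t)"
    using matrix_exp_decays[OF stable] by metis
  obtain K where K: "\<And>(X :: real^'n^'n) (Y :: real^'n^'n). norm (X ** Y) \<le> norm X * norm Y * K" "K \<ge> 0"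
    using bounded_bilinear.nonneg_bounded[OF bounded_bilinear_matrix_mult] by blast
  obtain L where L: "\<And>X :: real^'n^'n. norm (transpose X) \<le> norm X * L" "L \<ge> 0"
    using bounded_linear.nonneg_bounded[OF bounded_linear_transpose] by blast
  define M where "M = C * norm Q * K * (C * L) * K"
  have bound: "norm (flow_cov s) \<le> M * exp (- c * s)" if s: "s \<ge> 0" for s
  proof -
    have e: "norm (E s) \<le> C * exp (- c * s)" by (rule Cc(3)[OF s])
    also have "\<dots> \<le> C" using mult_left_mono[of "exp (- c * s)" 1 C] Cc(1,2) s by auto
    finally have e': "norm (E s) \<le> C" .
    have "norm (flow_cov s) \<le> norm (E s ** Q) * norm (transpose (E s)) * K" unfolding flow_cov_def by (rule K)
    also have "\<dots> \<le> (norm (E s) * norm Q * K) * (norm (E s) * L) * K"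
      using K L by (intro mult_right_mono mult_mono) (auto intro!: mult_nonneg_nonneg)
    also have "\<dots> \<le> (C * exp (- c * s) * norm Q * K) * (C * L) * K"
      using K L e e' Cc by (intro mult_right_mono mult_mono) (auto intro!: mult_nonneg_nonneg)
    finally show ?thesis by (simp add: M_def mult_ac)
  qed
  have "(\<lambda>s. exp (- c * s)) absolutely_integrable_on {0..}"
    using has_integral_exp_minus_to_infinity[OF Cc(2), of 0]
    by (intro nonnegative_absolutely_integrable_1) (auto simp: integrable_on_def)
  then have "set_integrable lborel {0..} (\<lambda>s. exp (- c * s))"
    unfolding set_integrable_def by (subst (asm) integrable_completion) auto
  then have "set_integrable lborel {0..} (\<lambda>s. M * exp (- c * s))" by (rule set_integrable_mult_right)
  then show ?thesis
    unfolding set_integrable_def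
  proof (rule Bochner_Integration.integrable_bound)
    have "(\<lambda>s. indicator {0..} s *\<^sub>R flow_cov s) \<in> borel_measurable borel"
      by (rule borel_measurable_continuous_on_indicator) (auto intro: continuous_on_flow_cov)
    then show "(\<lambda>s. indicator {0..} s *\<^sub>R flow_cov s) \<in> borel_measurable lborel" by simp
    show "AE s in lborel. norm (indicator {0..} s *\<^sub>R flow_cov s) \<le> norm (indicator {0..} s *\<^sub>R (M * exp (- c * s)))"
      using order_trans[OF bound abs_ge_self] by (intro AE_I2) (auto simp: indicator_def)
  qed
qed

lemma set_integrable_flow_cov_sub: "A \<in> sets borel \<Longrightarrow> A \<subseteq> {0..} \<Longrightarrow> set_integrable lborel A flow_cov"
  using set_integrable_subset[OF set_integrable_flow_cov] by simp

lemma set_integral_linear: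
  assumes "bounded_linear L" "set_integrable lborel A (f :: real \<Rightarrow> real^'n^'n)"
  shows "L (LINT s:A|lborel. f s) = (LINT s:A|lborel. (L (f s) :: 'b :: {banach, second_countable_topology}))"
    and "set_integrable lborel A (\<lambda>s. L (f s))"
proof -
  interpret L: bounded_linear L by fact
  show "L (LINT s:A|lborel. f s) = (LINT s:A|lborel. L (f s))"
    using integral_bounded_linear[OF assms(1) assms(2)[unfolded set_integrable_def]]
    by (simp add: set_lebesgue_integral_def L.scaleR)
  show "set_integrable lborel A (\<lambda>s. L (f s))"
    using integrable_bounded_linear[OF assms(1) assms(2)[unfolded set_integrable_def]]
    by (simp add: set_integrable_def L.scaleR)
qed

lemma transpose_flow_cov: "transpose (flow_cov s) = flow_cov s"
  by (simp add: flow_cov_def matrix_transpose_mul sym matrix_mul_assoc)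

lemma bounded_linear_quadratic: "bounded_linear (\<lambda>X :: real^'n^'n. (X *v x) \<bullet> x)"
  by (intro bounded_linear_compose[OF bounded_linear_inner_left]
      bounded_bilinear.bounded_linear_left[OF bounded_bilinear_matrix_vector_mult])

lemma flow_cov_quadratic: "(flow_cov s *v x) \<bullet> x = (Q *v (transpose (E s) *v x)) \<bullet> (transpose (E s) *v x)"
  by (simp add: flow_cov_def inner_matrix_transpose flip: matrix_vector_mul_assoc)

lemma transpose_exp_nonzero:
  assumes "x \<noteq> 0" shows "transpose (E s) *v x \<noteq> 0"
proof
  assume "transpose (E s) *v x = 0"
  then have "(transpose (E (- s)) ** transpose (E s)) *v x = 0"
    by (simp flip: matrix_vector_mul_assoc)
  moreover have "transpose (E (- s)) ** transpose (E s) = mat 1"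
    using matrix_exp_inverse(1)[of s B] by (simp flip: matrix_transpose_mul)
  ultimately show False using assms by simp
qed

lemma flow_cov_pos: "x \<noteq> 0 \<Longrightarrow> 0 < (flow_cov s *v x) \<bullet> x"
  using pd transpose_exp_nonzero unfolding flow_cov_quadratic positive_definite_def by blast

lemma transpose_Cov: "transpose (Cov t) = Cov t"
proof -
  have "set_integrable lborel {0..t} flow_cov" by (rule set_integrable_flow_cov_sub) auto
  from set_integral_linear(1)[OF bounded_linear_transpose this] show ?thesis
    by (simp add: Cov_eq transpose_flow_cov)
qed

lemma transpose_Cinf: "transpose Cinf = Cinf"
  using set_integral_linear(1)[OF bounded_linear_transpose set_integrable_flow_cov]
  by (simp add: Cinf_eq transpose_flow_cov)

lemma positive_definite_Cov:
  assumes "t > 0" shows "positive_definite (Cov t)"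
  unfolding positive_definite_def
proof safe
  fix x :: "real^'n" assume x: "x \<noteq> 0"
  let ?g = "\<lambda>s. (flow_cov s *v x) \<bullet> x"
  have int: "set_integrable lborel {0..t} flow_cov" by (rule set_integrable_flow_cov_sub) auto
  note lin = set_integral_linear[OF bounded_linear_quadratic[of x] int]
  have "\<exists>s\<in>{0..t}. \<forall>r\<in>{0..t}. ?g s \<le> ?g r"
    using assms by (intro continuous_attains_inf bounded_linear.continuous_on[OF bounded_linear_quadratic]
       continuous_on_flow_cov) auto
  then obtain s where s: "\<And>r. r \<in> {0..t} \<Longrightarrow> ?g s \<le> ?g r" by blast
  have "0 < t * ?g s" using flow_cov_pos[OF x] assms by simp
  also have "\<dots> = (LINT r:{0..t}|lborel. ?g s)" using assms by (simp add: set_lebesgue_integral_def)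
  also have "\<dots> \<le> (LINT r:{0..t}|lborel. ?g r)"
    by (rule set_integral_mono[OF borel_integrable_atLeastAtMost'[OF continuous_on_const] lin(2)]) (use s in auto)
  finally show "0 < (Cov t *v x) \<bullet> x" unfolding Cov_eq lin(1) .
qed

text \<open>Split the integral at \<open>t\<close> and shift the tail by \<open>t\<close>.\<close>

lemma Cinf_split:
  assumes "t > 0" shows "Cinf = Cov t + E t ** Cinf ** transpose (E t)"
proof -
  have bl: "bounded_linear (\<lambda>X. E t ** X ** transpose (E t))"
    by (rule bounded_linear_compose[OF bounded_bilinear.bounded_linear_left[OF bounded_bilinear_matrix_mult]
      bounded_bilinear.bounded_linear_right[OF bounded_bilinear_matrix_mult]])
  have "Cinf = (LINT s:{0..t} \<union> {t<..}|lborel. flow_cov s)"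
    unfolding Cinf_eq using assms by (intro arg_cong2[where f="\<lambda>A f. set_lebesgue_integral lborel A f"]) auto
  also have "\<dots> = Cov t + (LINT s:{t<..}|lborel. flow_cov s)"
    unfolding Cov_eq by (rule set_integral_Un) (use assms in \<open>auto intro!: set_integrable_flow_cov_sub\<close>)
  also have "(LINT s:{t<..}|lborel. flow_cov s) = (LINT s|lborel. indicator {t<..} (t + 1 * s) *\<^sub>R flow_cov (t + 1 * s))"
    unfolding set_lebesgue_integral_def by (subst lborel_integral_real_affine[where c=1 and t=t]) auto
  also have "\<dots> = (LINT s:{0<..}|lborel. flow_cov (t + s))"
    unfolding set_lebesgue_integral_def by (intro Bochner_Integration.integral_cong) (auto simp: indicator_def)
  also have "\<dots> = (LINT s:{0<..}|lborel. E t ** flow_cov s ** transpose (E t))"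
    by (simp add: flow_cov_def matrix_exp_add matrix_transpose_mul matrix_mul_assoc)
  also have "\<dots> = (LINT s:{0..}|lborel. E t ** flow_cov s ** transpose (E t))"
  proof (rule set_integral_cong_set)
    have meas: "set_borel_measurable lborel A (\<lambda>s. E t ** flow_cov s ** transpose (E t))" if "A \<in> sets borel" "A \<subseteq> {0..}" for A
      using set_integral_linear(2)[OF bl set_integrable_flow_cov_sub[OF that]]
      unfolding set_borel_measurable_def set_integrable_def by (rule borel_measurable_integrable)
    show "set_borel_measurable lborel {0..} (\<lambda>s. E t ** flow_cov s ** transpose (E t))"
      by (rule meas) auto
    show "set_borel_measurable lborel {0<..} (\<lambda>s. E t ** flow_cov s ** transpose (E t))"
      by (rule meas) auto
    show "AE x in lborel. (x \<in> {0..}) = (x \<in> {0::real<..})"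
      using AE_lborel_singleton[of "0::real"] by eventually_elim auto
  qed
  also have "\<dots> = E t ** Cinf ** transpose (E t)"
    unfolding Cinf_eq by (rule set_integral_linear(1)[OF bl set_integrable_flow_cov, symmetric])
  finally show ?thesis .
qed

lemma positive_definite_Cinf: "positive_definite Cinf"
  unfolding positive_definite_def
proof safe
  fix x :: "real^'n" assume x: "x \<noteq> 0"
  have nn: "0 \<le> (Cinf *v y) \<bullet> y" for y
    unfolding Cinf_eq set_integral_linear(1)[OF bounded_linear_quadratic set_integrable_flow_cov]
    unfolding set_lebesgue_integral_def
    by (rule Bochner_Integration.integral_nonneg) (metis flow_cov_pos inner_zero_right less_eq_real_def scaleR_nonneg_nonneg indicator_pos_le)
  have "(Cinf *v x) \<bullet> x = (Cov 1 *v x) \<bullet> x + (Cinf *v (transpose (E 1) *v x)) \<bullet> (transpose (E 1) *v x)"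
    by (subst Cinf_split[of 1]) (simp_all add: matrix_vector_mult_add_rdistrib inner_add_left inner_matrix_transpose
        flip: matrix_vector_mul_assoc)
  moreover have "(Cov 1 *v x) \<bullet> x > 0" using positive_definite_Cov[of 1] x by (auto simp: positive_definite_def)
  ultimately show "0 < (Cinf *v x) \<bullet> x" using nn[of "transpose (E 1) *v x"] by simp
qed

lemma Cov_rescaled_tendsto: "((\<lambda>t. (1 / t) *\<^sub>R Cov t) \<longlongrightarrow> Q) (at_right 0)"
proof -
  have "((\<lambda>u. integral {0..u} flow_cov) has_vector_derivative flow_cov 0) (at 0 within {0..1})"
    by (rule integral_has_vector_derivative) (auto intro: continuous_on_flow_cov)
  then have "((\<lambda>u. (1 / norm (u - 0)) *\<^sub>R (integral {0..u} flow_cov - (integral {0..0} flow_cov + (u - 0) *\<^sub>R flow_cov 0))) \<longlongrightarrow> 0) (at 0 within {0..1})"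
    unfolding has_vector_derivative_def has_derivative_within by blast
  then have lim: "((\<lambda>u. (1 / \<bar>u\<bar>) *\<^sub>R (integral {0..u} flow_cov - u *\<^sub>R Q)) \<longlongrightarrow> 0) (at_right 0)"
    by (simp add: at_within_Icc_at_right flow_cov_def matrix_exp_zero)
  have "((\<lambda>u. (1 / \<bar>u\<bar>) *\<^sub>R (integral {0..u} flow_cov - u *\<^sub>R Q) + Q) \<longlongrightarrow> 0 + Q) (at_right 0)"
    by (intro tendsto_add lim tendsto_const)
  then have "((\<lambda>t. (1 / t) *\<^sub>R Cov t) \<longlongrightarrow> 0 + Q) (at_right 0)"
  proof (rule Lim_transform_eventually)
    show "\<forall>\<^sub>F u in at_right 0. (1 / \<bar>u\<bar>) *\<^sub>R (integral {0..u} flow_cov - u *\<^sub>R Q) + Q = (1 / u) *\<^sub>R Cov u"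
      using eventually_at_right_less[of "0::real"]
    proof eventually_elim
      case (elim u)
      have "Cov u = integral {0..u} flow_cov"
        unfolding Cov_eq by (rule set_borel_integral_eq_integral) (auto intro: set_integrable_flow_cov_sub)
      then show ?case using elim by (simp add: scaleR_diff_right)
    qed
  qed
  then show ?thesis by simp
qed

section \<open>The semigroup as Gaussian averaging\<close>

abbreviation \<gamma> :: "(real^'n) measure" where "\<gamma> \<equiv> ou_measure Q B"

abbreviation H :: "real \<Rightarrow> (real^'n \<Rightarrow> real) \<Rightarrow> real^'n \<Rightarrow> real" where "H \<equiv> ou_semigroup Q B"

text \<open>The normalising constant of the centred Gaussian density with covariance \<open>A\<close>.\<close>

definition norm_const :: "real^'n^'n \<Rightarrow> real" where
  "norm_const A = (2 * pi) powr (- real CARD('n) / 2) * det A powr (- 1/2)"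

definition invariant_density :: "real^'n \<Rightarrow> real" where
  "invariant_density x = norm_const Cinf * exp (- (1/2) * ((matrix_inv Cinf *v x) \<bullet> x))"

text \<open>The centred Gaussian density with covariance \<open>Q\<^sub>t\<close>.\<close>

definition transition :: "real \<Rightarrow> real^'n \<Rightarrow> real" where
  "transition t v = norm_const (Cov t) * exp (- (1/2) * ((matrix_inv (Cov t) *v v) \<bullet> v))"

lemma norm_const_pos: "positive_definite A \<Longrightarrow> norm_const A > 0"
  using positive_definite_det_pos[of A] by (auto simp: norm_const_def)

lemma ou_measure_eq: "\<gamma> = density lborel (\<lambda>x. ennreal (invariant_density x))"
  by (simp add: ou_measure_def invariant_density_def norm_const_def)

lemma continuous_gaussian: "continuous_on UNIV (\<lambda>v. c * exp (- (1/2) * (((P :: real^'n^'n) *v v) \<bullet> v)))"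
  by (intro continuous_intros linear_continuous_on matrix_vector_mul_bounded_linear)

lemma isCont_transition: "isCont (transition t) v"
  using continuous_gaussian[of "norm_const (Cov t)" "matrix_inv (Cov t)"]
  by (simp add: transition_def[abs_def] continuous_on_eq_continuous_at)

lemma isCont_invariant_density: "isCont invariant_density v"
  using continuous_gaussian[of "norm_const Cinf" "matrix_inv Cinf"]
  by (simp add: invariant_density_def[abs_def] continuous_on_eq_continuous_at)

lemma borel_measurable_transition [measurable]: "transition t \<in> borel_measurable borel"
  using isCont_transition by (intro borel_measurable_continuous_onI) (simp add: continuous_at_imp_continuous_on)

lemma borel_measurable_invariant_density [measurable]: "invariant_density \<in> borel_measurable borel"
  using isCont_invariant_density by (intro borel_measurable_continuous_onI) (simp add: continuous_at_imp_continuous_on)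

lemma transition_pos: "t > 0 \<Longrightarrow> transition t v > 0"
  by (simp add: transition_def norm_const_pos positive_definite_Cov)

lemma invariant_density_pos: "invariant_density v > 0"
  by (simp add: invariant_density_def norm_const_pos positive_definite_Cinf)

lemma integrable_transition: "t > 0 \<Longrightarrow> integrable lborel (transition t)"
  unfolding transition_def[abs_def]
  by (intro integrable_mult_right integrable_gaussian positive_definite_matrix_inv positive_definite_Cov)

lemma integrable_invariant_density: "integrable lborel invariant_density"
  unfolding invariant_density_def[abs_def]
  by (intro integrable_mult_right integrable_gaussian positive_definite_matrix_inv positive_definite_Cinf)

lemma sets_ou_measure [simp, measurable_cong]: "sets \<gamma> = sets borel" by (simp add: ou_measure_eq)

lemma space_ou_measure [simp]: "space \<gamma> = UNIV" by (simp add: ou_measure_eq)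

lemma emeasure_ou_measure_UNIV: "emeasure \<gamma> UNIV = ennreal (\<integral>x. invariant_density x \<partial>lborel)"
  unfolding ou_measure_eq using integrable_invariant_density invariant_density_pos
  by (simp add: emeasure_density nn_integral_eq_integral less_imp_le)

lemma finite_ou_measure: "finite_measure \<gamma>"
  by (rule finite_measureI) (simp add: emeasure_ou_measure_UNIV)

lemma integral_ou_measure:
  "f \<in> borel_measurable borel \<Longrightarrow> (\<integral>x. f x \<partial>\<gamma>) = (\<integral>x. invariant_density x * f x \<partial>lborel)"
  unfolding ou_measure_eq by (subst integral_density) (auto simp: invariant_density_pos less_imp_le)

lemma AE_ou_measure: "(AE x in lborel. P x) \<Longrightarrow> (AE x in \<gamma>. P x)"
  unfolding ou_measure_eq by (subst AE_density) auto

lemma measure_ou_measure_pos: "measure \<gamma> UNIV > 0"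
  using lborel_integral_pos[OF integrable_invariant_density invariant_density_pos]
  by (simp add: measure_def emeasure_ou_measure_UNIV)

lemma integrable_ou_measure_bounded:
  assumes "f \<in> borel_measurable borel" "\<And>x. \<bar>f x\<bar> \<le> (C::real)"
  shows "integrable \<gamma> f"
  by (rule finite_measure.integrable_const_bound[OF finite_ou_measure, of _ C]) (use assms in auto)

text \<open>Mehler's formula: the law \<open>K\<^sub>t(x,u) d\<gamma>(u)\<close> is Gaussian with mean \<open>exp(tB) x\<close> and
  covariance \<open>Q\<^sub>t\<close>.\<close>

lemma kernel_times_density:
  assumes t: "t > 0"
  shows "invariant_density u * ou_kernel Q B t x u = transition t (u - E t *v x)"
proof -
  note ci = matrix_inv_invertible[OF positive_definite_invertible[OF positive_definite_Cinf]]
  note ct = matrix_inv_invertible[OF positive_definite_invertible[OF positive_definite_Cov[OF t]]]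
  have dets: "det Cinf > 0" "det (Cov t) > 0"
    using positive_definite_det_pos positive_definite_Cinf positive_definite_Cov[OF t] by auto
  have F: "transpose (E t) ** matrix_exp ((- t) *\<^sub>R transpose B) = mat 1"
    unfolding matrix_exp_transpose using matrix_exp_inverse(2)[of t B] by (metis matrix_transpose_mul transpose_mat)
  have tr: "transpose (matrix_inv Cinf) = matrix_inv Cinf" "transpose (matrix_inv (Cov t)) = matrix_inv (Cov t)"
    by (auto intro!: symmetric_matrix_inv transpose_Cinf transpose_Cov positive_definite_invertible
        positive_definite_Cinf positive_definite_Cov t)
  note ex = kernel_exponent[OF tr(2,1) ci(2,1) ct(2,1) Cinf_split[OF t] F, of x u, folded ou_D_def]
  have "(det Cinf / det (Cov t)) powr (1/2) * norm_const Cinf = norm_const (Cov t)"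
    using dets by (simp add: norm_const_def powr_divide powr_minus field_simps)
  then have "invariant_density u * ou_kernel Q B t x u = norm_const (Cov t) *
     (exp (- (1/2) * ((matrix_inv Cinf *v u) \<bullet> u)) * exp (ou_R Q B x) *
      exp (- (1/2) * (((matrix_inv (Cov t) - matrix_inv Cinf) *v (u - ou_D Q B t *v x)) \<bullet> (u - ou_D Q B t *v x))))"
    unfolding invariant_density_def ou_kernel_def by (simp add: mult_ac)
  also have "\<dots> = transition t (u - E t *v x)"
    unfolding transition_def using ex by (simp add: ou_R_def flip: exp_add)
  finally show ?thesis .
qed

lemma borel_measurable_kernel: "ou_kernel Q B t x \<in> borel_measurable borel"
proof -
  have "continuous_on UNIV (\<lambda>u. ou_kernel Q B t x u)"
    unfolding ou_kernel_def
    by (intro continuous_intros continuous_on_compose2[OF linear_continuous_on[OF matrix_vector_mul_bounded_linear]]) auto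
  then show ?thesis by (rule borel_measurable_continuous_onI)
qed

lemma ou_semigroup_eq:
  assumes "t > 0" and [measurable]: "f \<in> borel_measurable borel"
  shows "H t f x = (\<integral>u. transition t (u - E t *v x) * f u \<partial>lborel)"
proof -
  note borel_measurable_kernel[measurable]
  have "H t f x = (\<integral>u. invariant_density u * (ou_kernel Q B t x u * f u) \<partial>lborel)"
    unfolding ou_semigroup_def by (rule integral_ou_measure) simp
  then show ?thesis by (simp add: kernel_times_density[OF assms(1)] flip: mult.assoc)
qed

definition mass :: "real \<Rightarrow> real" where "mass t = (\<integral>u. transition t u \<partial>lborel)"

lemma mass_shift:
  assumes "t > 0"
  shows "integrable lborel (\<lambda>u. transition t (u - a))" "(\<integral>u. transition t (u - a) \<partial>lborel) = mass t"
  using lborel_integral_translate[OF integrable_transition[OF assms], of "- a"] by (simp_all add: mass_def)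

lemma integrable_transition_mult:
  assumes t: "t > 0" and [measurable]: "f \<in> borel_measurable borel" and M: "\<And>u. \<bar>f u\<bar> \<le> M"
  shows "integrable lborel (\<lambda>u. transition t (u - a) * f u)"
proof (rule Bochner_Integration.integrable_bound)
  show "integrable lborel (\<lambda>u. M * transition t (u - a))" by (intro integrable_mult_right mass_shift t)
  have "\<bar>transition t (u - a) * f u\<bar> \<le> \<bar>M * transition t (u - a)\<bar>" for u
    using M[of u] transition_pos[OF t, of "u - a"] by (simp add: abs_mult)
  then show "AE u in lborel. norm (transition t (u - a) * f u) \<le> norm (M * transition t (u - a))" by simp
qed simp

lemma ou_semigroup_bound:
  assumes t: "t > 0" and f: "f \<in> borel_measurable borel" and M: "\<And>u. \<bar>f u\<bar> \<le> M"
  shows "\<bar>H t f x\<bar> \<le> M * mass t"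
proof -
  have "\<bar>H t f x\<bar> \<le> (\<integral>u. \<bar>transition t (u - E t *v x) * f u\<bar> \<partial>lborel)"
    unfolding ou_semigroup_eq[OF t f] by (rule integral_abs_bound)
  also have "\<dots> \<le> (\<integral>u. M * transition t (u - E t *v x) \<partial>lborel)"
  proof (rule integral_mono)
    show "integrable lborel (\<lambda>u. \<bar>transition t (u - E t *v x) * f u\<bar>)"
      using integrable_transition_mult[OF t f M] by (rule integrable_abs)
    show "integrable lborel (\<lambda>u. M * transition t (u - E t *v x))" by (intro integrable_mult_right mass_shift t)
    show "\<bar>transition t (u - E t *v x) * f u\<bar> \<le> M * transition t (u - E t *v x)" for u
      using M[of u] transition_pos[OF t, of "u - E t *v x"] by (simp add: abs_mult mult.commute mult_right_mono)
  qed
  also have "\<dots> = M * mass t" by (simp add: mass_shift t)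
  finally show ?thesis .
qed

text \<open>Moving \<open>x\<close> translates the transition density, which is a continuous motion in \<open>L\<^sup>1\<close>.\<close>

lemma isCont_ou_semigroup:
  assumes t: "t > 0" and f: "f \<in> borel_measurable borel" and M: "\<And>u. \<bar>f u\<bar> \<le> M"
  shows "isCont (H t f) x"
  unfolding continuous_at_sequentially
proof safe
  fix z assume z: "z \<longlonglongrightarrow> x"
  define g where "g u = transition t (u - E t *v x)" for u
  define h where "h k = E t *v x - E t *v z k" for k
  have g: "integrable lborel g" unfolding g_def using t by (rule mass_shift)
  have gc: "isCont g u" for u
    unfolding g_def by (rule isCont_o2[OF _ isCont_transition]) (intro continuous_intros)
  have "h \<longlonglongrightarrow> E t *v x - E t *v x"
    unfolding h_def by (intro tendsto_intros bounded_linear.tendsto[OF matrix_vector_mul_bounded_linear] z)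
  then have h: "h \<longlonglongrightarrow> 0" by simp
  have gh: "transition t (u - E t *v z k) = g (u + h k)" for u k by (simp add: g_def h_def algebra_simps)
  have lim: "(\<lambda>k. M * (\<integral>u. \<bar>g (u + h k) - g u\<bar> \<partial>lborel)) \<longlonglongrightarrow> M * 0"
    by (intro tendsto_mult tendsto_const translation_L1_continuous g h) (simp add: gc)
  have bnd: "norm (H t f (z k) - H t f x) \<le> M * (\<integral>u. \<bar>g (u + h k) - g u\<bar> \<partial>lborel)" for k
  proof -
    have i1: "integrable lborel (\<lambda>u. transition t (u - E t *v y) * f u)" for y
      by (rule integrable_transition_mult[OF t f M])
    have i2: "integrable lborel (\<lambda>u. \<bar>g (u + h k) - g u\<bar>)"
      using g lborel_integral_translate(1)[OF g] by (intro integrable_abs Bochner_Integration.integrable_diff)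
    have "H t f (z k) - H t f x = (\<integral>u. (g (u + h k) - g u) * f u \<partial>lborel)"
      unfolding ou_semigroup_eq[OF t f] using i1[of "z k"] i1[of x]
      by (simp add: gh g_def[symmetric] left_diff_distrib)
    also have "norm \<dots> \<le> (\<integral>u. M * \<bar>g (u + h k) - g u\<bar> \<partial>lborel)"
    proof (rule Bochner_Integration.integral_norm_bound_integral)
      show "integrable lborel (\<lambda>u. (g (u + h k) - g u) * f u)"
        using i1[of "z k"] i1[of x] by (simp add: gh g_def[symmetric] left_diff_distrib)
      show "norm ((g (u + h k) - g u) * f u) \<le> M * \<bar>g (u + h k) - g u\<bar>" for u
        using M[of u] by (simp add: abs_mult mult.commute mult_right_mono)
    qed (use i2 in simp)
    finally show ?thesis by simp
  qed
  have "(\<lambda>k. H t f (z k) - H t f x) \<longlonglongrightarrow> 0"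
    by (rule Lim_null_comparison[OF _ lim[simplified]]) (use bnd in auto)
  then show "(H t f \<circ> z) \<longlonglongrightarrow> H t f x" unfolding o_def by (rule Lim_null[THEN iffD2])
qed

lemma borel_measurable_ou_semigroup:
  assumes "t > 0" "f \<in> borel_measurable borel" "\<And>u. \<bar>f u\<bar> \<le> M"
  shows "H t f \<in> borel_measurable borel"
  by (intro borel_measurable_continuous_onI continuous_at_imp_continuous_on ballI isCont_ou_semigroup[OF assms])

lemma ou_semigroup_sum_square_wave:
  assumes t: "t > 0"
  shows "H t (\<lambda>u. c * (\<Sum>j<n. square_wave i (ms ! j) u)) x = c * (\<Sum>j<n. H t (square_wave i (ms ! j)) x)"
proof -
  have int: "integrable lborel (\<lambda>u. transition t (u - E t *v x) * square_wave i (ms ! j) u)" for j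
    by (rule integrable_transition_mult[OF t, where M = 1]) auto
  have "H t (\<lambda>u. c * (\<Sum>j<n. square_wave i (ms ! j) u)) x
      = (\<integral>u. c * (\<Sum>j<n. transition t (u - E t *v x) * square_wave i (ms ! j) u) \<partial>lborel)"
    by (subst ou_semigroup_eq[OF t]) (simp_all add: sum_distrib_left sum_distrib_right mult_ac)
  also have "\<dots> = c * (\<Sum>j<n. H t (square_wave i (ms ! j)) x)"
    using int by (simp add: ou_semigroup_eq[OF t] Bochner_Integration.integral_sum)
  finally show ?thesis .
qed

text \<open>The variation is a supremum of continuous functions of \<open>x\<close>, hence lower semicontinuous.  This makes
  its superlevel sets measurable, so that their measure in the weak type inequality is meaningful.\<close>

lemma open_ou_variation_greater:
  assumes f: "f \<in> borel_measurable borel" and M: "\<And>u. \<bar>f u\<bar> \<le> M" and \<alpha>: "\<alpha> \<ge> 0"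
  shows "open {x. ou_variation Q B 2 f x > ennreal \<alpha>}"
proof -
  let ?I = "{(N :: nat, t :: nat \<Rightarrow> real). strict_mono_on {0..N} t \<and> t ` {0..N} \<subseteq> {0<..}}"
  let ?V = "\<lambda>N t x. (\<Sum>i=1..N. \<bar>H (t i) f x - H (t (i - 1)) f x\<bar> powr 2) powr (1/2)"
  have "{x. ou_variation Q B 2 f x > ennreal \<alpha>} = (\<Union>(N, t)\<in>?I. {x. \<alpha> < ?V N t x})"
    unfolding ou_variation_def variation_def less_SUP_iff
    using \<alpha> by (auto simp: ennreal_less_iff)
  also have "open \<dots>"
  proof (intro open_UN ballI, clarify)
    fix N and t :: "nat \<Rightarrow> real" assume t: "t ` {0..N} \<subseteq> {0<..}"
    have "continuous_on UNIV (\<lambda>x. \<Sum>i=1..N. (H (t i) f x - H (t (i - 1)) f x)\<^sup>2)"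
    proof (intro continuous_on_sum continuous_on_power continuous_on_diff)
      fix i assume i: "i \<in> {1..N}"
      have "t i > 0" "t (i - 1) > 0" using t i by (auto simp: image_subset_iff)
      then show "continuous_on UNIV (H (t i) f)" "continuous_on UNIV (H (t (i - 1)) f)"
        by (auto intro!: continuous_at_imp_continuous_on isCont_ou_semigroup[OF _ f M])
    qed
    then have "continuous_on UNIV (\<lambda>x. sqrt (\<Sum>i=1..N. (H (t i) f x - H (t (i - 1)) f x)\<^sup>2))"
      by (rule continuous_on_real_sqrt)
    moreover have "?V N t x = sqrt (\<Sum>i=1..N. (H (t i) f x - H (t (i - 1)) f x)\<^sup>2)" for x
      by (simp add: powr_half_sqrt sum_nonneg)
    ultimately show "open {x. \<alpha> < ?V N t x}"
      by (simp add: open_Collect_less)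
  qed
  finally show ?thesis .
qed

section \<open>High frequencies and small times\<close>

lemma ou_semigroup_square_wave_tendsto_0:
  assumes t: "t > 0"
  shows "(\<lambda>m. H t (square_wave i (Suc m)) x) \<longlonglongrightarrow> 0"
proof -
  define g where "g u = transition t (u - E t *v x)" for u
  have g: "integrable lborel g" unfolding g_def using t by (rule mass_shift)
  have gc: "isCont g u" for u
    unfolding g_def by (rule isCont_o2[OF _ isCont_transition]) (intro continuous_intros)
  show ?thesis
    unfolding ou_semigroup_eq[OF t borel_measurable_square_wave] g_def[symmetric]
    by (rule riemann_lebesgue_square_wave[OF g]) (simp add: gc)
qed

text \<open>The pointwise convergence is upgraded to \<open>L\<^sup>1\<close>, so that one frequency serves all
  \<open>x\<close> outside a set of small measure.\<close>

lemma ou_semigroup_square_wave_L1_tendsto_0: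
  assumes t: "t > 0"
  shows "(\<lambda>m. \<integral>x. \<bar>H t (square_wave i (Suc m)) x\<bar> \<partial>\<gamma>) \<longlonglongrightarrow> 0"
proof -
  interpret finite_measure \<gamma> by (rule finite_ou_measure)
  have "(\<lambda>m. \<integral>x. \<bar>H t (square_wave i (Suc m)) x\<bar> \<partial>\<gamma>) \<longlonglongrightarrow> (\<integral>x. 0 \<partial>\<gamma>)"
  proof (rule integral_dominated_convergence[where w = "\<lambda>_. mass t"])
    show "AE x in \<gamma>. (\<lambda>m. \<bar>H t (square_wave i (Suc m)) x\<bar>) \<longlonglongrightarrow> 0"
      using ou_semigroup_square_wave_tendsto_0[OF t] by (intro AE_I2 tendsto_rabs_zero)
    show "AE x in \<gamma>. norm \<bar>H t (square_wave i (Suc m)) x\<bar> \<le> mass t" for m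
      using ou_semigroup_bound[OF t borel_measurable_square_wave[of i "Suc m"], of 1] by simp
    show "(\<lambda>x. \<bar>H t (square_wave i (Suc m)) x\<bar>) \<in> borel_measurable \<gamma>" for m
      using borel_measurable_ou_semigroup[OF t borel_measurable_square_wave[of i "Suc m"], of 1] by simp
  qed auto
  then show ?thesis by simp
qed

text \<open>The limit of the masses of the transition densities as \<open>t \<longrightarrow> 0\<close>.\<close>

definition \<kappa> :: real where
  "\<kappa> = norm_const Q * (\<integral>v. exp (- (1/2) * ((matrix_inv Q *v v) \<bullet> v)) \<partial>lborel)"

lemma \<kappa>_pos: "\<kappa> > 0"
  unfolding \<kappa>_def using norm_const_pos[OF pd]
  by (intro mult_pos_pos lborel_integral_pos integrable_gaussian positive_definite_matrix_inv pd) auto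

text \<open>In the variable \<open>v\<close> with \<open>u = exp(tB) x + sqrt t *\<^sub>R v\<close> the Gaussian has covariance
  \<open>Q\<^sub>t / t\<close>, which converges to the nondegenerate matrix \<open>Q\<close>.\<close>

lemma ou_semigroup_rescaled:
  assumes t: "t > 0" and f: "f \<in> borel_measurable borel"
  shows "H t f x = norm_const ((1/t) *\<^sub>R Cov t) *
    (\<integral>v. exp (- (1/2) * ((matrix_inv ((1/t) *\<^sub>R Cov t) *v v) \<bullet> v)) * f (E t *v x + sqrt t *\<^sub>R v) \<partial>lborel)"
proof -
  note f[measurable]
  have det: "det (Cov t) > 0" by (intro positive_definite_det_pos positive_definite_Cov t)
  have inv: "invertible (Cov t)" by (intro positive_definite_invertible positive_definite_Cov t)
  let ?y = "sqrt t ^ CARD('n)"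
  have y: "?y > 0" using t by simp
  have "(1 / t) ^ CARD('n) = 1 / ?y\<^sup>2"
    using t by (simp add: power_one_over flip: power_mult power_even_eq)
       (metis mult.commute power_mult real_sqrt_pow2 less_imp_le)
  then have "((1 / t) ^ CARD('n)) powr (- 1/2) = ?y"
    using y by (simp add: powr_minus powr_half_sqrt real_sqrt_divide)
  then have nc: "norm_const ((1/t) *\<^sub>R Cov t) = ?y * norm_const (Cov t)"
    using det t by (simp add: norm_const_def det_scaleR powr_mult)
  have tr: "norm_const (Cov t) * exp (- (1/2) * ((matrix_inv ((1/t) *\<^sub>R Cov t) *v v) \<bullet> v)) = transition t (sqrt t *\<^sub>R v)" for v
    using t by (simp add: transition_def matrix_inv_scaleR(2)[OF inv] matrix_vector_mult_scaleR flip: scaleR_matrix_vector_assoc)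
  have "H t f x = ?y * (\<integral>v. transition t (sqrt t *\<^sub>R v) * f (E t *v x + sqrt t *\<^sub>R v) \<partial>lborel)"
    unfolding ou_semigroup_eq[OF t f]
    by (subst lborel_integral_affine[where c = "sqrt t" and a = "E t *v x"]) (use t in auto)
  then show ?thesis unfolding nc tr[symmetric] by (simp add: mult.assoc)
qed

text \<open>Dominated convergence in the rescaled formula, with a fixed Gaussian as majorant.\<close>

lemma ou_semigroup_tendsto_at_0:
  assumes f: "f \<in> borel_measurable borel" and M: "\<And>u. \<bar>f u\<bar> \<le> M" and cont: "isCont f x"
  shows "((\<lambda>t. H t f x) \<longlongrightarrow> \<kappa> * f x) (at_right 0)"
proof -
  note f[measurable]
  define A where "A t = (1 / t) *\<^sub>R Cov t" for t
  define G where "G t v = exp (- (1/2) * ((matrix_inv (A t) *v v) \<bullet> v)) * f (E t *v x + sqrt t *\<^sub>R v)" for t v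
  define G0 where "G0 v = exp (- (1/2) * ((matrix_inv Q *v v) \<bullet> v)) * f x" for v
  have A: "(A \<longlongrightarrow> Q) (at_right 0)" unfolding A_def by (rule Cov_rescaled_tendsto)
  have pos: "\<forall>\<^sub>F t in at_right 0. 0 < (t::real)" by (rule eventually_at_right_less)
  have inv: "\<forall>\<^sub>F t in at_right 0. invertible (A t)"
    using pos by eventually_elim (simp add: A_def matrix_inv_scaleR(1)[OF positive_definite_invertible[OF positive_definite_Cov]])
  obtain c where c: "c > 0" and
    coer: "\<forall>\<^sub>F t in at_right 0. invertible (A t) \<longrightarrow> (\<forall>v. c * (norm v)\<^sup>2 \<le> (matrix_inv (A t) *v v) \<bullet> v)"
    using eventually_matrix_inv_coercive[OF A pd] by blast
  have E0: "((\<lambda>t. E t *v x) \<longlongrightarrow> x) (at_right 0)"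
  proof -
    have "((\<lambda>t. E t) \<longlongrightarrow> E 0) (at_right 0)"
    proof (rule tendsto_mono)
      have "isCont E 0" using continuous_on_matrix_exp[of UNIV B] by (simp add: continuous_on_eq_continuous_at)
      then show "((\<lambda>t. E t) \<longlongrightarrow> E 0) (at 0)" by (rule isContD)
    qed (rule at_le, simp)
    then have "((\<lambda>t. E t *v x) \<longlongrightarrow> E 0 *v x) (at_right 0)"
      by (rule bounded_linear.tendsto[OF bounded_bilinear.bounded_linear_left[OF bounded_bilinear_matrix_vector_mult]])
    then show ?thesis by (simp add: matrix_exp_zero)
  qed
  have arg: "((\<lambda>t. E t *v x + sqrt t *\<^sub>R v) \<longlongrightarrow> x) (at_right 0)" for v
  proof -
    have "((\<lambda>t. E t *v x + sqrt t *\<^sub>R v) \<longlongrightarrow> x + sqrt 0 *\<^sub>R v) (at_right 0)"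
      by (intro tendsto_intros E0)
    then show ?thesis by simp
  qed
  have lim: "((\<lambda>t. G t v) \<longlongrightarrow> G0 v) (at_right 0)" for v
    unfolding G_def G0_def
    by (intro tendsto_intros isCont_tendsto_compose[OF cont] arg tendsto_matrix_inv_vec[OF A _ inv] positive_definite_invertible pd)
  have meas: "G t \<in> borel_measurable borel" for t
  proof -
    have [measurable]: "(\<lambda>v. exp (- (1/2) * ((matrix_inv (A t) *v v) \<bullet> v))) \<in> borel_measurable borel"
      using continuous_gaussian[of 1 "matrix_inv (A t)"] by (simp add: borel_measurable_continuous_onI)
    show ?thesis unfolding G_def[abs_def] by measurable
  qed
  have "((\<lambda>r. \<integral>v. G (inverse r) v \<partial>lborel) \<longlongrightarrow> (\<integral>v. G0 v \<partial>lborel)) at_top"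
  proof (rule integral_dominated_convergence_at_top[where w = "\<lambda>v. M * exp (- (c/2) * (norm v)\<^sup>2)"])
    show "G0 \<in> borel_measurable lborel"
      using continuous_gaussian[of 1 "matrix_inv Q"] unfolding G0_def[abs_def]
      by (intro borel_measurable_times borel_measurable_const) (simp add: borel_measurable_continuous_onI)
    show "integrable lborel (\<lambda>v :: real^'n. M * exp (- (c/2) * (norm v)\<^sup>2))"
      using c integrable_exp_neg_norm_sq[of "c/2"] by (intro integrable_mult_right) simp
    show "AE v in lborel. ((\<lambda>r. G (inverse r) v) \<longlongrightarrow> G0 v) at_top"
      using lim by (intro AE_I2) (simp add: filterlim_at_right_to_top)
    have "\<forall>\<^sub>F t in at_right 0. \<forall>v. norm (G t v) \<le> M * exp (- (c/2) * (norm v)\<^sup>2)"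
      using inv coer
    proof eventually_elim
      case (elim t)
      show ?case
      proof
        fix v
        have "norm (G t v) = \<bar>f (E t *v x + sqrt t *\<^sub>R v)\<bar> * exp (- (1/2) * ((matrix_inv (A t) *v v) \<bullet> v))"
          by (simp add: G_def abs_mult)
        also have "\<dots> \<le> M * exp (- (c/2) * (norm v)\<^sup>2)"
          using elim M order_trans[OF abs_ge_zero M] by (intro mult_mono) auto
        finally show "norm (G t v) \<le> M * exp (- (c/2) * (norm v)\<^sup>2)" .
      qed
    qed
    then show "\<forall>\<^sub>F r in at_top. AE v in lborel. norm (G (inverse r) v) \<le> M * exp (- (c/2) * (norm v)\<^sup>2)"
      unfolding eventually_at_right_to_top by eventually_elim simp
  qed (use meas in simp)
  then have int: "((\<lambda>t. \<integral>v. G t v \<partial>lborel) \<longlongrightarrow> (\<integral>v. G0 v \<partial>lborel)) (at_right 0)"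
    unfolding filterlim_at_right_to_top .
  have nc: "((\<lambda>t. norm_const (A t)) \<longlongrightarrow> norm_const Q) (at_right 0)"
    unfolding norm_const_def using positive_definite_det_pos[OF pd]
    by (intro tendsto_intros tendsto_det A) auto
  have "((\<lambda>t. norm_const (A t) * (\<integral>v. G t v \<partial>lborel)) \<longlongrightarrow> norm_const Q * (\<integral>v. G0 v \<partial>lborel)) (at_right 0)"
    by (rule tendsto_mult[OF nc int])
  moreover have "norm_const Q * (\<integral>v. G0 v \<partial>lborel) = \<kappa> * f x"
    unfolding G0_def \<kappa>_def by simp
  ultimately have "((\<lambda>t. norm_const (A t) * (\<integral>v. G t v \<partial>lborel)) \<longlongrightarrow> \<kappa> * f x) (at_right 0)" by simp
  then show ?thesis
  proof (rule Lim_transform_eventually)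
    show "\<forall>\<^sub>F t in at_right 0. norm_const (A t) * (\<integral>v. G t v \<partial>lborel) = H t f x"
      using pos by eventually_elim (simp add: ou_semigroup_rescaled[OF _ f] A_def G_def)
  qed
qed

abbreviation small :: "nat \<Rightarrow> real" where "small k \<equiv> inverse (real (Suc k))"

lemma small_tendsto: "filterlim small (at_right 0) sequentially"
  unfolding filterlim_at using LIMSEQ_inverse_real_of_nat by auto

lemma mass_tendsto: "((\<lambda>k. mass (small k)) \<longlonglongrightarrow> \<kappa>)"
proof -
  have "((\<lambda>t. H t (\<lambda>_. 1) 0) \<longlongrightarrow> \<kappa> * 1) (at_right 0)"
    by (rule ou_semigroup_tendsto_at_0[where M = 1]) auto
  from filterlim_compose[OF this small_tendsto] have "(\<lambda>k. H (small k) (\<lambda>_. 1) 0) \<longlonglongrightarrow> \<kappa>" by simp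
  moreover have "H (small k) (\<lambda>_. 1) 0 = mass (small k)" for k
    by (subst ou_semigroup_eq) (simp_all add: mass_def)
  ultimately show ?thesis by simp
qed

lemma ou_semigroup_square_wave_L1_tendsto_identity:
  assumes m: "m > 0"
  shows "(\<lambda>k. \<integral>x. \<bar>H (small k) (square_wave i m) x - \<kappa> * square_wave i m x\<bar> \<partial>\<gamma>) \<longlonglongrightarrow> 0"
proof -
  interpret finite_measure \<gamma> by (rule finite_ou_measure)
  obtain C where C: "\<And>k. norm (mass (small k)) \<le> C"
    using convergent_imp_Bseq[OF convergentI[OF mass_tendsto]] unfolding Bseq_def by blast
  have "(\<lambda>k. \<integral>x. \<bar>H (small k) (square_wave i m) x - \<kappa> * square_wave i m x\<bar> \<partial>\<gamma>) \<longlonglongrightarrow> (\<integral>x. 0 \<partial>\<gamma>)"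
  proof (rule integral_dominated_convergence[where w = "\<lambda>_. C + \<kappa>"])
    have "AE x in \<gamma>. isCont (square_wave i m) x"
    proof (rule AE_ou_measure)
      show "AE x in lborel. isCont (square_wave i m) x"
        using AE_not_grid[OF m, of i]
        by eventually_elim (rule isCont_square_wave)
    qed
    then show "AE x in \<gamma>. (\<lambda>k. \<bar>H (small k) (square_wave i m) x - \<kappa> * square_wave i m x\<bar>) \<longlonglongrightarrow> 0"
    proof eventually_elim
      case (elim x)
      have "((\<lambda>t. H t (square_wave i m) x) \<longlongrightarrow> \<kappa> * square_wave i m x) (at_right 0)"
        by (rule ou_semigroup_tendsto_at_0[where M = 1]) (auto simp: elim)
      from filterlim_compose[OF this small_tendsto] show ?case
        by (intro tendsto_rabs_zero) (rule LIM_zero)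
    qed
    show "AE x in \<gamma>. norm \<bar>H (small k) (square_wave i m) x - \<kappa> * square_wave i m x\<bar> \<le> C + \<kappa>" for k
    proof (rule AE_I2)
      fix x
      have "\<bar>H (small k) (square_wave i m) x\<bar> \<le> 1 * mass (small k)"
        by (rule ou_semigroup_bound) auto
      moreover have "\<bar>\<kappa> * square_wave i m x\<bar> = \<kappa>" using \<kappa>_pos by (simp add: abs_mult)
      ultimately show "norm \<bar>H (small k) (square_wave i m) x - \<kappa> * square_wave i m x\<bar> \<le> C + \<kappa>" using C[of k] by simp
    qed
    show "(\<lambda>x. \<bar>H (small k) (square_wave i m) x - \<kappa> * square_wave i m x\<bar>) \<in> borel_measurable \<gamma>" for k
      using borel_measurable_ou_semigroup[of "small k", OF _ borel_measurable_square_wave[of i m], of 1] by simp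
  qed auto
  then show ?thesis by simp
qed

section \<open>A random walk inside the semigroup\<close>

lemma square_wave_pattern_tendsto_0:
  assumes ms: "\<forall>m\<in>set ms. m > 0" and G: "\<And>s. \<bar>G s\<bar> \<le> (1::real)"
  shows "(\<lambda>m. \<integral>x. square_wave i (Suc m) x * G (pattern i ms x) \<partial>\<gamma>) \<longlonglongrightarrow> 0"
proof -
  note borel_measurable_pattern[measurable]
  define g where "g x = invariant_density x * G (pattern i ms x)" for x
  have "integrable lborel g"
  proof (rule Bochner_Integration.integrable_bound[OF integrable_invariant_density])
    have "norm (g x) \<le> norm (invariant_density x)" for x
      using G[of "pattern i ms x"] by (simp add: g_def abs_mult mult_left_le)
    then show "AE x in lborel. norm (g x) \<le> norm (invariant_density x)" by simp
  qed (simp add: g_def[abs_def])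
  moreover have "AE x in lborel. isCont g x"
    using AE_isCont_pattern[OF ms, of G i] unfolding g_def[abs_def]
    by eventually_elim (intro continuous_mult isCont_invariant_density)
  ultimately have "(\<lambda>m. \<integral>x. g x * square_wave i (Suc m) x \<partial>lborel) \<longlonglongrightarrow> 0" by (rule riemann_lebesgue_square_wave)
  moreover have "(\<integral>x. square_wave i (Suc m) x * G (pattern i ms x) \<partial>\<gamma>) = (\<integral>x. g x * square_wave i (Suc m) x \<partial>lborel)" for m
    by (subst integral_ou_measure) (simp_all add: g_def mult_ac)
  ultimately show ?thesis by simp
qed

text \<open>There are only finitely many sign patterns of the old waves, so one frequency suits all functions
  \<open>G\<close> of them.\<close>

lemma eventually_square_wave_uncorrelated:
  assumes ms: "\<forall>m\<in>set ms. m > 0" and \<epsilon>: "\<epsilon> > 0"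
  shows "\<forall>\<^sub>F m in sequentially. \<forall>G. (\<forall>s. \<bar>G s\<bar> \<le> (1::real)) \<longrightarrow>
    \<bar>\<integral>x. square_wave i (Suc m) x * G (pattern i ms x) \<partial>\<gamma>\<bar> \<le> \<epsilon>"
proof -
  note borel_measurable_pattern[measurable]
  define S where "S = {s :: real list. set s \<subseteq> {1, -1} \<and> length s = length ms}"
  have S: "finite S" unfolding S_def by (rule finite_lists_length_eq) simp
  have pS: "pattern i ms x \<in> S" for x using square_wave_cases by (fastforce simp: S_def)
  define a where "a m s = (\<integral>x. square_wave i (Suc m) x * of_bool (pattern i ms x = s) \<partial>\<gamma>)" for m s
  have "(\<lambda>m. \<Sum>s\<in>S. \<bar>a m s\<bar>) \<longlonglongrightarrow> (\<Sum>s\<in>S. 0)"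
    unfolding a_def by (intro tendsto_sum tendsto_rabs_zero square_wave_pattern_tendsto_0 ms) simp
  then have "\<forall>\<^sub>F m in sequentially. (\<Sum>s\<in>S. \<bar>a m s\<bar>) < \<epsilon>"
    using \<epsilon> by (intro order_tendstoD) auto
  then show ?thesis
  proof (eventually_elim, safe)
    fix m and G :: "real list \<Rightarrow> real" assume small: "(\<Sum>s\<in>S. \<bar>a m s\<bar>) < \<epsilon>" and G: "\<forall>s. \<bar>G s\<bar> \<le> (1::real)"
    have int: "integrable \<gamma> (\<lambda>x. square_wave i (Suc m) x * of_bool (pattern i ms x = s))" for s
      by (rule integrable_ou_measure_bounded[of _ 1]) (auto simp: abs_mult)
    have "(\<integral>x. square_wave i (Suc m) x * G (pattern i ms x) \<partial>\<gamma>)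
        = (\<integral>x. (\<Sum>s\<in>S. G s * (square_wave i (Suc m) x * of_bool (pattern i ms x = s))) \<partial>\<gamma>)"
    proof (rule Bochner_Integration.integral_cong[OF refl])
      fix x
      have "(\<Sum>s\<in>S. G s * (square_wave i (Suc m) x * of_bool (pattern i ms x = s)))
          = (\<Sum>s\<in>S. if s = pattern i ms x then G s * square_wave i (Suc m) x else 0)"
        by (intro sum.cong) auto
      then show "square_wave i (Suc m) x * G (pattern i ms x)
          = (\<Sum>s\<in>S. G s * (square_wave i (Suc m) x * of_bool (pattern i ms x = s)))"
        using S pS[of x] by (simp add: sum.delta)
    qed
    also have "\<dots> = (\<Sum>s\<in>S. G s * a m s)"
      unfolding a_def using int by (subst Bochner_Integration.integral_sum) auto
    also have "\<bar>\<dots>\<bar> \<le> (\<Sum>s\<in>S. \<bar>a m s\<bar>)"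
      using G by (intro order_trans[OF sum_abs] sum_mono) (auto simp: abs_mult mult_left_le_one_le)
    finally show "\<bar>\<integral>x. square_wave i (Suc m) x * G (pattern i ms x) \<partial>\<gamma>\<bar> \<le> \<epsilon>" using small by linarith
  qed
qed

text \<open>The waves with frequencies \<open>ms\<close> behave like independent fair signs, up to \<open>\<epsilon>\<close>, and at the
  \<open>k\<close>-th of the increasing times \<open>ts\<close> the semigroup multiplies the waves from position
  \<open>k\<close> on by \<open>\<kappa>\<close> and erases those before it.  The most recently chosen (highest) frequency and the
  smallest time are at the heads of the lists.\<close>

definition simulates :: "'n \<Rightarrow> nat \<Rightarrow> real \<Rightarrow> nat list \<Rightarrow> real list \<Rightarrow> bool" where
  "simulates i N \<epsilon> ms ts \<longleftrightarrow>
     length ms = N \<and> length ts = Suc N \<and> (\<forall>m\<in>set ms. m > 0) \<and> (\<forall>t\<in>set ts. t > 0) \<and> sorted_wrt (<) ts \<and>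
     (\<forall>k\<le>N. \<forall>j<N.
        (\<integral>x. \<bar>H (ts ! k) (square_wave i (ms ! j)) x - (if k \<le> j then \<kappa> * square_wave i (ms ! j) x else 0)\<bar> \<partial>\<gamma>) \<le> \<epsilon>) \<and>
     (\<forall>F. (\<forall>s. \<bar>F s\<bar> \<le> 1) \<longrightarrow>
        \<bar>(\<integral>x. F (pattern i ms x) \<partial>\<gamma>) - measure \<gamma> UNIV * sign_avg N F\<bar> \<le> \<epsilon>)"

text \<open>Choose the new frequency so high that all old times erase its wave and that the wave is uncorrelated
  with every function of the old ones; then choose the new time so small that all waves survive.\<close>

lemma exists_simulates:
  "\<epsilon> > 0 \<Longrightarrow> \<exists>ms ts. simulates i N \<epsilon> ms ts"
proof (induction N arbitrary: \<epsilon>)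
  case 0
  have "simulates i 0 \<epsilon> [] [1]"
    using 0 by (auto simp: simulates_def)
  then show ?case by blast
next
  case (Suc N)
  then obtain ms ts where IH: "simulates i N (\<epsilon> / 2) ms ts" by (metis half_gt_zero)
  note IH = IH[unfolded simulates_def]
  have "\<forall>\<^sub>F m in sequentially. \<forall>t\<in>set ts. (\<integral>x. \<bar>H t (square_wave i (Suc m)) x\<bar> \<partial>\<gamma>) < \<epsilon>"
    using IH Suc.prems by (intro eventually_ball_finite ballI order_tendstoD(2)[OF ou_semigroup_square_wave_L1_tendsto_0]) auto
  moreover have "\<forall>\<^sub>F m in sequentially. \<forall>G. (\<forall>s. \<bar>G s\<bar> \<le> (1::real)) \<longrightarrow>
    \<bar>\<integral>x. square_wave i (Suc m) x * G (pattern i ms x) \<partial>\<gamma>\<bar> \<le> \<epsilon> / 2"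
    using IH Suc.prems by (intro eventually_square_wave_uncorrelated) auto
  ultimately have "\<forall>\<^sub>F m in sequentially. (\<forall>t\<in>set ts. (\<integral>x. \<bar>H t (square_wave i (Suc m)) x\<bar> \<partial>\<gamma>) < \<epsilon>) \<and>
    (\<forall>G. (\<forall>s. \<bar>G s\<bar> \<le> (1::real)) \<longrightarrow> \<bar>\<integral>x. square_wave i (Suc m) x * G (pattern i ms x) \<partial>\<gamma>\<bar> \<le> \<epsilon> / 2)"
    by (rule eventually_conj)
  then obtain m0 where m0: "\<forall>t\<in>set ts. (\<integral>x. \<bar>H t (square_wave i (Suc m0)) x\<bar> \<partial>\<gamma>) < \<epsilon>"
    "\<And>G. (\<forall>s. \<bar>G s\<bar> \<le> (1::real)) \<Longrightarrow> \<bar>\<integral>x. square_wave i (Suc m0) x * G (pattern i ms x) \<partial>\<gamma>\<bar> \<le> \<epsilon> / 2"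
    using eventually_happens'[OF sequentially_bot] by blast
  define m where "m = Suc m0"
  have ts0: "ts ! 0 > 0" using IH by (metis nth_mem zero_less_Suc)
  have "\<forall>\<^sub>F k in sequentially. \<forall>m'\<in>set (m # ms). (\<integral>x. \<bar>H (small k) (square_wave i m') x - \<kappa> * square_wave i m' x\<bar> \<partial>\<gamma>) < \<epsilon>"
    using IH Suc.prems
    by (intro eventually_ball_finite ballI order_tendstoD(2)[OF ou_semigroup_square_wave_L1_tendsto_identity]) (auto simp: m_def)
  moreover have "\<forall>\<^sub>F k in sequentially. small k < ts ! 0"
    using ts0 by (rule order_tendstoD(2)[OF LIMSEQ_inverse_real_of_nat])
  ultimately have "\<forall>\<^sub>F k in sequentially. small k < ts ! 0 \<and>
    (\<forall>m'\<in>set (m # ms). (\<integral>x. \<bar>H (small k) (square_wave i m') x - \<kappa> * square_wave i m' x\<bar> \<partial>\<gamma>) < \<epsilon>)"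
    by eventually_elim blast
  then obtain k0 where k0: "small k0 < ts ! 0"
    "\<forall>m'\<in>set (m # ms). (\<integral>x. \<bar>H (small k0) (square_wave i m') x - \<kappa> * square_wave i m' x\<bar> \<partial>\<gamma>) < \<epsilon>"
    using eventually_happens'[OF sequentially_bot] by blast
  define t where "t = small k0"
  have t: "t > 0" "t < ts ! 0" using k0 by (simp_all add: t_def)
  have "simulates i (Suc N) \<epsilon> (m # ms) (t # ts)"
    unfolding simulates_def
  proof (intro conjI allI impI)
    show "length (m # ms) = Suc N" "length (t # ts) = Suc (Suc N)" using IH by auto
    show "\<forall>m\<in>set (m # ms). m > 0" using IH by (auto simp: m_def)
    show "\<forall>t\<in>set (t # ts). t > 0" using IH t by auto
    have "t < s" if "s \<in> set ts" for s
    proof -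
      obtain k where k: "k < length ts" "s = ts ! k" using \<open>s \<in> set ts\<close> by (metis in_set_conv_nth)
      then have "ts ! 0 \<le> s" using IH sorted_wrt_nth_less[of "(<)" ts 0 k] by (cases k) auto
      then show ?thesis using t by simp
    qed
    then show "sorted_wrt (<) (t # ts)" using IH by simp
  next
    fix k j assume k: "k \<le> Suc N" and j: "j < Suc N"
    show "(\<integral>x. \<bar>H ((t # ts) ! k) (square_wave i ((m # ms) ! j)) x -
        (if k \<le> j then \<kappa> * square_wave i ((m # ms) ! j) x else 0)\<bar> \<partial>\<gamma>) \<le> \<epsilon>"
    proof (cases k)
      case 0
      have "(m # ms) ! j \<in> set (m # ms)" using IH j by (intro nth_mem) simp
      then show ?thesis using k0(2) 0 unfolding t_def by (auto simp del: list.set)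
    next
      case (Suc k')
      show ?thesis
      proof (cases j)
        case 0
        have "ts ! k' \<in> set ts" using IH k Suc by (intro nth_mem) simp
        then show ?thesis using m0(1) Suc 0 by (simp add: m_def less_imp_le)
      next
        case (Suc j')
        have "(\<integral>x. \<bar>H (ts ! k') (square_wave i (ms ! j')) x - (if k' \<le> j' then \<kappa> * square_wave i (ms ! j') x else 0)\<bar> \<partial>\<gamma>) \<le> \<epsilon> / 2"
          using IH k j \<open>k = Suc k'\<close> Suc by simp
        then show ?thesis
          unfolding \<open>k = Suc k'\<close> \<open>j = Suc j'\<close> nth_Cons_Suc Suc_le_mono using Suc.prems by simp
      qed
    qed
  next
    fix F :: "real list \<Rightarrow> real" assume F: "\<forall>s. \<bar>F s\<bar> \<le> 1"
    note borel_measurable_pattern[measurable]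
    \<comment> \<open>Split \<open>F\<close> into its mean over the new sign and the coefficient of the new sign.\<close>
    define G1 where "G1 s = (F (1 # s) + F (-1 # s)) / 2" for s
    define G2 where "G2 s = (F (1 # s) - F (-1 # s)) / 2" for s
    have b: "\<bar>G1 s\<bar> \<le> 1" "\<bar>G2 s\<bar> \<le> 1" for s
      using F[rule_format, of "1 # s"] F[rule_format, of "-1 # s"] by (auto simp: G1_def G2_def abs_le_iff)
    have "(\<integral>x. F (pattern i (m # ms) x) \<partial>\<gamma>) = (\<integral>x. G1 (pattern i ms x) + square_wave i m x * G2 (pattern i ms x) \<partial>\<gamma>)"
    proof (rule Bochner_Integration.integral_cong[OF refl])
      fix x
      show "F (pattern i (m # ms) x) = G1 (pattern i ms x) + square_wave i m x * G2 (pattern i ms x)"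
        using square_wave_cases[of i m x] by (auto simp: G1_def G2_def field_simps)
    qed
    also have "\<dots> = (\<integral>x. G1 (pattern i ms x) \<partial>\<gamma>) + (\<integral>x. square_wave i m x * G2 (pattern i ms x) \<partial>\<gamma>)"
      by (intro Bochner_Integration.integral_add integrable_ou_measure_bounded[of _ 1])
        (use b in \<open>auto simp: abs_mult\<close>)
    finally have 1: "(\<integral>x. F (pattern i (m # ms) x) \<partial>\<gamma>) = \<dots>" .
    have 2: "sign_avg (Suc N) F = sign_avg N G1"
    proof -
      have "sign_avg N G1 = sign_avg N (\<lambda>s. (F (1 # s) + F (-1 # s)) * (1/2))"
        by (simp add: G1_def[abs_def])
      then show ?thesis unfolding sign_avg_multc sign_avg_add by simp
    qed
    have "\<bar>(\<integral>x. G1 (pattern i ms x) \<partial>\<gamma>) - measure \<gamma> UNIV * sign_avg N G1\<bar> \<le> \<epsilon> / 2"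
      using IH b by blast
    moreover have "\<bar>\<integral>x. square_wave i m x * G2 (pattern i ms x) \<partial>\<gamma>\<bar> \<le> \<epsilon> / 2"
      unfolding m_def using b by (intro m0(2)) blast
    ultimately show "\<bar>(\<integral>x. F (pattern i (m # ms) x) \<partial>\<gamma>) - measure \<gamma> UNIV * sign_avg (Suc N) F\<bar> \<le> \<epsilon>"
      unfolding 1 2 by linarith
  qed
  then show ?case by blast
qed

text \<open>The constants \<open>C\<close> and \<open>c\<close> do not depend on the level \<open>\<alpha>\<close>: functions with a fixed bound on
  their \<open>L\<^sup>p\<close> norm have arbitrarily large variation on sets of a fixed measure.  The function
  is the normalised sum of \<open>N\<close> simulated signs.\<close>

lemma large_variation:
  assumes p: "p \<ge> 1"
  obtains C c where "C > 0" "c > 0"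
    "\<And>\<alpha>. \<alpha> > 0 \<Longrightarrow> \<exists>f M. f \<in> borel_measurable borel \<and> (\<forall>u. \<bar>f u\<bar> \<le> M) \<and>
       (\<integral>x. \<bar>f x\<bar> powr p \<partial>\<gamma>) \<le> C \<and> c \<le> measure \<gamma> {x. ou_variation Q B 2 f x > ennreal \<alpha>}"
proof -
  interpret finite_measure \<gamma> by (rule finite_ou_measure)
  obtain C0 where C0: "C0 \<ge> 0" "\<And>N. N \<ge> 1 \<Longrightarrow> sign_avg N (\<lambda>xs. \<bar>sum_list xs / sqrt N\<bar> powr p) \<le> C0"
    using sign_avg_moment[OF p] by blast
  define K0 where "K0 = measure \<gamma> UNIV"
  have K0: "K0 > 0" unfolding K0_def by (rule measure_ou_measure_pos)
  show ?thesis
  proof (rule that[of "K0 * C0 + 1" "K0 / 8"])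
    fix \<alpha> :: real assume \<alpha>: "\<alpha> > 0"
    \<comment> \<open>This makes the ideal walk exceed the level by enough to absorb all errors.\<close>
    define M where "M = 4 * (\<alpha>\<^sup>2 + 2) / \<kappa>\<^sup>2"
    have M: "M > 0" using \<kappa>_pos by (auto simp: M_def intro!: divide_pos_pos add_nonneg_pos)
    obtain w l where w: "w \<ge> (1::nat)"
      and cov: "sign_avg (w * 2^l) (\<lambda>xs. of_bool (uncovered w M l xs \<le> real w * 2^l / 2)) \<ge> 1/2"
      using sign_avg_mostly_covered[OF M] by blast
    define N where "N = w * 2^l"
    have N: "N \<ge> 1" "real N > 0" using w by (simp_all add: N_def)
    \<comment> \<open>The pointwise error for which the additive loss in \<open>block_var_perturb\<close> is exactly \<open>1\<close>.\<close>
    define \<eta> :: real where "\<eta> = 1 / sqrt (4 * 2^l)"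
    have \<eta>: "\<eta> > 0" "4 * \<eta>\<^sup>2 * 2^l = 1" by (simp_all add: \<eta>_def power_divide)
    \<comment> \<open>A bound for \<open>\<bar>f\<bar> powr p\<close>, which scales it into the range \<open>[0,1]\<close> of the test functions.\<close>
    define Bd where "Bd = sqrt N powr p"
    have Bd: "Bd > 0" using N by (simp add: Bd_def)
    define NN where "NN = real (Suc N) * real N"
    have NN: "NN > 0" using N by (simp add: NN_def)
    \<comment> \<open>The three terms control the probability of good patterns, the \<open>L\<^sup>p\<close> norm of \<open>f\<close>, and the measure of the exceptional set.\<close>
    define \<epsilon> where "\<epsilon> = min (K0 / 4) (min (1 / Bd) (K0 / 8 * \<eta> / NN))"
    have \<epsilon>: "\<epsilon> > 0" "\<epsilon> \<le> K0 / 4" "\<epsilon> \<le> 1 / Bd" "\<epsilon> \<le> K0 / 8 * \<eta> / NN"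
    proof -
      have "0 < K0 / 8 * \<eta> / NN" using K0 \<eta> NN by simp
      then show "\<epsilon> > 0" using K0 Bd by (simp add: \<epsilon>_def)
      show "\<epsilon> \<le> K0 / 4" "\<epsilon> \<le> 1 / Bd" "\<epsilon> \<le> K0 / 8 * \<eta> / NN"
        unfolding \<epsilon>_def by linarith+
    qed
    fix i :: 'n
    obtain ms ts where sim: "simulates i N \<epsilon> ms ts" using exists_simulates[OF \<epsilon>(1)] by blast
    note sim = sim[unfolded simulates_def]
    have sorted_ts: "sorted_wrt (<) ts" and length_ts: "length ts = Suc N" using sim by blast+
    define X where "X x = pattern i ms x" for x
    define f where "f x = sum_list (X x) / sqrt N" for x
    have lenX: "length (X x) = N" for x using sim by (simp add: X_def)
    have f_meas: "f \<in> borel_measurable borel"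
      unfolding f_def[abs_def] X_def by (rule borel_measurable_pattern)
    have f_bound: "\<bar>f x\<bar> \<le> sqrt N" for x
      using abs_sum_pattern[where i = i and ms = ms and x = x] sim N by (simp add: f_def X_def field_simps)
    have X_nth: "X x ! j = square_wave i (ms ! j) x" if "j < N" for x j using that sim by (simp add: X_def)
    have f_sum: "f = (\<lambda>u. 1 / sqrt N * (\<Sum>j<N. square_wave i (ms ! j) u))"
    proof
      fix u
      have "sum_list (X u) = (\<Sum>j<N. X u ! j)" by (simp add: sum_list_sum_nth lenX lessThan_atLeast0)
      also have "\<dots> = (\<Sum>j<N. square_wave i (ms ! j) u)" by (intro sum.cong) (auto simp: X_nth)
      finally show "f u = 1 / sqrt N * (\<Sum>j<N. square_wave i (ms ! j) u)" by (simp add: f_def)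
    qed
    have moment: "(\<integral>x. \<bar>f x\<bar> powr p \<partial>\<gamma>) \<le> K0 * C0 + 1"
    proof -
      define F where "F xs = min 1 (\<bar>sum_list xs / sqrt N\<bar> powr p * (1 / Bd))" for xs
      have "\<bar>f x\<bar> powr p \<le> Bd" for x
        unfolding Bd_def using f_bound p by (intro powr_mono2) auto
      then have "\<bar>f x\<bar> powr p = Bd * F (X x)" for x
        using Bd by (simp add: F_def f_def)
      then have "(\<integral>x. \<bar>f x\<bar> powr p \<partial>\<gamma>) = Bd * (\<integral>x. F (X x) \<partial>\<gamma>)" by simp
      also have "\<dots> \<le> Bd * (K0 * sign_avg N F + \<epsilon>)"
      proof (rule mult_left_mono)
        have "\<forall>xs. \<bar>F xs\<bar> \<le> 1" using Bd by (simp add: F_def)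
        then have "\<bar>(\<integral>x. F (X x) \<partial>\<gamma>) - K0 * sign_avg N F\<bar> \<le> \<epsilon>" using sim unfolding X_def K0_def by blast
        then show "(\<integral>x. F (X x) \<partial>\<gamma>) \<le> K0 * sign_avg N F + \<epsilon>" by linarith
      qed (use Bd in simp)
      also have "\<dots> \<le> Bd * (K0 * (C0 * (1 / Bd)) + 1 / Bd)"
      proof (intro mult_left_mono add_mono \<epsilon>)
        have "sign_avg N F \<le> sign_avg N (\<lambda>xs. \<bar>sum_list xs / sqrt N\<bar> powr p * (1 / Bd))"
          by (intro sign_avg_mono) (simp add: F_def)
        also have "\<dots> \<le> C0 * (1 / Bd)"
          unfolding sign_avg_multc using C0(2)[OF N(1)] Bd by (intro mult_right_mono) auto
        finally show "sign_avg N F \<le> C0 * (1 / Bd)" .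
      qed (use K0 Bd in auto)
      also have "\<dots> = K0 * C0 + 1" using Bd by (simp add: field_simps)
      finally show ?thesis .
    qed
    define e where "e k j x = \<bar>H (ts ! k) (square_wave i (ms ! j)) x - (if k \<le> j then \<kappa> * square_wave i (ms ! j) x else 0)\<bar>" for k j x
    \<comment> \<open>The sum of all simulation errors; by Markov's inequality it is below \<open>\<eta>\<close> off a set of measure at most \<open>K0 / 8\<close>.\<close>
    define D where "D x = (\<Sum>k\<le>N. \<Sum>j<N. e k j x)" for x
    have ts_pos: "ts ! k > 0" if "k \<le> N" for k using that sim nth_mem[of k ts] by simp
    have e_int: "integrable \<gamma> (e k j)" if "k \<le> N" for k j
    proof (rule integrable_ou_measure_bounded)
      note t = ts_pos[OF that]
      show "e k j \<in> borel_measurable borel"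
        using borel_measurable_ou_semigroup[OF t borel_measurable_square_wave, where M = 1] unfolding e_def[abs_def] by simp
      show "\<bar>e k j x\<bar> \<le> mass (ts ! k) + \<kappa>" for x
        using ou_semigroup_bound[OF t borel_measurable_square_wave, of i "ms ! j" 1 x] \<kappa>_pos abs_square_wave[of i "ms ! j" x]
        by (auto simp: e_def abs_mult intro!: order_trans[OF abs_triangle_ineq4])
    qed
    have D_int: "integrable \<gamma> D" unfolding D_def[abs_def] by (intro Bochner_Integration.integrable_sum e_int) auto
    have "(\<integral>x. D x \<partial>\<gamma>) = (\<Sum>k\<le>N. \<Sum>j<N. \<integral>x. e k j x \<partial>\<gamma>)"
      unfolding D_def by (simp add: Bochner_Integration.integral_sum Bochner_Integration.integrable_sum e_int)
    also have "\<dots> \<le> (\<Sum>k\<le>N. \<Sum>j<N. \<epsilon>)"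
      using sim unfolding e_def by (intro sum_mono) auto
    also have "\<dots> = NN * \<epsilon>" by (simp add: NN_def)
    also have "\<dots> \<le> NN * (K0 / 8 * \<eta> / NN)" using \<epsilon>(4) NN by (intro mult_left_mono) auto
    also have "\<dots> = K0 / 8 * \<eta>" using NN by simp
    finally have D_small: "(\<integral>x. D x \<partial>\<gamma>) \<le> K0 / 8 * \<eta>" .
    define bad where "bad = {x. \<eta> \<le> D x}"
    have D_meas: "D \<in> borel_measurable \<gamma>" using D_int by (rule borel_measurable_integrable)
    have bad_sets: "bad \<in> sets \<gamma>" using D_meas unfolding bad_def by measurable
    have e_nonneg: "e k j x \<ge> 0" for k j x by (simp add: e_def)
    have D_nonneg: "D x \<ge> 0" for x unfolding D_def by (intro sum_nonneg e_nonneg)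
    have "\<eta> * measure \<gamma> bad = (\<integral>x. \<eta> * indicator bad x \<partial>\<gamma>)" by simp
    also have "\<dots> \<le> (\<integral>x. D x \<partial>\<gamma>)"
    proof (rule integral_mono[OF _ D_int])
      show "integrable \<gamma> (\<lambda>x. \<eta> * indicator bad x)"
        by (intro integrable_mult_right integrable_real_indicator bad_sets) (simp add: emeasure_eq_measure)
      show "\<eta> * indicator bad x \<le> D x" for x using D_nonneg by (auto simp: bad_def indicator_def)
    qed
    finally have "\<eta> * measure \<gamma> bad \<le> \<eta> * (K0 / 8)" using D_small by (simp add: mult.commute)
    then have bad_small: "measure \<gamma> bad \<le> K0 / 8" using \<eta> by simp
    \<comment> \<open>At least half of the steps are covered; for truly random signs this has probability at least \<open>1/2\<close>.\<close>
    define good where "good = {x. uncovered w M l (X x) \<le> real w * 2^l / 2}"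
    have good_sets: "good \<in> sets \<gamma>"
    proof -
      have "(\<lambda>x. uncovered w M l (X x)) \<in> borel_measurable borel" unfolding X_def by (rule borel_measurable_pattern)
      then have "good \<in> sets borel" unfolding good_def by measurable
      then show ?thesis by simp
    qed
    have good_large: "measure \<gamma> good \<ge> K0 / 4"
    proof -
      define F :: "real list \<Rightarrow> real" where "F xs = of_bool (uncovered w M l xs \<le> real w * 2^l / 2)" for xs
      have "\<forall>xs. \<bar>F xs\<bar> \<le> 1" by (simp add: F_def)
      then have "\<bar>(\<integral>x. F (X x) \<partial>\<gamma>) - K0 * sign_avg N F\<bar> \<le> \<epsilon>" using sim unfolding X_def K0_def by blast
      moreover have "K0 * (1/2) \<le> K0 * sign_avg N F"
        using cov K0 unfolding F_def N_def by (intro mult_left_mono) auto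
      moreover have "(\<integral>x. F (X x) \<partial>\<gamma>) = measure \<gamma> good"
      proof -
        have "(\<lambda>x. F (X x)) = indicator good" by (auto simp: F_def good_def indicator_def)
        then show ?thesis by simp
      qed
      ultimately show ?thesis using \<epsilon>(2) by linarith
    qed
    have sub: "good - bad \<subseteq> {x. ou_variation Q B 2 f x > ennreal \<alpha>}"
    proof safe
      fix x assume x: "x \<in> good" "x \<notin> bad"
      define y where "y k = \<kappa> / sqrt N * sum_list (drop k (X x))" for k
      define z where "z k = H (ts ! k) f x" for k
      have zy: "\<bar>z k - y k\<bar> \<le> \<eta>" if k: "k \<le> N" for k
      proof -
        have "z k = 1 / sqrt N * (\<Sum>j<N. H (ts ! k) (square_wave i (ms ! j)) x)"
          unfolding z_def f_sum by (rule ou_semigroup_sum_square_wave[OF ts_pos[OF k]])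
        moreover have "y k = 1 / sqrt N * (\<Sum>j<N. if k \<le> j then \<kappa> * square_wave i (ms ! j) x else 0)"
          unfolding y_def sum_list_drop_conv_sum lenX
          by (simp add: sum_distrib_left X_nth if_distrib cong: if_cong)
        ultimately have "z k - y k = 1 / sqrt N * (\<Sum>j<N. H (ts ! k) (square_wave i (ms ! j)) x - (if k \<le> j then \<kappa> * square_wave i (ms ! j) x else 0))"
          by (simp add: sum_subtractf diff_divide_distrib)
        then have "\<bar>z k - y k\<bar> = 1 / sqrt N * \<bar>\<Sum>j<N. H (ts ! k) (square_wave i (ms ! j)) x - (if k \<le> j then \<kappa> * square_wave i (ms ! j) x else 0)\<bar>"
          by (simp add: abs_mult)
        also have "\<dots> \<le> 1 * (\<Sum>j<N. e k j x)"
          unfolding e_def using N by (intro mult_mono sum_abs) auto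
        also have "\<dots> \<le> D x"
          unfolding D_def using k e_nonneg by (simp, intro member_le_sum) (auto intro: sum_nonneg)
        also have "\<dots> \<le> \<eta>" using x(2) by (simp add: bad_def)
        finally show ?thesis .
      qed
      have "M * (N / 2) \<le> M * (real w * 2^l - uncovered w M l (X x))"
        using x(1) M by (intro mult_left_mono) (auto simp: good_def N_def)
      also have "\<dots> \<le> block_var w l 0 (\<lambda>k. sum_list (drop k (X x)))"
        by (rule block_var_ge_covered) (use M lenX in \<open>auto simp: N_def\<close>)
      finally have "(\<kappa> / sqrt N)\<^sup>2 * (M * (N / 2)) \<le> block_var w l 0 y"
        unfolding y_def block_var_cmult by (rule mult_left_mono) simp
      moreover have "(\<kappa> / sqrt N)\<^sup>2 * (M * (N / 2)) = 2 * (\<alpha>\<^sup>2 + 2)"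
        using N \<kappa>_pos by (simp add: M_def power_divide)
      ultimately have "\<alpha>\<^sup>2 + 2 \<le> block_var w l 0 y / 2" by simp
      moreover have "block_var w l 0 y / 2 - 4 * \<eta>\<^sup>2 * 2^l \<le> block_var w l 0 z"
        by (rule block_var_perturb) (use zy in \<open>simp add: N_def\<close>)
      ultimately have "\<alpha>\<^sup>2 < block_var w l 0 z" using \<eta>(2) by linarith
      then have "\<alpha> < sqrt (block_var w l 0 z)" by (rule real_less_rsqrt)
      then have "ennreal \<alpha> < ennreal (sqrt (block_var w l 0 z))" using \<alpha> by (simp add: ennreal_less_iff)
      also have "\<dots> \<le> ou_variation Q B 2 f x"
        unfolding ou_variation_def z_def
      proof (rule variation_ge_block_var[OF w])
        show "strict_mono_on {0..w * 2^l} (\<lambda>k. ts ! k)"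
          using sorted_wrt_nth_less[OF sorted_ts] by (intro strict_mono_onI) (simp add: N_def[symmetric] length_ts)
        show "(\<lambda>k. ts ! k) ` {0..w * 2^l} \<subseteq> {0<..}" using ts_pos by (auto simp: N_def)
      qed
      finally show "ennreal \<alpha> < ou_variation Q B 2 f x" .
    qed
    have "K0 / 8 \<le> measure \<gamma> good - measure \<gamma> bad" using good_large bad_small by linarith
    also have "\<dots> \<le> measure \<gamma> (good - bad)"
    proof -
      have "measure \<gamma> good \<le> measure \<gamma> ((good - bad) \<union> bad)"
        using good_sets bad_sets by (intro finite_measure_mono) auto
      also have "\<dots> \<le> measure \<gamma> (good - bad) + measure \<gamma> bad"
        using good_sets bad_sets by (intro measure_Un_le) auto
      finally show ?thesis by simp
    qed
    also have "\<dots> \<le> measure \<gamma> {x. ou_variation Q B 2 f x > ennreal \<alpha>}"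
      using open_ou_variation_greater[OF f_meas f_bound, of \<alpha>] \<alpha> by (intro finite_measure_mono sub) simp
    finally have large: "K0 / 8 \<le> measure \<gamma> {x. ou_variation Q B 2 f x > ennreal \<alpha>}" .
    show "\<exists>f M. f \<in> borel_measurable borel \<and> (\<forall>u. \<bar>f u\<bar> \<le> M) \<and>
       (\<integral>x. \<bar>f x\<bar> powr p \<partial>\<gamma>) \<le> K0 * C0 + 1 \<and> K0 / 8 \<le> measure \<gamma> {x. ou_variation Q B 2 f x > ennreal \<alpha>}"
      using f_meas f_bound moment large by blast
  qed (use K0 C0(1) in \<open>auto intro!: add_nonneg_pos\<close>)
qed

section \<open>Failure of the strong and weak type bounds\<close>

lemma ennreal_powr_ennreal: "x \<ge> 0 \<Longrightarrow> ennreal_powr (ennreal x) a = ennreal (x powr a)"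
  by (simp add: ennreal_powr_def)

lemma ennreal_powr_mono:
  assumes "x \<le> y" "a \<ge> 0" shows "ennreal_powr x a \<le> ennreal_powr y a"
proof (cases "y = \<infinity>")
  case False
  then have "x \<noteq> \<infinity>" using assms(1) by (auto simp: top_unique)
  then show ?thesis using False assms
    by (auto simp: ennreal_powr_def less_top intro!: ennreal_leI powr_mono2 enn2real_mono)
qed (simp add: ennreal_powr_def)

lemma Lp_norm_bounded:
  assumes f: "f \<in> borel_measurable borel" "\<And>u. \<bar>f u\<bar> \<le> (M::real)" and p: "p > 0"
  shows "Lp_norm \<gamma> p (\<lambda>x. ennreal \<bar>f x\<bar>) = ennreal ((\<integral>x. \<bar>f x\<bar> powr p \<partial>\<gamma>) powr (1/p))"
proof -
  have int: "integrable \<gamma> (\<lambda>x. \<bar>f x\<bar> powr p)"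
    by (rule integrable_ou_measure_bounded[of _ "M powr p"]) (use f p in \<open>auto intro!: powr_mono2\<close>)
  have "(\<integral>\<^sup>+x. ennreal_powr (ennreal \<bar>f x\<bar>) p \<partial>\<gamma>) = ennreal (\<integral>x. \<bar>f x\<bar> powr p \<partial>\<gamma>)"
    using nn_integral_eq_integral[OF int] by (simp add: ennreal_powr_ennreal)
  then show ?thesis
    unfolding Lp_norm_def by (simp add: ennreal_powr_ennreal Bochner_Integration.integral_nonneg)
qed

lemma variation_not_weak_type:
  assumes p: "p \<ge> 1" shows "\<not> weak_type \<gamma> p (ou_variation Q B 2)"
proof
  assume "weak_type \<gamma> p (ou_variation Q B 2)"
  then obtain D :: real where D: "\<And>\<alpha> f. \<alpha> > 0 \<Longrightarrow> f \<in> Lp_functions \<gamma> p \<Longrightarrow>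
      emeasure \<gamma> {x \<in> space \<gamma>. ou_variation Q B 2 f x > ennreal \<alpha>}
        \<le> ennreal D * ennreal (\<alpha> powr (- p)) * ennreal_powr (Lp_norm \<gamma> p (\<lambda>x. ennreal \<bar>f x\<bar>)) p"
    unfolding weak_type_def by blast
  obtain C c where C: "C > 0" "c > 0"
    "\<And>\<alpha>. \<alpha> > 0 \<Longrightarrow> \<exists>f M. f \<in> borel_measurable borel \<and> (\<forall>u. \<bar>f u\<bar> \<le> M) \<and>
       (\<integral>x. \<bar>f x\<bar> powr p \<partial>\<gamma>) \<le> C \<and> c \<le> measure \<gamma> {x. ou_variation Q B 2 f x > ennreal \<alpha>}"
    using large_variation[OF p] by metis
  \<comment> \<open>At this level the right hand side of the weak type inequality drops below \<open>c\<close>.\<close>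
  define \<alpha> where "\<alpha> = \<bar>D\<bar> * C / c + 1"
  have \<alpha>: "\<alpha> \<ge> 1" using C by (simp add: \<alpha>_def)
  then obtain f M where f: "f \<in> borel_measurable borel" "\<And>u. \<bar>f u\<bar> \<le> M"
    "(\<integral>x. \<bar>f x\<bar> powr p \<partial>\<gamma>) \<le> C" "c \<le> measure \<gamma> {x. ou_variation Q B 2 f x > ennreal \<alpha>}"
    using C(3)[of \<alpha>] by auto
  let ?I = "\<integral>x. \<bar>f x\<bar> powr p \<partial>\<gamma>"
  have I: "?I \<ge> 0" by (intro Bochner_Integration.integral_nonneg) simp
  have n: "Lp_norm \<gamma> p (\<lambda>x. ennreal \<bar>f x\<bar>) = ennreal (?I powr (1/p))"
    by (rule Lp_norm_bounded[OF f(1,2)]) (use p in simp)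
  then have "f \<in> Lp_functions \<gamma> p" using f(1) by (simp add: Lp_functions_def)
  from D[OF _ this, of \<alpha>] \<alpha>
  have "emeasure \<gamma> {x. ou_variation Q B 2 f x > ennreal \<alpha>} \<le> ennreal D * ennreal (\<alpha> powr (- p)) * ennreal ?I"
    using I p by (simp add: n ennreal_powr_ennreal powr_powr)
  also have "\<dots> \<le> ennreal \<bar>D\<bar> * ennreal (1 / \<alpha>) * ennreal C"
  proof (intro mult_mono ennreal_leI)
    have "\<alpha> powr (- p) \<le> \<alpha> powr (- 1)" using \<alpha> p by (intro powr_mono) auto
    then show "\<alpha> powr (- p) \<le> 1 / \<alpha>" using \<alpha> by (simp add: powr_minus_divide)
  qed (use f in auto)
  also have "\<dots> = ennreal (\<bar>D\<bar> * C / \<alpha>)" using \<alpha> C by (simp add: ennreal_mult'[symmetric])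
  finally have "measure \<gamma> {x. ou_variation Q B 2 f x > ennreal \<alpha>} \<le> \<bar>D\<bar> * C / \<alpha>"
    using \<alpha> C by (simp add: finite_measure.emeasure_eq_measure[OF finite_ou_measure] ennreal_le_iff)
  then have "c \<le> \<bar>D\<bar> * C / \<alpha>" using f(4) by linarith
  then have "c * \<alpha> \<le> \<bar>D\<bar> * C" using \<alpha> by (simp add: field_simps)
  moreover have "c * \<alpha> = \<bar>D\<bar> * C + c" using C(2) by (simp add: \<alpha>_def field_simps)
  ultimately show False using C(2) by linarith
qed

text \<open>By Chebyshev's inequality the \<open>L\<^sup>p\<close> norm of the variation is at least
  \<open>\<alpha> * c powr (1/p)\<close>.\<close>

lemma variation_not_strong_type:
  assumes p: "p \<ge> 1" shows "\<not> strong_type \<gamma> p (ou_variation Q B 2)"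
proof
  assume "strong_type \<gamma> p (ou_variation Q B 2)"
  then obtain D :: real where D: "\<And>f. f \<in> Lp_functions \<gamma> p \<Longrightarrow>
      Lp_norm \<gamma> p (ou_variation Q B 2 f) \<le> ennreal D * Lp_norm \<gamma> p (\<lambda>x. ennreal \<bar>f x\<bar>)"
    unfolding strong_type_def by blast
  obtain C c where C: "C > 0" "c > 0"
    "\<And>\<alpha>. \<alpha> > 0 \<Longrightarrow> \<exists>f M. f \<in> borel_measurable borel \<and> (\<forall>u. \<bar>f u\<bar> \<le> M) \<and>
       (\<integral>x. \<bar>f x\<bar> powr p \<partial>\<gamma>) \<le> C \<and> c \<le> measure \<gamma> {x. ou_variation Q B 2 f x > ennreal \<alpha>}"
    using large_variation[OF p] by metis
  define \<alpha> where "\<alpha> = \<bar>D\<bar> * C powr (1/p) / c powr (1/p) + 1"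
  have \<alpha>: "\<alpha> \<ge> 1" using C by (simp add: \<alpha>_def)
  then obtain f M where f: "f \<in> borel_measurable borel" "\<And>u. \<bar>f u\<bar> \<le> M"
    "(\<integral>x. \<bar>f x\<bar> powr p \<partial>\<gamma>) \<le> C" "c \<le> measure \<gamma> {x. ou_variation Q B 2 f x > ennreal \<alpha>}"
    using C(3)[of \<alpha>] by auto
  let ?I = "\<integral>x. \<bar>f x\<bar> powr p \<partial>\<gamma>" and ?A = "{x. ou_variation Q B 2 f x > ennreal \<alpha>}"
  have I: "?I \<ge> 0" by (intro Bochner_Integration.integral_nonneg) simp
  have n: "Lp_norm \<gamma> p (\<lambda>x. ennreal \<bar>f x\<bar>) = ennreal (?I powr (1/p))"
    by (rule Lp_norm_bounded[OF f(1,2)]) (use p in simp)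
  then have "f \<in> Lp_functions \<gamma> p" using f(1) by (simp add: Lp_functions_def)
  from D[OF this] have up: "Lp_norm \<gamma> p (ou_variation Q B 2 f) \<le> ennreal D * ennreal (?I powr (1/p))"
    unfolding n .
  have A: "?A \<in> sets \<gamma>" using open_ou_variation_greater[OF f(1,2), of \<alpha>] \<alpha> by simp
  have "ennreal (\<alpha> powr p * c) \<le> ennreal (\<alpha> powr p) * emeasure \<gamma> ?A"
    using f(4) C \<alpha> by (simp add: finite_measure.emeasure_eq_measure[OF finite_ou_measure] ennreal_mult'[symmetric] mult_left_mono ennreal_leI)
  also have "\<dots> = (\<integral>\<^sup>+x. ennreal (\<alpha> powr p) * indicator ?A x \<partial>\<gamma>)"
    using A by (simp add: nn_integral_cmult_indicator)
  also have "\<dots> \<le> (\<integral>\<^sup>+x. ennreal_powr (ou_variation Q B 2 f x) p \<partial>\<gamma>)"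
  proof (rule nn_integral_mono)
    fix x
    show "ennreal (\<alpha> powr p) * indicator ?A x \<le> ennreal_powr (ou_variation Q B 2 f x) p"
      using ennreal_powr_mono[of "ennreal \<alpha>" "ou_variation Q B 2 f x" p] \<alpha> p
      by (auto simp: indicator_def ennreal_powr_ennreal)
  qed
  finally have "ennreal_powr (ennreal (\<alpha> powr p * c)) (1/p) \<le> Lp_norm \<gamma> p (ou_variation Q B 2 f)"
    unfolding Lp_norm_def using p by (intro ennreal_powr_mono) auto
  also have "\<dots> \<le> ennreal (\<bar>D\<bar>) * ennreal (C powr (1/p))"
    using p I f(3) by (intro order_trans[OF up] mult_mono ennreal_leI powr_mono2) auto
  also have "ennreal_powr (ennreal (\<alpha> powr p * c)) (1/p) = ennreal (\<alpha> * c powr (1/p))"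
    using \<alpha> C p by (simp add: ennreal_powr_ennreal powr_mult powr_powr)
  finally have "\<alpha> * c powr (1/p) \<le> \<bar>D\<bar> * C powr (1/p)"
    by (simp add: ennreal_mult'[symmetric] ennreal_le_iff)
  moreover have "c powr (1/p) > 0" using C by simp
  ultimately show False by (simp add: \<alpha>_def field_simps)
qed

end

theorem theorem8p1:
  fixes Q B :: "real^'n^'n" and p :: real
  assumes "transpose Q = Q" and "positive_definite Q"
    and "\<And>z. complex_eigenvalue B z \<Longrightarrow> Re z < 0"
    and "1 \<le> p"
  shows "\<not> strong_type (ou_measure Q B) p (ou_variation Q B 2) \<and>
         \<not> weak_type (ou_measure Q B) p (ou_variation Q B 2)"
proof -
  interpret ornstein_uhlenbeck Q B using assms by unfold_locales auto
  show ?thesis using variation_not_strong_type variation_not_weak_type assms(4) by blast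
qed

end
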